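(* Let $S$ be a countable abelian semigroup with identity and let $(A,S,\alpha,L)$ be a dynamical system with extendible endomorphisms and an action of transfer operators. Then the family $X=\bigsqcup_{s\in S}X_s$ of Hilbert bimodules over $A$ associated to $(A,S,\alpha,L)$, endowed with the operation $$(s,x)(t,y):=\bigl(s+t, \lim_\lambda a_\lambda\alpha_s(b_\lambda\overline{\alpha_{t}}(1))\bigr)\quad\text{for } x=\lim_\lambda a_\lambda\overline{\alpha_s}(1)\in M_s,\ y=\lim_\lambda b_\lambda\overline{\alpha_t}(1)\in M_t,$$ is a product system over the semigroup $S$. Each fibre $X_s$ is essential, that is, $X_s=\overline{\operatorname{span}}\{\phi_s(a)x\mid a\in A, x\in X_s\}$.
   Context: System: $A$ is a (not necessarily unital) $C^*$-algebra with multiplier algebra $M(A)$; $S$ is written additively with identity $0$. $\alpha:S\to\operatorname{End}(A)$ is an action ($\alpha_{s+t}=\alpha_s\circ\alpha_t$, $\alpha_0=\operatorname{id}$) such that each $\alpha_s$ is extendible: it extends uniquely to an endomorphism $\overline{\alpha_s}$ of $M(A)$ with $\overline{\alpha_s}(1_{M(A)})=\lim\alpha_s(u_\lambda)$ (strict limit) for some (hence every) approximate unit $(u_\lambda)$ of $A$. An action of transfer operators $L$ is an action of $S$ ($L_{s+t}=L_s\circ L_t$, $L_0=\operatorname{id}$) by continuous linear positive maps $L_s:A\to A$ admitting continuous linear extensions $\overline{L_s}:M(A)\to M(A)$ with $L_s(\alpha_s(a)u)=a\overline{L_s}(u)$ for all $a\in A$, $u\in M(A)$, $s\in S$. Bimodules: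 a Hilbert bimodule over $A$ is a right Hilbert $A$-module $Y$ with a homomorphism $\phi:A\to\mathcal{L}(Y)$ giving the left action $a\cdot y=\phi(a)y$. For $s\in S$ put $A_s:=A\overline{\alpha_s}(1)$ with right action $x\cdot a:=x\alpha_s(a)$ and pre-inner product $\langle x,y\rangle_s:=L_s(x^*y)$. After modding out the elements $x$ with $\langle x,x\rangle_s=0$, let $M_s$ be the completion to a right Hilbert $A$-module. For $a\in A$, the map $x\in A_s\mapsto ax\in A_s$ extends to an adjointable operator $\phi_s(a)$ on $M_s$, giving a homomorphism $\phi_s:A\to\mathcal{L}(M_s)$. Set $X_s:=\{s\}\times M_s$, a Hilbert bimodule over $A$ with $(s,x)\cdot a=(s,x\alpha_s(a))$ and $\phi_s(a)(s,x)=(s,ax)$ for $x\in A_s$. The operation in the claim is the (well-defined) continuous extension of $(s,a\overline{\alpha_s}(1))(t,b\overline{\alpha_t}(1))=(s+t,a\alpha_s(b\overline{\alpha_t}(1)))$, $a,b\in A$. Product system: a family $X=\bigsqcup_{s\in S}X_s$ of Hilbert bimodules over $A$ is a product system over $S$ if $X$ is a semigroup and there is a semigroup homomorphism $p:X\to S$ with $p^{-1}(s)=X_s$ such that: for all $s,t\in S\setminus\{0\}$ the multiplication map $X_s\times X_t\to X_{s+t}$, $(x,y)\mapsto xy$, extends to an isomorphism $X_s\otimes_A X_t\cong X_{s+t}$ of Hilbert bimodules ($\otimes_A$ is the internal tensor product); $X_0=A$ with right action $x\cdot a=xa$ and left action $\phi_0(a)(x)=ax$; and the multiplications $X_0\times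 X_s\to X_s$, $X_s\times X_0\to X_s$ satisfy $ax=\phi_s(a)x$ and $xa=x\cdot a$ for $a\in A$, $x\in X_s$. *)

theory Defs
  imports "HOL-Analysis.Analysis"
begin

section \<open>C*-algebras\<close>

text \<open>Not necessarily unital, and possibly zero.\<close>

class cstar_algebra = banach + real_normed_algebra +
  fixes scaleC :: "complex \<Rightarrow> 'a \<Rightarrow> 'a"  (infixr "*\<^sub>C" 75)
    and star :: "'a \<Rightarrow> 'a"
  assumes scaleC_add_right: "c *\<^sub>C (x + y) = c *\<^sub>C x + c *\<^sub>C y"
    and scaleC_add_left: "(c + d) *\<^sub>C x = c *\<^sub>C x + d *\<^sub>C x"
    and scaleC_scaleC: "c *\<^sub>C d *\<^sub>C x = (c * d) *\<^sub>C x"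
    and scaleR_scaleC: "r *\<^sub>R x = complex_of_real r *\<^sub>C x"
    and norm_scaleC: "norm (c *\<^sub>C x) = cmod c * norm x"
    and mult_scaleC_left: "(c *\<^sub>C x) * y = c *\<^sub>C (x * y)"
    and mult_scaleC_right: "x * (c *\<^sub>C y) = c *\<^sub>C (x * y)"
    and star_star: "star (star x) = x"
    and star_add: "star (x + y) = star x + star y"
    and star_scaleC: "star (c *\<^sub>C x) = cnj c *\<^sub>C star x"
    and star_mult: "star (x * y) = star y * star x"
    and cstar_identity: "norm (star x * x) = (norm x)\<^sup>2"

definition cpositive :: "'a::cstar_algebra \<Rightarrow> bool"
  where "cpositive a \<longleftrightarrow> (\<exists>b. a = star b * b)"

definition clinear_map :: "('a::cstar_algebra \<Rightarrow> 'b::cstar_algebra) \<Rightarrow> bool"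
  where "clinear_map f \<longleftrightarrow>
    (\<forall>x y. f (x + y) = f x + f y) \<and> (\<forall>c x. f (c *\<^sub>C x) = c *\<^sub>C f x)"

definition star_hom :: "('a::cstar_algebra \<Rightarrow> 'b::cstar_algebra) \<Rightarrow> bool"
  where "star_hom f \<longleftrightarrow>
    clinear_map f \<and> (\<forall>x y. f (x * y) = f x * f y) \<and> (\<forall>x. f (star x) = star (f x))"

text \<open>
  Nets in \<open>A\<close> are rendered by filters on \<open>A\<close>: a net \<open>u\<close> corresponds to the filter of those
  sets that contain \<open>u\<close> eventually, and every proper filter arises in this way.
\<close>

definition approximate_unit :: "'a::cstar_algebra filter \<Rightarrow> bool"
  where "approximate_unit F \<longleftrightarrow>
    F \<noteq> bot \<and> (\<forall>\<^sub>F u in F. cpositive u \<and> norm u \<le> 1) \<and>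
    (\<forall>a. ((\<lambda>u. u * a) \<longlongrightarrow> a) F \<and> ((\<lambda>u. a * u) \<longlongrightarrow> a) F)"

lemma star_zero [simp]: "star (0::'a::cstar_algebra) = 0"
  using star_add[of "0::'a" 0] by simp

lemma star_scaleR: "star (r *\<^sub>R x) = r *\<^sub>R star (x::'a::cstar_algebra)"
  by (simp add: scaleR_scaleC star_scaleC)

lemma norm_star_le: "norm x \<le> norm (star (x::'a::cstar_algebra))"
proof (cases "x = 0")
  case False
  have "norm x * norm x \<le> norm (star x) * norm x"
    using norm_mult_ineq[of "star x" x] by (simp add: cstar_identity power2_eq_square)
  with False show ?thesis by simp
qed simp

lemma norm_star [simp]: "norm (star x) = norm (x::'a::cstar_algebra)"
  using norm_star_le[of x] norm_star_le[of "star x"] by (simp add: star_star)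

lemma bounded_linear_star: "bounded_linear (star :: 'a::cstar_algebra \<Rightarrow> 'a)"
  by (rule bounded_linear_intro[where K = 1]) (simp_all add: star_add star_scaleR)

lemma bounded_linear_scaleC: "bounded_linear (scaleC c :: 'a::cstar_algebra \<Rightarrow> 'a)"
  by (rule bounded_linear_intro[where K = "cmod c"])
    (simp_all add: scaleC_add_right scaleR_scaleC scaleC_scaleC norm_scaleC mult.commute)

lemma cstar_mult_eq_0:
  fixes x :: "'a::cstar_algebra"
  assumes "\<And>a. a * x = 0"
  shows "x = 0"
  using assms[of "star x"] cstar_identity[of x] by simp


section \<open>The multiplier algebra\<close>

text \<open>
  Double centralizers \<open>(l, r)\<close>, the multiplier \<open>m\<close> being represented by \<open>l a = m a\<close> and
  \<open>r a = a m\<close>.  The identities \<open>l (a b) = (l a) b\<close>, \<open>r (a b) = a (r b)\<close> and complex linearity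
  follow from \<open>a (l b) = (r a) b\<close>.
\<close>

typedef (overloaded) 'a multiplier =
  "{(l :: 'a::cstar_algebra \<Rightarrow>\<^sub>L 'a, r :: 'a \<Rightarrow>\<^sub>L 'a). \<forall>a b. a * l b = r a * b}"
  by (rule exI[of _ "(0, 0)"]) simp

setup_lifting type_definition_multiplier

lift_definition lmult :: "'a::cstar_algebra multiplier \<Rightarrow> 'a \<Rightarrow> 'a"  (infixr "\<cdot>\<^sub>l" 71)
  is "\<lambda>(l, r). blinfun_apply l" .

lift_definition rmult :: "'a::cstar_algebra \<Rightarrow> 'a multiplier \<Rightarrow> 'a"  (infixl "\<cdot>\<^sub>r" 71)
  is "\<lambda>a (l, r). blinfun_apply r a" .

lemma centralizer: "a * (m \<cdot>\<^sub>l b) = (a \<cdot>\<^sub>r m) * b"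
  by transfer auto

lemma multiplier_eqI:
  assumes "\<And>a. m \<cdot>\<^sub>l a = n \<cdot>\<^sub>l a" "\<And>a. a \<cdot>\<^sub>r m = a \<cdot>\<^sub>r n"
  shows "m = n"
  using assms by transfer (auto intro!: blinfun_eqI)

lemma star_mult_eq_0:
  fixes x :: "'a::cstar_algebra"
  assumes "\<And>a. x * a = 0"
  shows "x = 0"
proof -
  have "star x = 0"
    by (rule cstar_mult_eq_0) (metis assms star_mult star_star star_zero)
  then show ?thesis by (metis star_star star_zero)
qed

lemma multiplier_eqI_left:
  assumes "\<And>a. m \<cdot>\<^sub>l a = n \<cdot>\<^sub>l a"
  shows "m = n"
proof (rule multiplier_eqI[OF assms])
  fix a
  have "(a \<cdot>\<^sub>r m - a \<cdot>\<^sub>r n) * b = 0" for b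
    by (metis assms centralizer cancel_comm_monoid_add_class.diff_cancel left_diff_distrib)
  then show "a \<cdot>\<^sub>r m = a \<cdot>\<^sub>r n"
    using star_mult_eq_0 by (metis eq_iff_diff_eq_0)
qed

lemma norm_rmult_le:
  fixes l r :: "'a::cstar_algebra \<Rightarrow>\<^sub>L 'a"
  assumes "\<And>a b. a * l b = r a * b"
  shows "norm r \<le> norm l"
proof (rule norm_blinfun_bound)
  fix a
  show "norm (r a) \<le> norm l * norm a"
  proof (cases "r a = 0")
    case False
    have "(norm (r a))\<^sup>2 = norm (r a * star (r a))"
      using cstar_identity[of "star (r a)"] by (simp add: star_star)
    also have "\<dots> = norm (a * l (star (r a)))" by (simp add: assms)
    also have "\<dots> \<le> norm a * norm (l (star (r a)))" by (rule norm_mult_ineq)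
    also have "\<dots> \<le> norm a * (norm l * norm (r a))"
      using norm_blinfun[of l "star (r a)"] by (simp add: mult_left_mono)
    finally show ?thesis using False by (simp add: power2_eq_square mult.commute)
  qed simp
qed simp

instantiation multiplier :: (cstar_algebra) real_normed_algebra
begin

lift_definition zero_multiplier :: "'a multiplier" is "(0, 0)" by simp

lift_definition plus_multiplier :: "'a multiplier \<Rightarrow> 'a multiplier \<Rightarrow> 'a multiplier"
  is "\<lambda>(l, r) (l', r'). (l + l', r + r')"
  by (auto simp: blinfun.add_left algebra_simps)

lift_definition minus_multiplier :: "'a multiplier \<Rightarrow> 'a multiplier \<Rightarrow> 'a multiplier"
  is "\<lambda>(l, r) (l', r'). (l - l', r - r')"
  by (auto simp: blinfun.diff_left algebra_simps)

lift_definition uminus_multiplier :: "'a multiplier \<Rightarrow> 'a multiplier"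
  is "\<lambda>(l, r). (- l, - r)"
  by (auto simp: blinfun.minus_left)

lift_definition scaleR_multiplier :: "real \<Rightarrow> 'a multiplier \<Rightarrow> 'a multiplier"
  is "\<lambda>c (l, r). (c *\<^sub>R l, c *\<^sub>R r)"
  by (auto simp: blinfun.scaleR_left)

lift_definition times_multiplier :: "'a multiplier \<Rightarrow> 'a multiplier \<Rightarrow> 'a multiplier"
  is "\<lambda>(l, r) (l', r'). (l o\<^sub>L l', r' o\<^sub>L r)"
  by auto

lift_definition norm_multiplier :: "'a multiplier \<Rightarrow> real" is "\<lambda>(l, r). norm l" .

definition dist_multiplier :: "'a multiplier \<Rightarrow> 'a multiplier \<Rightarrow> real"
  where "dist_multiplier m n = norm (m - n)"

definition sgn_multiplier :: "'a multiplier \<Rightarrow> 'a multiplier"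
  where "sgn_multiplier m = inverse (norm m) *\<^sub>R m"

definition uniformity_multiplier :: "('a multiplier \<times> 'a multiplier) filter"
  where "uniformity_multiplier = (INF e\<in>{0<..}. principal {(x, y). dist x y < e})"

definition open_multiplier :: "'a multiplier set \<Rightarrow> bool"
  where "open_multiplier U \<longleftrightarrow> (\<forall>x\<in>U. \<forall>\<^sub>F (x', y) in uniformity. x' = x \<longrightarrow> y \<in> U)"

instance
proof
  fix m n k :: "'a multiplier" and x y :: real
  show "dist m n = norm (m - n)" by (rule dist_multiplier_def)
  show "sgn m = inverse (norm m) *\<^sub>R m" by (rule sgn_multiplier_def)
  show "(uniformity :: ('a multiplier \<times> 'a multiplier) filter)
      = (INF e\<in>{0<..}. principal {(x, y). dist x y < e})"
    by (rule uniformity_multiplier_def)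
  show "open U \<longleftrightarrow> (\<forall>x\<in>U. \<forall>\<^sub>F (x', y) in uniformity. x' = x \<longrightarrow> y \<in> U)"
    for U :: "'a multiplier set" by (rule open_multiplier_def)
  show "m + n + k = m + (n + k)" "m + n = n + m" "0 + m = m" "- m + m = 0" "m - n = m + - n"
    "x *\<^sub>R (m + n) = x *\<^sub>R m + x *\<^sub>R n" "(x + y) *\<^sub>R m = x *\<^sub>R m + y *\<^sub>R m"
    "x *\<^sub>R y *\<^sub>R m = (x * y) *\<^sub>R m" "1 *\<^sub>R m = m"
    by (transfer, auto simp: algebra_simps)+
  show "m * n * k = m * (n * k)" "(m + n) * k = m * k + n * k" "m * (n + k) = m * n + m * k"
    "x *\<^sub>R m * n = x *\<^sub>R (m * n)" "m * x *\<^sub>R n = x *\<^sub>R (m * n)"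
    by (transfer, auto intro!: blinfun_eqI simp: blinfun.bilinear_simps)+
  show "(norm m = 0) = (m = 0)"
    by transfer (use norm_rmult_le in fastforce)
  show "norm (m + n) \<le> norm m + norm n"
    by transfer (auto intro: norm_triangle_ineq)
  show "norm (x *\<^sub>R m) = \<bar>x\<bar> * norm m" by transfer auto
  show "norm (m * n) \<le> norm m * norm n" by transfer (auto intro: norm_blinfun_compose)
qed

end

lemma lmult_simps:
  "0 \<cdot>\<^sub>l a = 0" "(m + n) \<cdot>\<^sub>l a = m \<cdot>\<^sub>l a + n \<cdot>\<^sub>l a" "(m - n) \<cdot>\<^sub>l a = m \<cdot>\<^sub>l a - n \<cdot>\<^sub>l a"
  "(m * n) \<cdot>\<^sub>l a = m \<cdot>\<^sub>l n \<cdot>\<^sub>l a"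
  by (transfer, auto simp: blinfun.bilinear_simps)+

lemma rmult_simps:
  "a \<cdot>\<^sub>r 0 = 0" "a \<cdot>\<^sub>r (m + n) = a \<cdot>\<^sub>r m + a \<cdot>\<^sub>r n" "a \<cdot>\<^sub>r (m - n) = a \<cdot>\<^sub>r m - a \<cdot>\<^sub>r n"
  "a \<cdot>\<^sub>r (m * n) = a \<cdot>\<^sub>r m \<cdot>\<^sub>r n"
  by (transfer, auto simp: blinfun.bilinear_simps)+

lemma norm_lmult: "norm (m \<cdot>\<^sub>l a) \<le> norm m * norm a"
  by transfer (auto intro: norm_blinfun)

lemma norm_rmult: "norm (a \<cdot>\<^sub>r m) \<le> norm m * norm a"
proof (transfer, clarsimp)
  fix a and l r :: "'a \<Rightarrow>\<^sub>L 'a"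
  assume "\<forall>a b. a * l b = r a * b"
  then have "norm r \<le> norm l" by (intro norm_rmult_le) simp
  then show "norm (r a) \<le> norm l * norm a"
    using norm_blinfun[of r a] by (meson mult_right_mono norm_ge_zero order_trans)
qed

lemma norm_multiplier_bound: "(\<And>a. norm (m \<cdot>\<^sub>l a) \<le> K * norm a) \<Longrightarrow> 0 \<le> K \<Longrightarrow> norm m \<le> K"
  by transfer (auto intro: norm_blinfun_bound)

instance multiplier :: (cstar_algebra) banach
proof
  fix X :: "nat \<Rightarrow> 'a multiplier"
  assume "Cauchy X"
  have diffl: "norm (fst (Rep_multiplier m) - fst (Rep_multiplier n)) = norm (m - n)"
    for m n :: "'a multiplier" by transfer auto
  have diffr: "norm (snd (Rep_multiplier m) - snd (Rep_multiplier n)) \<le> norm (m - n)"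
    for m n :: "'a multiplier"
  proof (rule norm_blinfun_bound)
    fix a
    have "(snd (Rep_multiplier m) - snd (Rep_multiplier n)) a = a \<cdot>\<^sub>r (m - n)"
      by transfer (auto simp: blinfun.diff_left)
    then show "norm ((snd (Rep_multiplier m) - snd (Rep_multiplier n)) a)
      \<le> norm (m - n) * norm a" using norm_rmult by simp
  qed simp
  have "Cauchy (\<lambda>i. fst (Rep_multiplier (X i)))" "Cauchy (\<lambda>i. snd (Rep_multiplier (X i)))"
    using \<open>Cauchy X\<close> diffr unfolding Cauchy_def dist_norm diffl
    by (blast, meson le_less_trans)
  then obtain l r where l: "(\<lambda>i. fst (Rep_multiplier (X i))) \<longlonglongrightarrow> l"
    and r: "(\<lambda>i. snd (Rep_multiplier (X i))) \<longlonglongrightarrow> r"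
    using Cauchy_convergent unfolding convergent_def by metis
  have "a * l b = r a * b" for a b
  proof (rule LIMSEQ_unique)
    show "(\<lambda>i. a * fst (Rep_multiplier (X i)) b) \<longlonglongrightarrow> a * l b"
      by (intro tendsto_intros l)
    have "(\<lambda>i. snd (Rep_multiplier (X i)) a * b) \<longlonglongrightarrow> r a * b"
      by (intro tendsto_intros r)
    moreover have "a * fst (Rep_multiplier m) b = snd (Rep_multiplier m) a * b"
      for m :: "'a multiplier" using Rep_multiplier[of m] by auto
    ultimately show "(\<lambda>i. a * fst (Rep_multiplier (X i)) b) \<longlonglongrightarrow> r a * b" by simp
  qed
  then have rep: "Rep_multiplier (Abs_multiplier (l, r)) = (l, r)"
    by (intro Abs_multiplier_inverse) simp
  have "norm (X i - Abs_multiplier (l, r)) = norm (fst (Rep_multiplier (X i)) - l)" for i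
    unfolding diffl[symmetric] rep by simp
  then have "(\<lambda>i. norm (X i - Abs_multiplier (l, r))) \<longlonglongrightarrow> 0"
    using l by (simp add: LIM_zero tendsto_norm_zero)
  then show "convergent X"
    unfolding convergent_def by (blast intro: LIM_zero_cancel tendsto_norm_zero_cancel)
qed

instantiation multiplier :: (cstar_algebra) cstar_algebra
begin

lift_definition scaleC_multiplier :: "complex \<Rightarrow> 'a multiplier \<Rightarrow> 'a multiplier"
  is "\<lambda>c (l, r). (Blinfun (\<lambda>a. c *\<^sub>C blinfun_apply l a), Blinfun (\<lambda>a. c *\<^sub>C blinfun_apply r a))"
  by (auto simp: bounded_linear_Blinfun_apply bounded_linear_compose[OF bounded_linear_scaleC]
      blinfun.bounded_linear_right mult_scaleC_left mult_scaleC_right)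

lift_definition star_multiplier :: "'a multiplier \<Rightarrow> 'a multiplier"
  is "\<lambda>(l, r). (Blinfun (\<lambda>a. star (blinfun_apply r (star a))),
                Blinfun (\<lambda>a. star (blinfun_apply l (star a))))"
proof (clarsimp, goal_cases)
  case (1 l r a b)
  have bl: "bounded_linear (\<lambda>a. star (blinfun_apply f (star a)))" for f :: "'a \<Rightarrow>\<^sub>L 'a"
    by (intro bounded_linear_compose[OF bounded_linear_star]
        bounded_linear_compose[OF blinfun.bounded_linear_right] bounded_linear_star)
  show ?case
    unfolding bounded_linear_Blinfun_apply[OF bl] using 1 by (metis star_mult star_star)
qed

lemma scaleC_lmult: "(c *\<^sub>C m) \<cdot>\<^sub>l a = c *\<^sub>C (m \<cdot>\<^sub>l a)" for m :: "'a multiplier"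
  by transfer (auto simp: bounded_linear_Blinfun_apply
      bounded_linear_compose[OF bounded_linear_scaleC] blinfun.bounded_linear_right)

lemma scaleC_rmult: "a \<cdot>\<^sub>r (c *\<^sub>C m) = c *\<^sub>C (a \<cdot>\<^sub>r m)" for m :: "'a multiplier"
  by transfer (auto simp: bounded_linear_Blinfun_apply
      bounded_linear_compose[OF bounded_linear_scaleC] blinfun.bounded_linear_right)

lemma bounded_linear_star_conj:
  "bounded_linear (\<lambda>a. star (blinfun_apply f (star a)))" for f :: "'a \<Rightarrow>\<^sub>L 'a"
  by (intro bounded_linear_compose[OF bounded_linear_star]
      bounded_linear_compose[OF blinfun.bounded_linear_right] bounded_linear_star)

lemma star_lmult: "star m \<cdot>\<^sub>l a = star (star a \<cdot>\<^sub>r m)" for m :: "'a multiplier"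
  by transfer (auto simp: bounded_linear_Blinfun_apply bounded_linear_star_conj)

lemma star_rmult: "a \<cdot>\<^sub>r star m = star (m \<cdot>\<^sub>l star a)" for m :: "'a multiplier"
  by transfer (auto simp: bounded_linear_Blinfun_apply bounded_linear_star_conj)

lemma lmult_scaleC: "m \<cdot>\<^sub>l (c *\<^sub>C a) = c *\<^sub>C (m \<cdot>\<^sub>l a)" for m :: "'a multiplier"
proof -
  have "b * (m \<cdot>\<^sub>l (c *\<^sub>C a) - c *\<^sub>C (m \<cdot>\<^sub>l a)) = 0" for b
    by (simp add: right_diff_distrib centralizer mult_scaleC_right)
  then show ?thesis using cstar_mult_eq_0 by (metis eq_iff_diff_eq_0)
qed

instance
proof
  fix m n :: "'a multiplier" and x :: real and c d :: complex
  show "c *\<^sub>C (m + n) = c *\<^sub>C m + c *\<^sub>C n" "(c + d) *\<^sub>C m = c *\<^sub>C m + d *\<^sub>C m"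
    "c *\<^sub>C d *\<^sub>C m = (c * d) *\<^sub>C m" 
    "(c *\<^sub>C m) * n = c *\<^sub>C (m * n)" "m * (c *\<^sub>C n) = c *\<^sub>C (m * n)"
    by (rule multiplier_eqI_left; simp add: lmult_simps scaleC_lmult scaleC_add_right
        scaleC_add_left scaleC_scaleC lmult_scaleC)+
  show scaleR: "x *\<^sub>R m = complex_of_real x *\<^sub>C m" for x and m :: "'a multiplier"
  proof (rule multiplier_eqI_left)
    have "(x *\<^sub>R m) \<cdot>\<^sub>l a = x *\<^sub>R (m \<cdot>\<^sub>l a)" for a
      by transfer (auto simp: blinfun.scaleR_left)
    then show "(x *\<^sub>R m) \<cdot>\<^sub>l a = (complex_of_real x *\<^sub>C m) \<cdot>\<^sub>l a" for a
      by (simp add: scaleC_lmult scaleR_scaleC)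
  qed
  have le: "norm (c *\<^sub>C m) \<le> cmod c * norm m" for c and m :: "'a multiplier"
  proof (rule norm_multiplier_bound)
    fix a
    show "norm ((c *\<^sub>C m) \<cdot>\<^sub>l a) \<le> cmod c * norm m * norm a"
      using mult_left_mono[OF norm_lmult[of m a], of "cmod c"]
      by (simp add: scaleC_lmult norm_scaleC mult.assoc)
  qed simp
  show "norm (c *\<^sub>C m) = cmod c * norm m"
  proof (cases "c = 0")
    case True
    then show ?thesis using le[of c m] by simp
  next
    case False
    have "inverse c *\<^sub>C c *\<^sub>C m = m"
      by (rule multiplier_eqI_left)
        (use False in \<open>simp add: scaleC_lmult scaleC_scaleC flip: scaleR_scaleC[of 1, simplified]\<close>)
    then have "norm m \<le> inverse (cmod c) * norm (c *\<^sub>C m)"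
      using le[of "inverse c" "c *\<^sub>C m"] by (simp add: norm_inverse)
    then show ?thesis using le[of c m] False by (simp add: field_simps)
  qed
  show "star (star m) = m" "star (m + n) = star m + star n" "star (m * n) = star n * star m"
    "star (c *\<^sub>C m) = cnj c *\<^sub>C star m"
    by (rule multiplier_eqI_left; simp add: lmult_simps rmult_simps star_lmult star_rmult
        star_star star_add scaleC_lmult scaleC_rmult star_scaleC)+
  have "norm (star m) \<le> norm m"
    using norm_rmult[of _ m] by (intro norm_multiplier_bound) (metis star_lmult norm_star, simp)
  then have "norm (star m * m) \<le> (norm m)\<^sup>2"
    unfolding power2_eq_square
    by (meson mult_right_mono norm_ge_zero norm_mult_ineq order_trans)
  moreover have "norm m \<le> sqrt (norm (star m * m))"
  proof (rule norm_multiplier_bound)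
    fix a
    let ?b = "m \<cdot>\<^sub>l a"
    have "(norm ?b)\<^sup>2 = norm (star a * ((star m * m) \<cdot>\<^sub>l a))"
      by (simp add: centralizer star_rmult rmult_simps star_star lmult_simps
          flip: cstar_identity)
    also have "\<dots> \<le> norm a * norm ((star m * m) \<cdot>\<^sub>l a)"
      by (metis norm_mult_ineq norm_star)
    also have "\<dots> \<le> norm a * (norm (star m * m) * norm a)"
      by (intro mult_left_mono norm_lmult) simp
    finally have "(norm ?b)\<^sup>2 \<le> (sqrt (norm (star m * m)) * norm a)\<^sup>2"
      by (simp add: power_mult_distrib power2_eq_square[of "norm a"] mult_ac)
    then show "norm ?b \<le> sqrt (norm (star m * m)) * norm a"
      by (rule power2_le_imp_le) simp
  qed simp
  then have "(norm m)\<^sup>2 \<le> norm (star m * m)"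
    using real_le_rsqrt real_sqrt_ge_zero by (metis norm_ge_zero power_mono real_sqrt_pow2)
  ultimately show "norm (star m * m) = (norm m)\<^sup>2" by simp
qed

end

instantiation multiplier :: (cstar_algebra) monoid_mult
begin

lift_definition one_multiplier :: "'a multiplier" is "(id_blinfun, id_blinfun)" by simp

instance
  by standard (transfer, auto)+

end

lift_definition mult_embed :: "'a::cstar_algebra \<Rightarrow> 'a multiplier"
  is "\<lambda>a. (blinfun_mult_right a, blinfun_mult_left a)"
  by (simp add: mult.assoc)

lemma mult_embed_mult: "mult_embed a * m = mult_embed (a \<cdot>\<^sub>r m)"
proof (rule multiplier_eqI_left)
  have "mult_embed c \<cdot>\<^sub>l b = c * b" for c b :: 'a
    by transfer simp
  then show "(mult_embed a * m) \<cdot>\<^sub>l b = mult_embed (a \<cdot>\<^sub>r m) \<cdot>\<^sub>l b" for b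
    by (simp add: lmult_simps centralizer)
qed

definition strictly_tendsto ::
    "('i \<Rightarrow> 'a::cstar_algebra multiplier) \<Rightarrow> 'a multiplier \<Rightarrow> 'i filter \<Rightarrow> bool"
  where "strictly_tendsto f m F \<longleftrightarrow>
    (\<forall>a. ((\<lambda>i. f i \<cdot>\<^sub>l a) \<longlongrightarrow> m \<cdot>\<^sub>l a) F \<and> ((\<lambda>i. a \<cdot>\<^sub>r f i) \<longlongrightarrow> a \<cdot>\<^sub>r m) F)"


section \<open>Extendible endomorphisms and transfer operators\<close>

definition is_extension ::
    "('a::cstar_algebra \<Rightarrow> 'a) \<Rightarrow> ('a multiplier \<Rightarrow> 'a multiplier) \<Rightarrow> bool"
  where "is_extension f g \<longleftrightarrow>
    star_hom g \<and> (\<forall>a. g (mult_embed a) = mult_embed (f a)) \<and>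
    (\<exists>F. approximate_unit F \<and> strictly_tendsto (\<lambda>u. mult_embed (f u)) (g 1) F)"

definition extendible :: "('a::cstar_algebra \<Rightarrow> 'a) \<Rightarrow> bool"
  where "extendible f \<longleftrightarrow> (\<exists>!g. is_extension f g)"

definition extension :: "('a::cstar_algebra \<Rightarrow> 'a) \<Rightarrow> 'a multiplier \<Rightarrow> 'a multiplier"
  where "extension f = (THE g. is_extension f g)"

definition transfer_operator :: "('a::cstar_algebra \<Rightarrow> 'a) \<Rightarrow> ('a \<Rightarrow> 'a) \<Rightarrow> bool"
  where "transfer_operator f T \<longleftrightarrow>
    clinear_map T \<and> continuous_on UNIV T \<and> (\<forall>a. cpositive a \<longrightarrow> cpositive (T a)) \<and>
    (\<exists>T'. clinear_map T' \<and> continuous_on UNIV T' \<and> (\<forall>a. T' (mult_embed a) = mult_embed (T a)) \<and>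
          (\<forall>a u. T (f a \<cdot>\<^sub>r u) = a \<cdot>\<^sub>r T' u))"

locale transfer_system =
  fixes \<alpha> :: "'s::comm_monoid_add \<Rightarrow> 'a::cstar_algebra \<Rightarrow> 'a"
    and L :: "'s \<Rightarrow> 'a \<Rightarrow> 'a"
  assumes endomorphism: "star_hom (\<alpha> s)"
    and action_add: "\<alpha> (s + t) = \<alpha> s \<circ> \<alpha> t"
    and action_zero: "\<alpha> 0 = id"
    and extendible: "extendible (\<alpha> s)"
    and transfer_operator: "transfer_operator (\<alpha> s) (L s)"
    and transfer_add: "L (s + t) = L s \<circ> L t"
    and transfer_zero: "L 0 = id"


section \<open>Hilbert bimodules\<close>

record ('a, 'm) bimodule =
  carrier :: "'m set"
  madd :: "'m \<Rightarrow> 'm \<Rightarrow> 'm"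
  mzero :: 'm
  mscale :: "complex \<Rightarrow> 'm \<Rightarrow> 'm"
  ract :: "'m \<Rightarrow> 'a \<Rightarrow> 'm"
  lact :: "'a \<Rightarrow> 'm \<Rightarrow> 'm"
  ip :: "'m \<Rightarrow> 'm \<Rightarrow> 'a"

definition mdist :: "('a::cstar_algebra, 'm) bimodule \<Rightarrow> 'm \<Rightarrow> 'm \<Rightarrow> real"
  where "mdist M x y = (let d = madd M x (mscale M (- 1) y) in sqrt (norm (ip M d d)))"

locale hilbert_module =
  fixes M :: "('a::cstar_algebra, 'm) bimodule"
  assumes zero_closed: "mzero M \<in> carrier M"
    and add_closed: "\<lbrakk>x \<in> carrier M; y \<in> carrier M\<rbrakk> \<Longrightarrow> madd M x y \<in> carrier M"
    and scale_closed: "x \<in> carrier M \<Longrightarrow> mscale M c x \<in> carrier M"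
    and ract_closed: "x \<in> carrier M \<Longrightarrow> ract M x a \<in> carrier M"
    and add_assoc: "\<lbrakk>x \<in> carrier M; y \<in> carrier M; z \<in> carrier M\<rbrakk>
      \<Longrightarrow> madd M (madd M x y) z = madd M x (madd M y z)"
    and add_commute: "\<lbrakk>x \<in> carrier M; y \<in> carrier M\<rbrakk> \<Longrightarrow> madd M x y = madd M y x"
    and add_zero: "x \<in> carrier M \<Longrightarrow> madd M x (mzero M) = x"
    and add_inverse: "x \<in> carrier M \<Longrightarrow> \<exists>y\<in>carrier M. madd M x y = mzero M"
    and scale_add: "\<lbrakk>x \<in> carrier M; y \<in> carrier M\<rbrakk>
      \<Longrightarrow> mscale M c (madd M x y) = madd M (mscale M c x) (mscale M c y)"
    and add_scale: "x \<in> carrier M \<Longrightarrow> mscale M (c + d) x = madd M (mscale M c x) (mscale M d x)"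
    and scale_scale: "x \<in> carrier M \<Longrightarrow> mscale M c (mscale M d x) = mscale M (c * d) x"
    and scale_one: "x \<in> carrier M \<Longrightarrow> mscale M 1 x = x"
    and ract_add_left: "\<lbrakk>x \<in> carrier M; y \<in> carrier M\<rbrakk>
      \<Longrightarrow> ract M (madd M x y) a = madd M (ract M x a) (ract M y a)"
    and ract_add_right: "x \<in> carrier M \<Longrightarrow> ract M x (a + b) = madd M (ract M x a) (ract M x b)"
    and ract_mult: "x \<in> carrier M \<Longrightarrow> ract M x (a * b) = ract M (ract M x a) b"
    and ract_scale_left: "x \<in> carrier M \<Longrightarrow> ract M (mscale M c x) a = mscale M c (ract M x a)"
    and ract_scale_right: "x \<in> carrier M \<Longrightarrow> ract M x (c *\<^sub>C a) = mscale M c (ract M x a)"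
    and ip_add: "\<lbrakk>x \<in> carrier M; y \<in> carrier M; z \<in> carrier M\<rbrakk>
      \<Longrightarrow> ip M x (madd M y z) = ip M x y + ip M x z"
    and ip_scale: "\<lbrakk>x \<in> carrier M; y \<in> carrier M\<rbrakk> \<Longrightarrow> ip M x (mscale M c y) = c *\<^sub>C ip M x y"
    and ip_ract: "\<lbrakk>x \<in> carrier M; y \<in> carrier M\<rbrakk> \<Longrightarrow> ip M x (ract M y a) = ip M x y * a"
    and ip_star: "\<lbrakk>x \<in> carrier M; y \<in> carrier M\<rbrakk> \<Longrightarrow> star (ip M x y) = ip M y x"
    and ip_positive: "x \<in> carrier M \<Longrightarrow> cpositive (ip M x x)"
    and ip_definite: "\<lbrakk>x \<in> carrier M; ip M x x = 0\<rbrakk> \<Longrightarrow> x = mzero M"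
    and complete: "Metric_space.mcomplete (carrier M) (mdist M)"

text \<open>
  The left action is a *-homomorphism \<open>a \<mapsto> lact M a\<close> into the adjointable operators:
  \<open>lact_adjoint\<close> makes each \<open>lact M a\<close> adjointable with adjoint \<open>lact M (star a)\<close>.
\<close>

locale hilbert_bimodule = hilbert_module M for M :: "('a::cstar_algebra, 'm) bimodule" +
  assumes lact_closed: "x \<in> carrier M \<Longrightarrow> lact M a x \<in> carrier M"
    and lact_adjoint: "\<lbrakk>x \<in> carrier M; y \<in> carrier M\<rbrakk>
      \<Longrightarrow> ip M (lact M a x) y = ip M x (lact M (star a) y)"
    and lact_add: "x \<in> carrier M \<Longrightarrow> lact M (a + b) x = madd M (lact M a x) (lact M b x)"
    and lact_scale: "x \<in> carrier M \<Longrightarrow> lact M (c *\<^sub>C a) x = mscale M c (lact M a x)"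
    and lact_mult: "x \<in> carrier M \<Longrightarrow> lact M (a * b) x = lact M a (lact M b x)"

definition bimodule_iso ::
    "('a::cstar_algebra, 'm) bimodule \<Rightarrow> ('a, 'n) bimodule \<Rightarrow> ('m \<Rightarrow> 'n) \<Rightarrow> bool"
  where "bimodule_iso M N h \<longleftrightarrow>
    bij_betw h (carrier M) (carrier N) \<and>
    (\<forall>x\<in>carrier M. \<forall>y\<in>carrier M.
      h (madd M x y) = madd N (h x) (h y) \<and> ip N (h x) (h y) = ip M x y) \<and>
    (\<forall>x\<in>carrier M. \<forall>c. h (mscale M c x) = mscale N c (h x)) \<and>
    (\<forall>x\<in>carrier M. \<forall>a. h (ract M x a) = ract N (h x) a \<and> h (lact M a x) = lact N a (h x))"

definition identity_bimodule :: "('a::cstar_algebra, 'a) bimodule"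
  where "identity_bimodule = \<lparr>carrier = UNIV, madd = (+), mzero = 0, mscale = scaleC,
    ract = (*), lact = (*), ip = (\<lambda>x y. star x * y)\<rparr>"

inductive_set module_span :: "('a, 'm) bimodule \<Rightarrow> 'm set \<Rightarrow> 'm set"
  for M :: "('a, 'm) bimodule" and B :: "'m set" where
  span_zero: "mzero M \<in> module_span M B"
| span_base: "x \<in> B \<Longrightarrow> x \<in> module_span M B"
| span_add: "\<lbrakk>x \<in> module_span M B; y \<in> module_span M B\<rbrakk> \<Longrightarrow> madd M x y \<in> module_span M B"
| span_scale: "x \<in> module_span M B \<Longrightarrow> mscale M c x \<in> module_span M B"

definition essential :: "('a::cstar_algebra, 'm) bimodule \<Rightarrow> bool"
  where "essential M \<longleftrightarrow>
    carrier M = Metric_space.mtopology (carrier M) (mdist M) closure_of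
      module_span M {lact M a x |a x. x \<in> carrier M}"


subsection \<open>Hausdorff completion\<close>

text \<open>
  The input need only carry a semi-inner product.  Identifying Cauchy sequences whose distance
  tends to zero performs the quotient by the vectors with \<open>ip x x = 0\<close> and the completion at
  the same time; the image of \<open>x\<close> is the class of the constant sequence.
\<close>

definition cauchy_seqs :: "('a::cstar_algebra, 'm) bimodule \<Rightarrow> (nat \<Rightarrow> 'm) set"
  where "cauchy_seqs M = {f. range f \<subseteq> carrier M \<and>
    (\<forall>e>0. \<exists>N. \<forall>m\<ge>N. \<forall>n\<ge>N. mdist M (f m) (f n) < e)}"

definition null_rel :: "('a::cstar_algebra, 'm) bimodule \<Rightarrow> ((nat \<Rightarrow> 'm) \<times> (nat \<Rightarrow> 'm)) set"
  where "null_rel M = {(f, g). f \<in> cauchy_seqs M \<and> g \<in> cauchy_seqs M \<and>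
    (\<lambda>n. mdist M (f n) (g n)) \<longlonglongrightarrow> 0}"

definition completion :: "('a::cstar_algebra, 'm) bimodule \<Rightarrow> ('a, (nat \<Rightarrow> 'm) set) bimodule"
  where "completion M = \<lparr>
    carrier = cauchy_seqs M // null_rel M,
    madd = (\<lambda>X Y. \<Union>f\<in>X. \<Union>g\<in>Y. null_rel M `` {\<lambda>n. madd M (f n) (g n)}),
    mzero = null_rel M `` {\<lambda>n. mzero M},
    mscale = (\<lambda>c X. \<Union>f\<in>X. null_rel M `` {\<lambda>n. mscale M c (f n)}),
    ract = (\<lambda>X a. \<Union>f\<in>X. null_rel M `` {\<lambda>n. ract M (f n) a}),
    lact = (\<lambda>a X. \<Union>f\<in>X. null_rel M `` {\<lambda>n. lact M a (f n)}),
    ip = (\<lambda>X Y. THE c. \<forall>f\<in>X. \<forall>g\<in>Y. (\<lambda>n. ip M (f n) (g n)) \<longlonglongrightarrow> c)\<rparr>"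


subsection \<open>Internal tensor product\<close>

text \<open>
  The list \<open>[(x\<^sub>1, y\<^sub>1), \<dots>, (x\<^sub>k, y\<^sub>k)]\<close> stands for the formal sum of the
  \<open>x\<^sub>i \<otimes> y\<^sub>i\<close>.  The relations defining the algebraic tensor product balanced over \<open>A\<close>
  are null for the semi-inner product
  \<open>\<langle>x \<otimes> y, x' \<otimes> y'\<rangle> = \<langle>y, \<langle>x, x'\<rangle> \<cdot> y'\<rangle>\<close>,
  so the completion makes the identifications of that tensor product.
\<close>

definition formal_tensor :: "('a::cstar_algebra, 'm) bimodule \<Rightarrow> ('a, 'n) bimodule
    \<Rightarrow> ('a, ('m \<times> 'n) list) bimodule"
  where "formal_tensor M N = \<lparr>
    carrier = lists (carrier M \<times> carrier N),
    madd = (@),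
    mzero = [],
    mscale = (\<lambda>c. map (\<lambda>(x, y). (mscale M c x, y))),
    ract = (\<lambda>u a. map (\<lambda>(x, y). (x, ract N y a)) u),
    lact = (\<lambda>a. map (\<lambda>(x, y). (lact M a x, y))),
    ip = (\<lambda>u v. \<Sum>(x, y)\<leftarrow>u. \<Sum>(x', y')\<leftarrow>v. ip N y (lact N (ip M x x') y'))\<rparr>"

definition internal_tensor :: "('a::cstar_algebra, 'm) bimodule \<Rightarrow> ('a, 'n) bimodule
    \<Rightarrow> ('a, (nat \<Rightarrow> ('m \<times> 'n) list) set) bimodule"
  where "internal_tensor M N = completion (formal_tensor M N)"

definition simple_tensor :: "('a::cstar_algebra, 'm) bimodule \<Rightarrow> ('a, 'n) bimodule
    \<Rightarrow> 'm \<Rightarrow> 'n \<Rightarrow> (nat \<Rightarrow> ('m \<times> 'n) list) set"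
  where "simple_tensor M N x y = null_rel (formal_tensor M N) `` {\<lambda>n. [(x, y)]}"


section \<open>Product systems\<close>

text \<open>
  The requirement that the fibre over \<open>0\<close> be \<open>A\<close> is read up to a specified isomorphism \<open>\<iota>\<close>
  of Hilbert bimodules.
\<close>

locale product_system =
  fixes X :: "'s::comm_monoid_add \<Rightarrow> ('a::cstar_algebra, 'x) bimodule"
    and mul :: "'x \<Rightarrow> 'x \<Rightarrow> 'x"
    and \<iota> :: "'a \<Rightarrow> 'x"
  assumes fibre_bimodule: "hilbert_bimodule (X s)"
    and mul_closed: "\<lbrakk>x \<in> (\<Union>s. carrier (X s)); y \<in> (\<Union>s. carrier (X s))\<rbrakk>
      \<Longrightarrow> mul x y \<in> (\<Union>s. carrier (X s))"
    and mul_assoc: "\<lbrakk>x \<in> (\<Union>s. carrier (X s)); y \<in> (\<Union>s. carrier (X s));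
        z \<in> (\<Union>s. carrier (X s))\<rbrakk> \<Longrightarrow> mul (mul x y) z = mul x (mul y z)"
    and projection: "\<exists>p :: 'x \<Rightarrow> 's.
      (\<forall>x\<in>\<Union>s. carrier (X s). \<forall>y\<in>\<Union>s. carrier (X s). p (mul x y) = p x + p y) \<and>
      (\<forall>s. {x \<in> \<Union>s. carrier (X s). p x = s} = carrier (X s))"
    and mul_tensor: "\<lbrakk>s \<noteq> 0; t \<noteq> 0\<rbrakk> \<Longrightarrow>
      \<exists>h. bimodule_iso (internal_tensor (X s) (X t)) (X (s + t)) h \<and>
          (\<forall>x\<in>carrier (X s). \<forall>y\<in>carrier (X t). h (simple_tensor (X s) (X t) x y) = mul x y)"
    and unit_fibre: "bimodule_iso identity_bimodule (X 0) \<iota>"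
    and mul_unit_left: "x \<in> carrier (X s) \<Longrightarrow> mul (\<iota> a) x = lact (X s) a x"
    and mul_unit_right: "x \<in> carrier (X s) \<Longrightarrow> mul x (\<iota> a) = ract (X s) x a"


section \<open>The product system of a transfer system\<close>

definition pre_fibre :: "('s \<Rightarrow> 'a::cstar_algebra \<Rightarrow> 'a) \<Rightarrow> ('s \<Rightarrow> 'a \<Rightarrow> 'a) \<Rightarrow> 's
    \<Rightarrow> ('a, 'a) bimodule"
  where "pre_fibre \<alpha> L s = \<lparr>
    carrier = {a \<cdot>\<^sub>r extension (\<alpha> s) 1 |a. True},
    madd = (+), mzero = 0, mscale = scaleC,
    ract = (\<lambda>x a. x * \<alpha> s a), lact = (*), ip = (\<lambda>x y. L s (star x * y))\<rparr>"

definition tagged :: "'s \<Rightarrow> ('a, 'm) bimodule \<Rightarrow> ('a, 's \<times> 'm) bimodule"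
  where "tagged s M = \<lparr>
    carrier = {s} \<times> carrier M,
    madd = (\<lambda>x y. (s, madd M (snd x) (snd y))),
    mzero = (s, mzero M),
    mscale = (\<lambda>c x. (s, mscale M c (snd x))),
    ract = (\<lambda>x a. (s, ract M (snd x) a)),
    lact = (\<lambda>a x. (s, lact M a (snd x))),
    ip = (\<lambda>x y. ip M (snd x) (snd y))\<rparr>"

definition fibre :: "('s \<Rightarrow> 'a::cstar_algebra \<Rightarrow> 'a) \<Rightarrow> ('s \<Rightarrow> 'a \<Rightarrow> 'a) \<Rightarrow> 's
    \<Rightarrow> ('a, 's \<times> (nat \<Rightarrow> 'a) set) bimodule"
  where "fibre \<alpha> L s = tagged s (completion (pre_fibre \<alpha> L s))"

text \<open>
  The union over all representatives of the two factors: a single class, as the product does not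
  depend on the representatives.
\<close>

definition fibre_mult :: "('s::comm_monoid_add \<Rightarrow> 'a::cstar_algebra \<Rightarrow> 'a) \<Rightarrow> ('s \<Rightarrow> 'a \<Rightarrow> 'a)
    \<Rightarrow> 's \<times> (nat \<Rightarrow> 'a) set \<Rightarrow> 's \<times> (nat \<Rightarrow> 'a) set \<Rightarrow> 's \<times> (nat \<Rightarrow> 'a) set"
  where "fibre_mult \<alpha> L = (\<lambda>(s, x) (t, y). (s + t,
    \<Union>{null_rel (pre_fibre \<alpha> L (s + t)) `` {\<lambda>n. a n * \<alpha> s (b n \<cdot>\<^sub>r extension (\<alpha> t) 1)} |a b.
        (\<lambda>n. a n \<cdot>\<^sub>r extension (\<alpha> s) 1) \<in> x \<and> (\<lambda>n. b n \<cdot>\<^sub>r extension (\<alpha> t) 1) \<in> y}))"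

definition fibre_unit :: "('s::comm_monoid_add \<Rightarrow> 'a::cstar_algebra \<Rightarrow> 'a) \<Rightarrow> ('s \<Rightarrow> 'a \<Rightarrow> 'a)
    \<Rightarrow> 'a \<Rightarrow> 's \<times> (nat \<Rightarrow> 'a) set"
  where "fibre_unit \<alpha> L a = (0, null_rel (pre_fibre \<alpha> L 0) `` {\<lambda>n. a})"

end

theory Submission
  imports Defs
begin

text \<open>
  Write \<open>p\<^sub>s\<close> for the extension of \<open>\<alpha>\<^sub>s\<close> at \<open>1\<close>.  As \<open>L\<^sub>s (b \<alpha>\<^sub>s(a)) = L\<^sub>s(b) a\<close> and
  \<open>L\<^sub>s\<^sub>+\<^sub>t = L\<^sub>t \<circ> L\<^sub>s\<close>, the products satisfy
  \<open>\<langle>x \<alpha>\<^sub>s(y), x' \<alpha>\<^sub>s(y')\<rangle>\<^sub>s\<^sub>+\<^sub>t = L\<^sub>t (y\<^sup>* L\<^sub>s(x\<^sup>* x') y') = \<langle>y, \<langle>x, x'\<rangle>\<^sub>s \<cdot> y'\<rangle>\<^sub>t\<close>, so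
  \<open>x \<otimes> y \<mapsto> x \<alpha>\<^sub>s(y)\<close> is isometric for the inner product of the internal tensor product.  Its range
  is dense, because \<open>z \<alpha>\<^sub>s\<^sub>+\<^sub>t(u) = (z p\<^sub>s) \<alpha>\<^sub>s(\<alpha>\<^sub>t(u))\<close> tends to \<open>z\<close> along an approximate unit
  for every \<open>z \<in> A p\<^sub>s\<^sub>+\<^sub>t\<close>.  In the same way \<open>u x \<rightarrow> x\<close> makes the fibres essential.  That the
  fibres are Hilbert modules rests on the order of a C*-algebra, above all on
  \<open>c\<^sup>* a c \<le> \<parallel>a\<parallel> c\<^sup>* c\<close> and on the closedness of the positive cone.  These are obtained without spectral
  theory, from square roots computed by an iteration.
\<close>

section \<open>Positive elements of unital C*-algebras\<close>

text \<open>The norm condition in \<open>is_pos\<close> is visibly stable under sums and limits,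
  whereas \<open>cpositive\<close> asks for a factorization \<open>star b * b\<close>, for which
  neither is visible; identifying the two is the real work and needs square roots. The iteration
  \<open>y \<mapsto> (x + y * y) / 2\<close> is chosen because its fixed points solve
  \<open>(1 - y) * (1 - y) = 1 - x\<close>, and because at the scalar \<open>1\<close> it is an
  increasing majorant with limit \<open>1\<close>, so that it converges on the closed unit ball,
  boundary included. The norm condition requires a unit, so it is applied in \<open>M(A)\<close>;
  roots of elements of \<open>A\<close> must then be brought back into \<open>A\<close>, which is
  why every root is shown to lie in each closed right ideal containing its square.

  Nothing in a transfer operator postulates \<open>L s (star a) = star (L s a)\<close>; this has to
  be extracted from positivity, and only then does the given identity with
  \<open>\<alpha> s a\<close> on the left yield the one on the right. Formal tensors raise another
  obstacle: they are lists under concatenation, which is not commutative, so they are not modules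
  before completion.\<close>

primrec sqrt_iter :: "'b::real_normed_algebra \<Rightarrow> nat \<Rightarrow> 'b" where
  "sqrt_iter x 0 = 0"
| "sqrt_iter x (Suc n) = (1/2) *\<^sub>R (x + sqrt_iter x n * sqrt_iter x n)"

lemma sqrt_iter_real_bounds:
  "0 \<le> sqrt_iter (1::real) n \<and> sqrt_iter (1::real) n \<le> 1"
proof (induction n)
  case (Suc n)
  then have "sqrt_iter (1::real) n * sqrt_iter 1 n \<le> 1 * 1"
    by (intro mult_mono) auto
  with Suc show ?case by simp
qed simp

lemma sqrt_iter_real_le_Suc: "sqrt_iter (1::real) n \<le> sqrt_iter 1 (Suc n)"
proof -
  have "0 \<le> (1 - sqrt_iter (1::real) n)\<^sup>2" by simp
  then show ?thesis by (simp add: power2_eq_square algebra_simps)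
qed

text \<open>The sequence increases and is bounded by \<open>1\<close>, and its limit solves
  \<open>2 l = 1 + l * l\<close>, whose only root is \<open>1\<close>.\<close>

lemma sqrt_iter_real_tendsto: "sqrt_iter (1::real) \<longlonglongrightarrow> 1"
proof -
  have "incseq (sqrt_iter (1::real))"
    by (rule incseq_SucI) (rule sqrt_iter_real_le_Suc)
  then obtain l where l: "sqrt_iter (1::real) \<longlonglongrightarrow> l"
    using incseq_convergent[of "sqrt_iter 1" 1] sqrt_iter_real_bounds by blast
  have "(\<lambda>n. sqrt_iter (1::real) (Suc n)) \<longlonglongrightarrow> (1/2) *\<^sub>R (1 + l * l)"
    unfolding sqrt_iter.simps by (intro tendsto_intros l)
  then have "l = (1/2) *\<^sub>R (1 + l * l)"
    using LIMSEQ_unique LIMSEQ_Suc[OF l] by blast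
  then have "(l - 1)\<^sup>2 = 0" by (simp add: power2_eq_square algebra_simps)
  with l show ?thesis by simp
qed

lemma commute_square: "a * b = b * a \<Longrightarrow> a * (b * b) = b * b * (a::'b::semigroup_mult)"
  by (metis mult.assoc)

lemma sqrt_iter_commute:
  "z * x = x * z \<Longrightarrow> z * sqrt_iter x n = sqrt_iter x n * z"
proof (induction n)
  case (Suc n)
  then have "z * (sqrt_iter x n * sqrt_iter x n) = sqrt_iter x n * sqrt_iter x n * z"
    by (metis mult.assoc)
  with Suc show ?case by (simp add: algebra_simps)
qed simp

text \<open>The iterates and their increments are polynomials in \<open>x\<close> with nonnegative
  coefficients, so for \<open>norm x \<le> 1\<close> the same polynomial at the scalar
  \<open>1\<close> bounds their norm. In the induction for the increments this appears as
  \<open>y' * y' - y * y = (y' + y) * (y' - y)\<close>, valid because iterates commute.\<close>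

lemma sqrt_iter_norm:
  assumes "norm x \<le> 1"
  shows "norm (sqrt_iter x n) \<le> sqrt_iter 1 n"
    and "norm (sqrt_iter x (Suc n) - sqrt_iter x n) \<le> sqrt_iter 1 (Suc n) - sqrt_iter 1 n"
proof -
  show A: "norm (sqrt_iter x n) \<le> sqrt_iter 1 n" for n
  proof (induction n)
    case (Suc n)
    have "norm (x + sqrt_iter x n * sqrt_iter x n) \<le> 1 + sqrt_iter 1 n * sqrt_iter 1 n"
      by (rule norm_triangle_le)
        (use assms Suc norm_mult_ineq[of "sqrt_iter x n" "sqrt_iter x n"]
          mult_mono[OF Suc Suc] sqrt_iter_real_bounds[of n] in simp)
    then show ?case by simp
  qed simp
  show "norm (sqrt_iter x (Suc n) - sqrt_iter x n) \<le> sqrt_iter 1 (Suc n) - sqrt_iter 1 n"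
  proof (induction n)
    case 0
    show ?case using assms by simp
  next
    case (Suc n)
    define y y' where "y = sqrt_iter x n" and "y' = sqrt_iter x (Suc n)"
    define r r' :: real where "r = sqrt_iter 1 n" and "r' = sqrt_iter 1 (Suc n)"
    have comm: "y * y' = y' * y"
      unfolding y_def y'_def by (intro sqrt_iter_commute sqrt_iter_commute[symmetric] refl)
    have "sqrt_iter x (Suc (Suc n)) - sqrt_iter x (Suc n)
        = (1/2) *\<^sub>R (x + y' * y') - (1/2) *\<^sub>R (x + y * y)"
      by (simp add: y_def y'_def)
    also have "\<dots> = (1/2) *\<^sub>R ((y' + y) * (y' - y))"
      unfolding scaleR_diff_right[symmetric] by (simp add: algebra_simps comm)
    finally have "norm (sqrt_iter x (Suc (Suc n)) - sqrt_iter x (Suc n))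
        \<le> (1/2) * (norm (y' + y) * norm (y' - y))"
      using norm_mult_ineq[of "y' + y" "y' - y"] by simp
    also have "norm (y' + y) * norm (y' - y) \<le> (r' + r) * (r' - r)"
    proof (rule mult_mono)
      show "norm (y' + y) \<le> r' + r"
        unfolding y_def y'_def r_def r'_def by (intro norm_triangle_le add_mono A)
      show "norm (y' - y) \<le> r' - r"
        using Suc unfolding y_def y'_def r_def r'_def .
      show "0 \<le> r' + r" unfolding r_def r'_def using sqrt_iter_real_bounds by (meson add_nonneg_nonneg)
    qed simp
    also have "1/2 * ((r' + r) * (r' - r)) = sqrt_iter 1 (Suc (Suc n)) - sqrt_iter 1 (Suc n)"
      unfolding sqrt_iter.simps(2)[of 1 "Suc n"] sqrt_iter.simps(2)[of 1 n]
      by (simp only: r_def r'_def sqrt_iter.simps(2)[of 1 n]) (simp add: field_simps)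
    finally show ?case by simp
  qed
qed

text \<open>Increments telescope, so the Cauchy property is inherited from the scalar majorant. This
  covers \<open>norm x = 1\<close>, where the iteration need not be a strict contraction.\<close>

lemma sqrt_iter_convergent:
  fixes x :: "'b::{real_normed_algebra, banach}"
  assumes "norm x \<le> 1"
  shows "convergent (sqrt_iter x)"
proof -
  have le: "norm (sqrt_iter x (m + k) - sqrt_iter x m) \<le> sqrt_iter 1 (m + k) - sqrt_iter 1 m" for m k
  proof (induction k)
    case (Suc k)
    have "norm (sqrt_iter x (Suc (m + k)) - sqrt_iter x m)
      \<le> norm (sqrt_iter x (Suc (m + k)) - sqrt_iter x (m + k)) + norm (sqrt_iter x (m + k) - sqrt_iter x m)"
      by (metis diff_add_cancel add_diff_eq norm_triangle_ineq)
    with Suc sqrt_iter_norm(2)[OF assms, of "m + k"] show ?case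
      by (simp del: sqrt_iter.simps)
  qed simp
  have "Cauchy (sqrt_iter (1::real))"
    using sqrt_iter_real_tendsto by (rule LIMSEQ_imp_Cauchy)
  have "Cauchy (sqrt_iter x)"
  proof (rule CauchyI')
    fix e :: real assume "0 < e"
    then obtain N where N: "\<And>m n. m \<ge> N \<Longrightarrow> n \<ge> N \<Longrightarrow> norm (sqrt_iter (1::real) m - sqrt_iter 1 n) < e"
      using CauchyD[OF \<open>Cauchy (sqrt_iter (1::real))\<close>] by meson
    have "norm (sqrt_iter x m - sqrt_iter x n) < e" if mn: "m \<ge> N" "n > m" for m n
    proof -
      obtain k where n: "n = m + k" using less_imp_add_positive[OF mn(2)] by blast
      show ?thesis
        using le[of m k] N[of n m] mn unfolding n by (simp add: norm_minus_commute)
    qed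
    then show "\<exists>N. \<forall>m\<ge>N. \<forall>n>m. dist (sqrt_iter x m) (sqrt_iter x n) < e"
      unfolding dist_norm by blast
  qed
  then show ?thesis by (simp add: Cauchy_convergent_iff)
qed

section \<open>Involution, unit, and square roots of \<open>1 - x\<close>\<close>

lemma star_diff: "star (x - y) = star x - star (y::'b::cstar_algebra)"
  by (metis add_diff_cancel diff_add_cancel star_add)

lemma star_minus: "star (- y) = - star (y::'b::cstar_algebra)"
  using star_diff[of 0 y] by simp

lemma star_one [simp]: "star 1 = (1::'b::{cstar_algebra, monoid_mult})"
  by (metis mult_1 mult_1_right star_mult star_star)

lemma norm_one_le: "norm (1::'b::{cstar_algebra, monoid_mult}) \<le> 1"
proof -
  have "norm (1::'b) * (norm (1::'b) - 1) = 0"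
    using cstar_identity[of "1::'b"] by (simp add: power2_eq_square algebra_simps)
  then show ?thesis by auto
qed

lemma tendsto_star: "(f \<longlongrightarrow> a) F \<Longrightarrow> ((\<lambda>n. star (f n)) \<longlongrightarrow> star (a::'b::cstar_algebra)) F"
  using bounded_linear_star by (rule bounded_linear.tendsto)

lemma tendsto_scaleC: "(f \<longlongrightarrow> a) F \<Longrightarrow> ((\<lambda>n. c *\<^sub>C f n) \<longlongrightarrow> c *\<^sub>C (a::'b::cstar_algebra)) F"
  using bounded_linear_scaleC by (rule bounded_linear.tendsto)

text \<open>The root is \<open>w = 1 - y\<close> with \<open>y\<close> the limit of the iteration.
  The bound on \<open>1 - w\<close> makes \<open>w\<close> positive again; the commutation clause
  lets roots of commuting elements commute; the clause on \<open>E\<close> places \<open>w\<close>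
  in every closed right ideal containing \<open>1 - x\<close>.\<close>

lemma sqrt_one_minus:
  fixes x :: "'u::{cstar_algebra, monoid_mult}"
  assumes "star x = x" "norm x \<le> 1"
  obtains w where "star w = w" "w * w = 1 - x" "norm (1 - w) \<le> 1"
    "\<And>z. z * x = x * z \<Longrightarrow> z * w = w * z"
    "\<And>E. \<lbrakk>closed E; subspace E; \<And>e z. e \<in> E \<Longrightarrow> e * z \<in> E; 1 - x \<in> E\<rbrakk> \<Longrightarrow> w \<in> E"
proof -
  obtain y where y: "sqrt_iter x \<longlonglongrightarrow> y"
    using sqrt_iter_convergent[OF assms(2)] convergent_def by blast
  have "(\<lambda>n. sqrt_iter x (Suc n)) \<longlonglongrightarrow> (1/2) *\<^sub>R (x + y * y)"
    unfolding sqrt_iter.simps by (intro tendsto_intros y)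
  then have eq: "y = (1/2) *\<^sub>R (x + y * y)"
    using LIMSEQ_unique LIMSEQ_Suc[OF y] by blast
  then have eq2: "y + y = x + y * y"
    by (metis scaleR_half_double scaleR_add_right)
  have "star (sqrt_iter x n) = sqrt_iter x n" for n
    by (induction n) (simp_all add: star_scaleR star_add star_mult assms)
  then have "star y = y"
    using LIMSEQ_unique[OF tendsto_star[OF y]] y by simp
  have "norm y \<le> 1"
    by (rule LIMSEQ_le_const2[OF tendsto_norm[OF y]])
      (use sqrt_iter_norm(1)[OF assms(2)] sqrt_iter_real_bounds order_trans in blast)
  show ?thesis
  proof (rule that[of "1 - y"])
    show "star (1 - y) = 1 - y" by (simp add: star_diff \<open>star y = y\<close>)
    show "(1 - y) * (1 - y) = 1 - x"
      using eq2 by (simp add: algebra_simps)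
    show "norm (1 - (1 - y)) \<le> 1" using \<open>norm y \<le> 1\<close> by simp
    fix z assume "z * x = x * z"
    then have "z * sqrt_iter x n = sqrt_iter x n * z" for n by (rule sqrt_iter_commute)
    then have "(\<lambda>n. sqrt_iter x n * z) \<longlonglongrightarrow> z * y"
      using tendsto_mult_left[OF y, of z] by simp
    then have "z * y = y * z"
      using tendsto_mult_right[OF y, of z] by (rule LIMSEQ_unique)
    then show "z * (1 - y) = (1 - y) * z" by (simp add: algebra_simps)
  next
    fix E assume E: "closed E" "subspace E" "\<And>e z. e \<in> E \<Longrightarrow> e * z \<in> E" "1 - x \<in> E"
    \<comment> \<open>The iterates need not lie in \<open>E\<close>, but their differences from the
      scalar majorant do: each new one is half of \<open>1 - x\<close> plus
      \<open>r^2 1 - y^2 = (r 1 - y) (r 1 + y)\<close>, a right multiple of the previous one. Since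
      \<open>r\<close> tends to \<open>1\<close>, these differences tend to
      \<open>1 - y\<close>.\<close>
    have in_E: "sqrt_iter 1 n *\<^sub>R 1 - sqrt_iter x n \<in> E" for n
    proof (induction n)
      case 0
      show ?case using subspace_0[OF E(2)] by simp
    next
      case (Suc n)
      let ?r = "sqrt_iter 1 n :: real" and ?y = "sqrt_iter x n"
      have "(1/2) *\<^sub>R ((1 - x) + (?r *\<^sub>R 1 - ?y) * (?r *\<^sub>R 1 + ?y)) \<in> E"
        by (intro subspace_scale subspace_add E Suc)
      moreover have "(1/2) *\<^sub>R ((1 - x) + (?r *\<^sub>R 1 - ?y) * (?r *\<^sub>R 1 + ?y))
        = sqrt_iter 1 (Suc n) *\<^sub>R 1 - sqrt_iter x (Suc n)"
        by (simp add: algebra_simps)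
      ultimately show ?case by simp
    qed
    have "(\<lambda>n. sqrt_iter 1 n *\<^sub>R 1 - sqrt_iter x n) \<longlonglongrightarrow> 1 *\<^sub>R 1 - y"
      by (intro tendsto_intros y sqrt_iter_real_tendsto)
    from closed_sequentially[OF E(1) in_E this] show "1 - y \<in> E" by simp
  qed
qed

text \<open>For self-adjoint \<open>a\<close> the inequality says that the spectrum lies in
  \<open>[0, 2 t]\<close>, in a form that speaks of the norm only.\<close>

definition is_pos :: "'u::{cstar_algebra, monoid_mult} \<Rightarrow> bool"
  where "is_pos a \<longleftrightarrow> star a = a \<and> (\<exists>t\<ge>0. norm (t *\<^sub>R 1 - a) \<le> t)"

lemma is_posI: "\<lbrakk>star a = a; norm (t *\<^sub>R 1 - a) \<le> t\<rbrakk> \<Longrightarrow> is_pos a"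
  unfolding is_pos_def using norm_ge_zero order_trans by blast

lemma is_pos_star: "is_pos a \<Longrightarrow> star a = a"
  by (simp add: is_pos_def)

text \<open>With \<open>x = 1 - a / t\<close> the inequality in \<open>is_pos\<close> becomes
  \<open>norm x \<le> 1\<close>, and the root of \<open>1 - x = a / t\<close> is multiplied by
  \<open>sqrt t\<close>. For \<open>t = 0\<close> the inequality forces
  \<open>a = 0\<close>.\<close>

lemma is_pos_sqrt:
  assumes "is_pos a"
  obtains w where "is_pos w" "w * w = a" "\<And>z. z * a = a * z \<Longrightarrow> z * w = w * z"
    "\<And>E. \<lbrakk>closed E; subspace E; \<And>e z. e \<in> E \<Longrightarrow> e * z \<in> E; a \<in> E\<rbrakk> \<Longrightarrow> w \<in> E"
proof -
  obtain t where t: "0 \<le> t" "norm (t *\<^sub>R 1 - a) \<le> t" and sa: "star a = a"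
    using assms by (auto simp: is_pos_def)
  show ?thesis
  proof (cases "t = 0")
    case True
    with t have "a = 0" by simp
    show ?thesis
      by (rule that[of 0]) (auto simp: \<open>a = 0\<close> subspace_0 intro: is_posI[of _ 0])
  next
    case False
    with t have "t > 0" by simp
    define x where "x = 1 - (1 / t) *\<^sub>R a"
    have "x = (1 / t) *\<^sub>R (t *\<^sub>R 1 - a)"
      using \<open>t > 0\<close> by (simp add: x_def scaleR_diff_right)
    then have "norm x \<le> 1" using t \<open>t > 0\<close> by simp
    moreover have "star x = x" by (simp add: x_def star_diff star_scaleR sa)
    ultimately obtain w where w: "star w = w" "w * w = 1 - x" "norm (1 - w) \<le> 1"
      and comm: "\<And>z. z * x = x * z \<Longrightarrow> z * w = w * z"
      and E: "\<And>E. \<lbrakk>closed E; subspace E; \<And>e z. e \<in> E \<Longrightarrow> e * z \<in> E; 1 - x \<in> E\<rbrakk> \<Longrightarrow> w \<in> E"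
      using sqrt_one_minus[of x] by blast
    show ?thesis
    proof (rule that[of "sqrt t *\<^sub>R w"])
      have "norm (sqrt t *\<^sub>R 1 - sqrt t *\<^sub>R w) \<le> sqrt t"
        unfolding scaleR_diff_right[symmetric] norm_scaleR
        using mult_left_mono[OF w(3), of "sqrt t"] \<open>t > 0\<close> by simp
      then show "is_pos (sqrt t *\<^sub>R w)"
        by (intro is_posI) (simp_all add: star_scaleR w)
      show "sqrt t *\<^sub>R w * sqrt t *\<^sub>R w = a"
        using \<open>t > 0\<close> by (simp add: w x_def)
      show "z * sqrt t *\<^sub>R w = sqrt t *\<^sub>R w * z" if "z * a = a * z" for z
        using comm[of z] that by (simp add: x_def algebra_simps)
      show "sqrt t *\<^sub>R w \<in> E" if "closed E" "subspace E" "\<And>e z. e \<in> E \<Longrightarrow> e * z \<in> E" "a \<in> E" for E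
        using E[OF that(1-3)] that(2,4) by (simp add: x_def subspace_scale)
    qed
  qed
qed

section \<open>Squares, order and norm in a unital C*-algebra\<close>

lemma scaleC_one [simp]: "1 *\<^sub>C x = (x::'b::cstar_algebra)"
  using scaleR_scaleC[of 1 x] by simp

lemma scaleC_zero_left [simp]: "0 *\<^sub>C x = (0::'b::cstar_algebra)"
  using scaleR_scaleC[of 0 x] by simp

lemma scaleC_minus_one [simp]: "(- 1) *\<^sub>C x = - (x::'b::cstar_algebra)"
  using scaleR_scaleC[of "- 1" x] by simp

lemma scaleC_ii: "\<i> *\<^sub>C \<i> *\<^sub>C x = - (x::'b::cstar_algebra)"
  by (simp add: scaleC_scaleC)

lemma scaleC_minus_left: "(- c) *\<^sub>C x = - (c *\<^sub>C (x::'b::cstar_algebra))"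
  using scaleC_scaleC[of "- 1" c x] by simp

lemma scaleC_minus_right: "c *\<^sub>C (- x) = - (c *\<^sub>C (x::'b::cstar_algebra))"
  using bounded_linear_scaleC linear_neg[of "scaleC c"] bounded_linear.linear by blast

lemma scaleC_diff_right: "c *\<^sub>C (x - y) = c *\<^sub>C x - c *\<^sub>C (y::'b::cstar_algebra)"
  using scaleC_add_right[of c x "- y"] by (simp add: scaleC_minus_right)

text \<open>The element \<open>u = h + i k\<close> is normal with
  \<open>star u * u = h * h + k * k\<close> and real part \<open>h\<close>, so
  \<open>norm h \<le> norm u\<close>. This stands in for the monotonicity of the norm until the
  order is available.\<close>

lemma norm_le_commuting_sum_squares:
  fixes h k :: "'b::cstar_algebra"
  assumes "star h = h" "star k = k" "h * k = k * h"
  shows "(norm h)\<^sup>2 \<le> norm (h * h + k * k)"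
proof -
  define u where "u = h + \<i> *\<^sub>C k"
  have su: "star u = h - \<i> *\<^sub>C k"
    by (simp add: u_def star_add star_scaleC assms scaleC_minus_left)
  have "star u * u = h * h + k * k"
    unfolding su unfolding u_def by (simp add: algebra_simps mult_scaleC_left mult_scaleC_right assms
        scaleC_ii scaleC_diff_right)
  then have nu: "(norm u)\<^sup>2 = norm (h * h + k * k)" by (metis cstar_identity)
  have "h + h = star u + u" unfolding su unfolding u_def by simp
  then have "2 * norm h \<le> norm (star u) + norm u"
    by (metis norm_triangle_ineq mult_2 scaleR_2 norm_scaleR abs_numeral)
  then have "norm h \<le> norm u" by simp
  then show ?thesis unfolding nu[symmetric] by (simp add: power_mono)
qed

lemma norm_square_sa: "star h = h \<Longrightarrow> norm (h * h) = (norm (h::'b::cstar_algebra))\<^sup>2"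
  using cstar_identity[of h] by simp

lemma sa_square_eq_0: "\<lbrakk>star h = h; h * h = 0\<rbrakk> \<Longrightarrow> h = (0::'b::cstar_algebra)"
  using norm_square_sa[of h] by simp

text \<open>With \<open>k\<^sup>2 = \<parallel>h\<parallel>\<^sup>2 - h\<^sup>2\<close>, the element \<open>k + i h\<close> is a multiple of a unitary.\<close>

lemma norm_diff_square:
  fixes h :: "'u::{cstar_algebra, monoid_mult}"
  assumes "star h = h"
  shows "norm ((norm (h * h)) *\<^sub>R 1 - h * h) \<le> norm (h * h)"
proof -
  let ?t = "norm (h * h)"
  have sa: "star (h * h) = h * h" by (simp add: star_mult assms)
  \<comment> \<open>There is no circularity: subtracting this element from \<open>?t 1\<close> gives
    back \<open>h * h\<close>, whose norm is \<open>?t\<close>, so it is positive before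
    \<open>h * h\<close> is known to be.\<close>
  have "is_pos (?t *\<^sub>R 1 - h * h)"
    by (rule is_posI[of _ ?t]) (simp_all add: star_diff star_scaleR sa)
  then obtain k where k: "is_pos k" "k * k = ?t *\<^sub>R 1 - h * h"
    and comm: "\<And>z. z * (?t *\<^sub>R 1 - h * h) = (?t *\<^sub>R 1 - h * h) * z \<Longrightarrow> z * k = k * z"
    using is_pos_sqrt by metis
  have "h * k = k * h" by (rule comm) (simp add: algebra_simps)
  then have "norm (k * k) \<le> norm (k * k + h * h)"
    using norm_le_commuting_sum_squares[of k h] k(1) assms is_pos_star[OF k(1)]
    by (simp add: norm_square_sa)
  also have "\<dots> = norm (?t *\<^sub>R (1::'u))" by (simp add: k)
  also have "\<dots> \<le> ?t" using mult_left_mono[OF norm_one_le, of ?t] by simp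
  finally show ?thesis by (simp add: k)
qed

lemma is_pos_square:
  fixes h :: "'u::{cstar_algebra, monoid_mult}"
  assumes "star h = h"
  shows "is_pos (h * h)"
  using norm_diff_square[OF assms] by (intro is_posI) (simp_all add: star_mult assms)

text \<open>The witness \<open>t\<close> in \<open>is_pos\<close> can be taken to be
  \<open>norm a\<close>, because \<open>a\<close> is the square of a self-adjoint element. This
  choice is continuous in \<open>a\<close>, which is what makes the cone closed in
  \<open>is_pos_limit\<close>.\<close>

lemma is_pos_norm_diff:
  assumes "is_pos a"
  shows "norm (norm a *\<^sub>R 1 - a) \<le> norm a"
  using is_pos_sqrt[OF assms] norm_diff_square is_pos_star by metis

lemma is_pos_add:
  assumes "is_pos a" "is_pos b"
  shows "is_pos (a + b)"
proof -
  obtain s t where "norm (s *\<^sub>R 1 - a) \<le> s" "norm (t *\<^sub>R 1 - b) \<le> t"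
    using assms by (auto simp: is_pos_def)
  then have "norm ((s *\<^sub>R 1 - a) + (t *\<^sub>R 1 - b)) \<le> s + t"
    by (intro norm_triangle_le) simp
  then show ?thesis
    using assms by (intro is_posI[of _ "s + t"]) (simp_all add: is_pos_def star_add algebra_simps)
qed

lemma is_pos_scaleR:
  assumes "is_pos a" "0 \<le> r"
  shows "is_pos (r *\<^sub>R a)"
proof -
  obtain t where t: "norm (t *\<^sub>R 1 - a) \<le> t"
    using assms by (auto simp: is_pos_def)
  then have "r * norm (t *\<^sub>R 1 - a) \<le> r * t"
    using \<open>0 \<le> r\<close> by (rule mult_left_mono)
  then have "norm (r *\<^sub>R (t *\<^sub>R 1 - a)) \<le> r * t"
    using assms(2) by simp
  then show ?thesis
    using assms by (intro is_posI[of _ "r * t"]) (simp_all add: is_pos_def star_scaleR scaleR_diff_right)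
qed

lemma is_pos_zero [simp]: "is_pos 0"
  by (rule is_posI[of _ 0]) auto

text \<open>Each root commutes with whatever commutes with its square, so the two roots commute with
  one another and \<open>a * b\<close> is the square of the self-adjoint
  \<open>v * w\<close>.\<close>

lemma is_pos_mult_commute:
  assumes "is_pos a" "is_pos b" "a * b = b * a"
  shows "is_pos (a * b)"
proof -
  obtain v where v: "is_pos v" "v * v = a" "\<And>z. z * a = a * z \<Longrightarrow> z * v = v * z"
    using is_pos_sqrt[OF assms(1)] by metis
  obtain w where w: "is_pos w" "w * w = b" "\<And>z. z * b = b * z \<Longrightarrow> z * w = w * z"
    using is_pos_sqrt[OF assms(2)] by metis
  have "b * v = v * b" by (rule v(3)) (simp add: assms)
  then have vw: "v * w = w * v" by (metis w(3))
  then have "star (v * w) = v * w"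
    using is_pos_star[OF v(1)] is_pos_star[OF w(1)] by (simp add: star_mult)
  then have "is_pos ((v * w) * (v * w))" by (rule is_pos_square)
  moreover have "(v * w) * (v * w) = a * b"
    using vw v(2) w(2) by (metis mult.assoc)
  ultimately show ?thesis by simp
qed

lemma is_pos_limit:
  assumes "\<And>n::nat. is_pos (f n)" "f \<longlonglongrightarrow> a"
  shows "is_pos a"
proof (rule is_posI)
  show "star a = a"
  proof (rule LIMSEQ_unique[OF _ assms(2)])
    show "f \<longlonglongrightarrow> star a"
      using tendsto_star[OF assms(2)] is_pos_star[OF assms(1)] by simp
  qed
  have "(\<lambda>n. norm (norm (f n) *\<^sub>R 1 - f n)) \<longlonglongrightarrow> norm (norm a *\<^sub>R 1 - a)"
    by (intro tendsto_intros assms(2))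
  moreover have "(\<lambda>n. norm (f n)) \<longlonglongrightarrow> norm a" by (intro tendsto_intros assms(2))
  ultimately show "norm (norm a *\<^sub>R 1 - a) \<le> norm a"
    by (rule LIMSEQ_le) (use is_pos_norm_diff assms(1) in blast)
qed

lemma is_pos_bound_diff:
  assumes "star a = a" "norm a \<le> c"
  shows "is_pos (c *\<^sub>R 1 - a)"
  using assms by (intro is_posI[of _ c]) (simp_all add: star_diff star_scaleR)

text \<open>Centre the interval \<open>[0, c]\<close>: with \<open>z = a - (c / 2) 1\<close> and
  \<open>k * k = a * (c 1 - a)\<close> one has \<open>z * z + k * k = (c / 2)^2 1\<close>, so
  \<open>norm z \<le> c / 2\<close> by the estimate for commuting squares.\<close>

lemma norm_le_is_pos_bound:
  assumes "is_pos a" "is_pos (c *\<^sub>R 1 - a)" "0 \<le> c"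
  shows "norm a \<le> c"
proof -
  define z where "z = a - (c / 2) *\<^sub>R 1"
  have "is_pos (a * (c *\<^sub>R 1 - a))"
    by (intro is_pos_mult_commute assms) (simp add: algebra_simps)
  then obtain k where k: "is_pos k" "k * k = a * (c *\<^sub>R 1 - a)"
    and comm: "\<And>z. z * (a * (c *\<^sub>R 1 - a)) = a * (c *\<^sub>R 1 - a) * z \<Longrightarrow> z * k = k * z"
    using is_pos_sqrt by metis
  have "z * k = k * z" by (rule comm) (simp add: z_def algebra_simps)
  moreover have sz: "star z = z" using assms by (simp add: z_def star_diff star_scaleR is_pos_star)
  ultimately have "(norm z)\<^sup>2 \<le> norm (z * z + k * k)"
    using k by (intro norm_le_commuting_sum_squares) (auto simp: is_pos_star)
  also have "z * z + k * k = (c / 2)\<^sup>2 *\<^sub>R 1"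
  proof -
    have "z * z = a * a - (c / 2) *\<^sub>R a - (c / 2) *\<^sub>R a + (c / 2)\<^sup>2 *\<^sub>R 1"
      by (simp add: z_def algebra_simps power2_eq_square)
    also have "\<dots> = a * a - c *\<^sub>R a + (c / 2)\<^sup>2 *\<^sub>R 1"
      by (simp add: diff_diff_eq flip: scaleR_left.add)
    finally show ?thesis by (simp add: k algebra_simps)
  qed
  also have "norm ((c / 2)\<^sup>2 *\<^sub>R (1::'a)) \<le> (c / 2)\<^sup>2"
    using mult_left_mono[OF norm_one_le, of "(c/2)\<^sup>2"] by simp
  finally have "norm z \<le> c / 2"
    using \<open>0 \<le> c\<close> power2_le_imp_le by (metis divide_nonneg_nonneg zero_le_numeral)
  have "norm a \<le> norm z + norm ((c / 2) *\<^sub>R (1::'a))"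
    using norm_triangle_ineq[of z "(c/2) *\<^sub>R 1"] by (simp add: z_def)
  also have "norm ((c / 2) *\<^sub>R (1::'a)) \<le> c / 2"
    using mult_left_mono[OF norm_one_le, of "c/2"] \<open>0 \<le> c\<close> by simp
  finally show ?thesis using \<open>norm z \<le> c / 2\<close> by simp
qed

lemma is_pos_norm_mono:
  assumes "is_pos a" "is_pos (b - a)"
  shows "norm a \<le> norm b"
proof (rule norm_le_is_pos_bound[OF assms(1)])
  have "star b = b" using is_pos_star[OF is_pos_add[OF assms]] by simp
  then have "is_pos ((norm b *\<^sub>R 1 - b) + (b - a))"
    by (intro is_pos_add assms is_pos_bound_diff) simp_all
  then show "is_pos (norm b *\<^sub>R 1 - a)" by simp
qed simp

section \<open>Positivity of \<open>star b * b\<close>\<close>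

text \<open>
  The usual argument compares the spectra of \<open>c\<^sup>* c\<close> and \<open>c c\<^sup>*\<close>.  Here, for \<open>\<parallel>c\<parallel> = 1\<close>,
  \<open>x = c\<^sup>* c\<close> and \<open>y = c c\<^sup>*\<close>, one has \<open>c\<^sup>* (1 + y)\<^sup>n c = x (1 + x)\<^sup>n\<close>, which stays bounded by
  \<open>1\<close>, while \<open>y (1 + y)\<^sup>n y \<ge> n y\<^sup>3\<close>.  Below, \<open>1 + d\<close> stands for \<open>(1 + y)\<^sup>n\<close>.
\<close>

lemma star_mult_neg_eq_0:
  fixes c :: "'u::{cstar_algebra, monoid_mult}"
  assumes neg: "is_pos (- (star c * c))" and pos: "is_pos (c * star c)"
  shows "c = 0"
proof (rule ccontr)
  assume "c \<noteq> 0"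
  define b where "b = (1 / norm c) *\<^sub>R c"
  define x y where "x = star b * b" and "y = b * star b"
  have nb: "norm b = 1" using \<open>c \<noteq> 0\<close> by (simp add: b_def)
  have scale: "- x = ((1 / norm c) * (1 / norm c)) *\<^sub>R (- (star c * c))"
      "y = ((1 / norm c) * (1 / norm c)) *\<^sub>R (c * star c)"
    by (simp_all add: x_def y_def b_def star_scaleR)
  have "is_pos (- x)" "is_pos y"
    unfolding scale by (intro is_pos_scaleR neg pos; simp)+
  have "norm (- x) = 1" unfolding x_def by (simp add: nb cstar_identity)
  then have nx: "norm (1 + x) \<le> 1"
    using is_pos_norm_diff[OF \<open>is_pos (- x)\<close>] by simp
  have ex: "\<exists>d. d * y = y * d \<and> is_pos d \<and> is_pos (d - real n *\<^sub>R y) \<and> norm (star b * (1 + d) * b) \<le> 1" for n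
  proof (induction n)
    case 0
    show ?case by (rule exI[of _ 0]) (simp add: cstar_identity nb)
  next
    case (Suc n)
    then obtain d where d: "d * y = y * d" "is_pos d" "is_pos (d - real n *\<^sub>R y)"
      "norm (star b * (1 + d) * b) \<le> 1" by blast
    \<comment> \<open>Chosen so that \<open>1 + d' = (1 + d) * (1 + y)\<close>. Moving
      \<open>1 + y\<close> past \<open>b\<close> turns it into \<open>1 + x\<close>, as
      \<open>y * b = b * x\<close>, and \<open>norm (1 + x) \<le> 1\<close> preserves the
      bound.\<close>
    define d' where "d' = d + d * y + y"
    have "is_pos (d * y)" by (intro is_pos_mult_commute d(1,2) \<open>is_pos y\<close>)
    have "d' * y = y * d'"
      unfolding d'_def distrib_left distrib_right by (metis d(1) mult.assoc)
    moreover have "is_pos d'"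
      unfolding d'_def by (intro is_pos_add d(2) \<open>is_pos (d * y)\<close> \<open>is_pos y\<close>)
    moreover have "is_pos (d' - real (Suc n) *\<^sub>R y)"
      using is_pos_add[OF d(3) \<open>is_pos (d * y)\<close>] by (simp add: d'_def algebra_simps)
    moreover have "star b * (1 + d') * b = star b * (1 + d) * b * (1 + x)"
      by (simp add: d'_def x_def y_def algebra_simps)
    then have "norm (star b * (1 + d') * b) \<le> 1"
      using norm_mult_ineq[of "star b * (1 + d) * b" "1 + x"] mult_mono[OF d(4) nx] by simp
    ultimately show ?case by blast
  qed
  have bound: "real n * norm (y * y * y) \<le> 1" for n
  proof -
    obtain d where d: "d * y = y * d" "is_pos d" "is_pos (d - real n *\<^sub>R y)"
      "norm (star b * (1 + d) * b) \<le> 1"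
      using ex by blast
    have yy: "is_pos (y * y)" by (intro is_pos_square is_pos_star \<open>is_pos y\<close>)
    have "(d - real n *\<^sub>R y) * (y * y) = (y * y) * (d - real n *\<^sub>R y)"
      using d(1) by (simp add: algebra_simps) (metis mult.assoc)
    then have "is_pos ((d - real n *\<^sub>R y) * (y * y))"
      by (intro is_pos_mult_commute d(3) yy)
    from is_pos_add[OF this yy]
    have "is_pos ((1 + d) * (y * y) - real n *\<^sub>R (y * y * y))"
      by (simp add: algebra_simps)
    moreover have "is_pos (real n *\<^sub>R (y * y * y))"
      by (intro is_pos_scaleR is_pos_mult_commute yy \<open>is_pos y\<close>) (simp_all add: mult.assoc)
    ultimately have "norm (real n *\<^sub>R (y * y * y)) \<le> norm ((1 + d) * (y * y))"
      by (rule is_pos_norm_mono[rotated])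
    also have "(1 + d) * (y * y) = y * (1 + d) * y"
      using d(1) by (simp add: algebra_simps) (metis mult.assoc)
    also have "\<dots> = b * (star b * (1 + d) * b) * star b"
      by (simp add: y_def mult.assoc)
    also have "norm \<dots> \<le> norm (b * (star b * (1 + d) * b)) * norm (star b)"
      by (rule norm_mult_ineq)
    also have "\<dots> \<le> norm b * norm (star b * (1 + d) * b) * norm (star b)"
      by (intro mult_right_mono norm_mult_ineq) simp
    finally show ?thesis using d(4) nb by simp
  qed
  have "norm (y * y * y) = 0"
  proof (rule ccontr)
    assume "norm (y * y * y) \<noteq> 0"
    then obtain n where "1 < real n * norm (y * y * y)"
      using reals_Archimedean3[of "norm (y * y * y)"] by auto
    with bound[of n] show False by simp
  qed
  then have "(y * y) * (y * y) = 0" by (simp flip: mult.assoc)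
  moreover have "star y = y" using \<open>is_pos y\<close> by (rule is_pos_star)
  ultimately have "y = 0"
    by (metis sa_square_eq_0 star_mult)
  then have "norm (star (star b) * star b) = 0" by (simp add: y_def star_star)
  then show False by (simp add: cstar_identity nb)
qed

text \<open>Kaplansky's argument, applied to \<open>c = b (\<bar>a\<bar> - a)\<close> with \<open>a = b\<^sup>* b\<close>.\<close>

lemma is_pos_star_mult:
  fixes b :: "'u::{cstar_algebra, monoid_mult}"
  shows "is_pos (star b * b)"
proof -
  define a where "a = star b * b"
  have sa: "star a = a" by (simp add: a_def star_mult star_star)
  obtain m where m: "is_pos m" "m * m = a * a" and comm: "\<And>z. z * (a * a) = a * a * z \<Longrightarrow> z * m = m * z"
    using is_pos_sqrt[OF is_pos_square[OF sa]] by metis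
  have am: "a * m = m * a" by (rule comm) (simp add: mult.assoc)
  \<comment> \<open>Here \<open>m\<close> plays the role of \<open>\<bar>a\<bar>\<close>, so
    \<open>n\<close> is twice the negative part of \<open>a\<close>; the aim is
    \<open>n = 0\<close>, which leaves \<open>a = m\<close>.\<close>
  define n where "n = m - a"
  have sn: "star n = n" by (simp add: n_def star_diff sa is_pos_star m)
  have mn: "m * n = n * m" by (simp add: n_def algebra_simps am)
  have an: "a * n = - (m * n)" by (simp add: n_def algebra_simps m am)
  have pos: "is_pos (m * (n * n))"
    by (rule is_pos_mult_commute[OF m(1) is_pos_square[OF sn] commute_square[OF mn]])
  define c where "c = b * n"
  have cc: "star c * c = - (m * (n * n))"
  proof -
    have "star c * c = n * (a * n)" by (simp add: c_def a_def star_mult sn mult.assoc)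
    also have "\<dots> = - (m * (n * n))" by (metis an mn mult.assoc mult_minus_right)
    finally show ?thesis .
  qed
  \<comment> \<open>The real and imaginary parts of \<open>c\<close>. The identity
    \<open>star c * c + c * star c = 2 (h^2 + k^2)\<close> turns negativity of
    \<open>star c * c\<close> into positivity of \<open>c * star c\<close>, the situation of
    \<open>star_mult_neg_eq_0\<close>.\<close>
  define h k where "h = (1/2) *\<^sub>R (c + star c)" and "k = \<i> *\<^sub>C ((1/2) *\<^sub>R (star c - c))"
  have sh: "star h = h" by (simp add: h_def star_scaleR star_add star_star add.commute)
  have "star ((1/2) *\<^sub>R (star c - c)) = - ((1/2) *\<^sub>R (star c - c))"
    by (simp add: star_scaleR star_diff star_star flip: scaleR_minus_right)
  then have sk: "star k = k"
    by (simp add: k_def star_scaleC scaleC_minus_left scaleC_minus_right)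
  have "(\<i> *\<^sub>C d) * (\<i> *\<^sub>C d) = - (d * d)" for d :: 'u
    by (simp add: mult_scaleC_left mult_scaleC_right scaleC_ii)
  then have "h * h + k * k = (1/4) *\<^sub>R ((c + star c) * (c + star c) - (star c - c) * (star c - c))"
    by (simp add: h_def k_def algebra_simps)
  also have "(c + star c) * (c + star c) - (star c - c) * (star c - c) = 2 *\<^sub>R (star c * c + c * star c)"
    by (simp add: algebra_simps scaleR_2)
  finally have "c * star c = 2 *\<^sub>R (h * h + k * k) + m * (n * n)"
    by (simp add: cc)
  then have "is_pos (c * star c)"
    by (simp only:) (intro is_pos_add is_pos_scaleR is_pos_square pos sh sk, simp)
  moreover have "is_pos (- (star c * c))" by (simp add: cc pos)
  ultimately have "c = 0" using star_mult_neg_eq_0 by blast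
  then have mnn: "m * (n * n) = 0" using cc by simp
  have "n * (n * n) = m * (n * n) - a * n * n" by (simp add: n_def algebra_simps)
  then have "n * (n * n) = 0" by (simp add: an mnn mult.assoc)
  then have "(n * n) * (n * n) = 0" by (simp add: mult.assoc)
  then have "n = 0" by (metis sa_square_eq_0 star_mult sn)
  then show ?thesis using m by (simp add: n_def a_def)
qed

section \<open>Positivity in arbitrary C*-algebras\<close>

lemma lmult_embed [simp]: "mult_embed a \<cdot>\<^sub>l b = a * b"
  by transfer simp

lemma rmult_embed [simp]: "b \<cdot>\<^sub>r mult_embed a = b * a"
  by transfer simp

lemma mult_embed_add: "mult_embed (a + b) = mult_embed a + mult_embed b"
  by (rule multiplier_eqI_left) (simp add: lmult_simps distrib_right)

lemma mult_embed_diff: "mult_embed (a - b) = mult_embed a - mult_embed b"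
  by (rule multiplier_eqI_left) (simp add: lmult_simps left_diff_distrib)

lemma mult_embed_zero [simp]: "mult_embed 0 = 0"
  by (rule multiplier_eqI_left) (simp add: lmult_simps)

lemma mult_embed_scaleC: "mult_embed (c *\<^sub>C a) = c *\<^sub>C mult_embed a"
  by (rule multiplier_eqI_left) (simp add: scaleC_lmult mult_scaleC_left)

lemma mult_embed_scaleR: "mult_embed (r *\<^sub>R a) = r *\<^sub>R mult_embed a"
  by (simp add: scaleR_scaleC mult_embed_scaleC)

lemma mult_embed_times: "mult_embed (a * b) = mult_embed a * mult_embed b"
  by (simp add: mult_embed_mult)

lemma mult_embed_star: "mult_embed (star a) = star (mult_embed a)"
  by (rule multiplier_eqI_left) (simp add: star_lmult star_mult star_star)

lemma norm_mult_embed [simp]: "norm (mult_embed a) = norm a"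
proof (rule antisym)
  show "norm (mult_embed a) \<le> norm a"
    by (rule norm_multiplier_bound) (simp_all add: norm_mult_ineq)
  have "norm a * norm a = norm (a * star a)"
    using cstar_identity[of "star a"] by (simp add: star_star power2_eq_square)
  also have "\<dots> \<le> norm (mult_embed a) * norm a"
    using norm_lmult[of "mult_embed a" "star a"] by simp
  finally show "norm a \<le> norm (mult_embed a)"
    by (cases "a = 0") auto
qed

lemma mult_embed_eq_iff [simp]: "mult_embed a = mult_embed b \<longleftrightarrow> a = b"
  by (metis eq_iff_diff_eq_0 mult_embed_diff norm_eq_zero norm_mult_embed)

lemma bounded_linear_mult_embed: "bounded_linear mult_embed"
  by (rule bounded_linear_intro[where K = 1]) (simp_all add: mult_embed_add mult_embed_scaleR)

lemma closed_range_mult_embed: "closed (range (mult_embed :: 'a::cstar_algebra \<Rightarrow> _))"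
proof (rule complete_imp_closed)
  show "complete (range (mult_embed :: 'a \<Rightarrow> _))"
    by (rule complete_isometric_image[OF zero_less_one subspace_UNIV bounded_linear_mult_embed])
      (simp_all add: complete_UNIV)
qed

lemma rmult_one [simp]: "a \<cdot>\<^sub>r 1 = a"
  by transfer simp

lemma cpositive_star_mult: "cpositive (star b * b)"
  unfolding cpositive_def by blast

text \<open>One direction is \<open>is_pos_star_mult\<close> in \<open>M(A)\<close>. Conversely, the
  root of \<open>mult_embed a\<close> taken in \<open>M(A)\<close> lies in \<open>A\<close>, because
  the image of \<open>A\<close> is a closed right ideal; being self-adjoint, it exhibits
  \<open>a\<close> as \<open>star b * b\<close>.\<close>

lemma cpositive_iff_embed: "cpositive a \<longleftrightarrow> is_pos (mult_embed a)"
proof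
  assume "cpositive a"
  then obtain b where "a = star b * b" by (auto simp: cpositive_def)
  then show "is_pos (mult_embed a)"
    by (simp add: mult_embed_times mult_embed_star is_pos_star_mult)
next
  assume "is_pos (mult_embed a)"
  then obtain w where w: "is_pos w" "w * w = mult_embed a"
    and E: "\<And>E. \<lbrakk>closed E; subspace E; \<And>e z. e \<in> E \<Longrightarrow> e * z \<in> E; mult_embed a \<in> E\<rbrakk> \<Longrightarrow> w \<in> E"
    using is_pos_sqrt by metis
  have "w \<in> range mult_embed"
  proof (rule E)
    show "subspace (range (mult_embed :: 'a \<Rightarrow> _))"
      using linear_subspace_image[OF bounded_linear.linear[OF bounded_linear_mult_embed] subspace_UNIV] .
  qed (auto simp: closed_range_mult_embed mult_embed_mult)
  then obtain b where b: "w = mult_embed b" by blast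
  then have "mult_embed a = mult_embed (star b * b)"
    using w is_pos_star[OF w(1)] by (simp add: mult_embed_times mult_embed_star)
  then show "cpositive a" by (simp add: cpositive_star_mult)
qed

lemma cpositive_star: "cpositive a \<Longrightarrow> star a = a"
  by (auto simp: cpositive_def star_mult star_star)

lemma cpositive_add: "\<lbrakk>cpositive a; cpositive b\<rbrakk> \<Longrightarrow> cpositive (a + b)"
  by (simp add: cpositive_iff_embed mult_embed_add is_pos_add)

lemma cpositive_scaleR: "\<lbrakk>cpositive a; 0 \<le> r\<rbrakk> \<Longrightarrow> cpositive (r *\<^sub>R a)"
  by (simp add: cpositive_iff_embed mult_embed_scaleR is_pos_scaleR)

lemma cpositive_limit: "\<lbrakk>\<And>n::nat. cpositive (f n); f \<longlonglongrightarrow> a\<rbrakk> \<Longrightarrow> cpositive a"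
  unfolding cpositive_iff_embed
  by (rule is_pos_limit[OF _ bounded_linear.tendsto[OF bounded_linear_mult_embed]])

lemma cpositive_norm_mono: "\<lbrakk>cpositive a; cpositive (b - a)\<rbrakk> \<Longrightarrow> norm a \<le> norm b"
  using is_pos_norm_mono[of "mult_embed a" "mult_embed b"]
  by (simp add: cpositive_iff_embed mult_embed_diff)

text \<open>The difference is \<open>star (w * c) * (w * c)\<close> for a self-adjoint root
  \<open>w\<close> of \<open>t 1 - a\<close>. The root is taken in \<open>M(A)\<close>, as
  \<open>A\<close> may have no unit.\<close>

lemma cpositive_conj_bound:
  assumes "star a = a" "norm a \<le> t"
  shows "cpositive (t *\<^sub>R (star c * c) - star c * a * c)"
proof -
  have "is_pos (t *\<^sub>R 1 - mult_embed a)"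
    using assms by (intro is_pos_bound_diff) (simp_all flip: mult_embed_star)
  then obtain w where w: "is_pos w" "w * w = t *\<^sub>R 1 - mult_embed a"
    using is_pos_sqrt by metis
  have "star (w * mult_embed c) * (w * mult_embed c) = star (mult_embed c) * (w * w) * mult_embed c"
    by (simp add: star_mult is_pos_star[OF w(1)] mult.assoc)
  also have "\<dots> = mult_embed (t *\<^sub>R (star c * c) - star c * a * c)"
    unfolding w by (simp add: mult_embed_diff mult_embed_scaleR mult_embed_times mult_embed_star algebra_simps)
  finally show ?thesis
    unfolding cpositive_iff_embed by (metis is_pos_star_mult)
qed

section \<open>Star homomorphisms are contractive; positive maps preserve the involution\<close>

lemma clinear_map_simps:
  assumes "clinear_map f"
  shows "f (x + y) = f x + f y" "f (c *\<^sub>C x) = c *\<^sub>C f x" "f (r *\<^sub>R x) = r *\<^sub>R f x"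
    "f 0 = 0" "f (- x) = - f x" "f (x - y) = f x - f y"
proof -
  show add: "f (x + y) = f x + f y" for x y using assms by (simp add: clinear_map_def)
  show "f (c *\<^sub>C x) = c *\<^sub>C f x" using assms by (simp add: clinear_map_def)
  show scale: "f (r *\<^sub>R x) = r *\<^sub>R f x" for r x using assms by (simp add: clinear_map_def scaleR_scaleC)
  show "f 0 = 0" using scale[of 0 0] by simp
  show "f (- x) = - f x" using scale[of "-1" x] by simp
  then show "f (x - y) = f x - f y" using add[of x "- y"] scale[of "-1" y] by simp
qed

text \<open>Applying \<open>g\<close> to \<open>w * w = (norm a)^2 1 - star a * a\<close> gives
  \<open>star (g a) * g a \<le> (norm a)^2 g 1\<close>. The unit need not be preserved, but
  \<open>g 1\<close> is a projection and so has norm at most \<open>1\<close>.\<close>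

lemma star_hom_norm_le:
  fixes g :: "'u::{cstar_algebra, monoid_mult} \<Rightarrow> 'v::{cstar_algebra, monoid_mult}"
  assumes "star_hom g"
  shows "norm (g a) \<le> norm a"
proof -
  have lin: "clinear_map g" and mul: "\<And>x y. g (x * y) = g x * g y" and st: "\<And>x. g (star x) = star (g x)"
    using assms by (auto simp: star_hom_def)
  let ?t = "(norm a)\<^sup>2"
  have "is_pos (?t *\<^sub>R 1 - star a * a)"
    by (rule is_pos_bound_diff) (simp_all add: star_mult star_star cstar_identity)
  then obtain w where w: "is_pos w" "w * w = ?t *\<^sub>R 1 - star a * a"
    using is_pos_sqrt by metis
  have "star (g w) * g w = ?t *\<^sub>R g 1 - star (g a) * g a"
    by (metis w is_pos_star mul st clinear_map_simps(3,6)[OF lin])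
  then have "is_pos (?t *\<^sub>R g 1 - star (g a) * g a)" by (metis is_pos_star_mult)
  then have "norm (star (g a) * g a) \<le> norm (?t *\<^sub>R g 1)"
    by (intro is_pos_norm_mono is_pos_star_mult)
  moreover have "norm (g 1) \<le> 1"
  proof -
    have "g 1 = star (g 1) * g 1" by (metis mul st star_one mult_1)
    then have "norm (g 1) * (norm (g 1) - 1) = 0"
      using cstar_identity[of "g 1"] by (simp add: power2_eq_square algebra_simps)
    then show ?thesis by auto
  qed
  then have "norm (?t *\<^sub>R g 1) \<le> ?t"
    using mult_left_mono[of "norm (g 1)" 1 ?t] by simp
  ultimately have "(norm (g a))\<^sup>2 \<le> ?t"
    unfolding cstar_identity by (rule order_trans)
  then show ?thesis using power2_le_imp_le norm_ge_zero by blast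
qed

text \<open>Polarization settles arguments of the form \<open>star y * x\<close>, because
  \<open>T\<close> is self-adjoint on differences of positive elements. A general \<open>a\<close>
  is a limit of such products \<open>u * a\<close>, with \<open>u\<close> positive from the
  approximate unit, and \<open>T\<close> is continuous.\<close>

lemma positive_map_star:
  fixes T :: "'a::cstar_algebra \<Rightarrow> 'b::cstar_algebra" and F :: "'a filter"
  assumes lin: "clinear_map T" and cont: "continuous_on UNIV T"
    and pos: "\<And>a. cpositive a \<Longrightarrow> cpositive (T a)" and F: "approximate_unit F"
  shows "T (star a) = star (T a)"
proof -
  note T = clinear_map_simps[OF lin]
  have polar: "T (star y * x) = star (T (star x * y))" for x y
  proof -
    define q where "q z = star z * z" for z :: 'a
    \<comment> \<open>One has \<open>d = 2 (star x * y + star y * x)\<close> and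
      \<open>e = 2 i (star x * y - star y * x)\<close>, so \<open>4 star x * y = d - i e\<close> and
      \<open>4 star y * x = d + i e\<close>. As \<open>T d\<close> and \<open>T e\<close> are
      self-adjoint, taking adjoints exchanges the images of the two.\<close>
    define d e where "d = q (x + y) - q (x - y)" and "e = q (x + \<i> *\<^sub>C y) - q (x - \<i> *\<^sub>C y)"
    have sq: "star (T (q z)) = T (q z)" for z
      using pos[OF cpositive_star_mult] cpositive_star unfolding q_def by blast
    have sd: "star (T d) = T d" and se: "star (T e) = T e"
      by (simp_all add: d_def e_def T star_diff sq)
    have d: "d = 2 *\<^sub>R (star x * y) + 2 *\<^sub>R (star y * x)"
      by (simp add: d_def q_def star_add star_diff algebra_simps scaleR_2)
    have e: "e = 2 *\<^sub>R (\<i> *\<^sub>C (star x * y)) - 2 *\<^sub>R (\<i> *\<^sub>C (star y * x))"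
      by (simp add: e_def q_def star_add star_diff star_scaleC scaleC_minus_left algebra_simps
          scaleR_2 mult_scaleC_left mult_scaleC_right scaleC_ii scaleC_diff_right scaleC_minus_right scaleC_add_right)
    have ie: "\<i> *\<^sub>C e = 2 *\<^sub>R (star y * x) - 2 *\<^sub>R (star x * y)"
      by (simp add: e scaleR_2 scaleC_diff_right scaleC_add_right scaleC_ii)
    have "4 *\<^sub>R (star x * y) = d - \<i> *\<^sub>C e" "4 *\<^sub>R (star y * x) = d + \<i> *\<^sub>C e"
      unfolding ie d by (simp_all flip: scaleR_left.add)
    then have "4 *\<^sub>R T (star x * y) = T d - \<i> *\<^sub>C T e" "4 *\<^sub>R T (star y * x) = T d + \<i> *\<^sub>C T e"
      by (metis T)+
    then have "4 *\<^sub>R star (T (star x * y)) = 4 *\<^sub>R T (star y * x)"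
      by (simp add: star_diff star_scaleC sd se scaleC_minus_left flip: star_scaleR)
    then show ?thesis by simp
  qed
  have T_tendsto: "((\<lambda>u. T (f u)) \<longlongrightarrow> T b) F" if "(f \<longlongrightarrow> b) F" for f :: "'a \<Rightarrow> 'a" and b
    using continuous_on_tendsto_compose[OF cont that] by simp
  have nb: "F \<noteq> bot" and left: "((\<lambda>u. u * a) \<longlongrightarrow> a) F" and right: "((\<lambda>u. star a * u) \<longlongrightarrow> star a) F"
    and ev: "\<forall>\<^sub>F u in F. cpositive u" 
    using F by (auto simp: approximate_unit_def elim: eventually_mono)
  have "((\<lambda>u. star (T (u * a))) \<longlongrightarrow> star (T a)) F"
    by (intro tendsto_star T_tendsto left)
  moreover have "\<forall>\<^sub>F u in F. star (T (u * a)) = T (star a * u)"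
    using ev by eventually_elim (metis polar cpositive_star)
  ultimately have "((\<lambda>u. T (star a * u)) \<longlongrightarrow> star (T a)) F"
    by (rule Lim_transform_eventually)
  then show ?thesis using tendsto_unique[OF nb T_tendsto[OF right]] by blast
qed

section \<open>Semi-inner product bimodules\<close>

definition mnorm :: "('a::cstar_algebra, 'm) bimodule \<Rightarrow> 'm \<Rightarrow> real"
  where "mnorm M x = sqrt (norm (ip M x x))"

definition msub :: "('a::cstar_algebra, 'm) bimodule \<Rightarrow> 'm \<Rightarrow> 'm \<Rightarrow> 'm"
  where "msub M x y = madd M x (mscale M (- 1) y)"

lemma mdist_msub: "mdist M x y = mnorm M (msub M x y)"
  by (simp add: mdist_def mnorm_def msub_def Let_def)

lemma mdist_nonneg [simp]: "0 \<le> mdist M x y"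
  by (simp add: mdist_msub mnorm_def)

lemma mnorm_nonneg [simp]: "0 \<le> mnorm M x"
  by (simp add: mnorm_def)

lemma mnorm_square: "(mnorm M x)\<^sup>2 = norm (ip M x x)"
  by (simp add: mnorm_def)

text \<open>A Hilbert bimodule without definiteness and completeness. Identities that the adjoint
  rule would yield only up to vectors of length zero, such as linearity of \<open>lact\<close> in
  the vector, are therefore axioms; so is the bound \<open>mnorm_lact\<close>, through which the
  left action passes to the completion. The axiom \<open>scale_zero\<close> provides additive
  inverses.\<close>

locale pre_bimodule =
  fixes M :: "('a::cstar_algebra, 'm) bimodule"
  assumes zero_closed: "mzero M \<in> carrier M"
    and add_closed: "\<lbrakk>x \<in> carrier M; y \<in> carrier M\<rbrakk> \<Longrightarrow> madd M x y \<in> carrier M"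
    and scale_closed: "x \<in> carrier M \<Longrightarrow> mscale M c x \<in> carrier M"
    and ract_closed: "x \<in> carrier M \<Longrightarrow> ract M x a \<in> carrier M"
    and lact_closed: "x \<in> carrier M \<Longrightarrow> lact M a x \<in> carrier M"
    and add_assoc: "\<lbrakk>x \<in> carrier M; y \<in> carrier M; z \<in> carrier M\<rbrakk>
      \<Longrightarrow> madd M (madd M x y) z = madd M x (madd M y z)"
    and add_commute: "\<lbrakk>x \<in> carrier M; y \<in> carrier M\<rbrakk> \<Longrightarrow> madd M x y = madd M y x"
    and add_zero: "x \<in> carrier M \<Longrightarrow> madd M x (mzero M) = x"
    and scale_add: "\<lbrakk>x \<in> carrier M; y \<in> carrier M\<rbrakk>
      \<Longrightarrow> mscale M c (madd M x y) = madd M (mscale M c x) (mscale M c y)"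
    and add_scale: "x \<in> carrier M \<Longrightarrow> mscale M (c + d) x = madd M (mscale M c x) (mscale M d x)"
    and scale_scale: "x \<in> carrier M \<Longrightarrow> mscale M c (mscale M d x) = mscale M (c * d) x"
    and scale_one: "x \<in> carrier M \<Longrightarrow> mscale M 1 x = x"
    and scale_zero: "x \<in> carrier M \<Longrightarrow> mscale M 0 x = mzero M"
    and ract_add_left: "\<lbrakk>x \<in> carrier M; y \<in> carrier M\<rbrakk>
      \<Longrightarrow> ract M (madd M x y) a = madd M (ract M x a) (ract M y a)"
    and ract_add_right: "x \<in> carrier M \<Longrightarrow> ract M x (a + b) = madd M (ract M x a) (ract M x b)"
    and ract_mult: "x \<in> carrier M \<Longrightarrow> ract M x (a * b) = ract M (ract M x a) b"
    and ract_scale_left: "x \<in> carrier M \<Longrightarrow> ract M (mscale M c x) a = mscale M c (ract M x a)"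
    and ract_scale_right: "x \<in> carrier M \<Longrightarrow> ract M x (c *\<^sub>C a) = mscale M c (ract M x a)"
    and lact_add_left: "x \<in> carrier M \<Longrightarrow> lact M (a + b) x = madd M (lact M a x) (lact M b x)"
    and lact_add_right: "\<lbrakk>x \<in> carrier M; y \<in> carrier M\<rbrakk>
      \<Longrightarrow> lact M a (madd M x y) = madd M (lact M a x) (lact M a y)"
    and lact_mult: "x \<in> carrier M \<Longrightarrow> lact M (a * b) x = lact M a (lact M b x)"
    and lact_scale_left: "x \<in> carrier M \<Longrightarrow> lact M (c *\<^sub>C a) x = mscale M c (lact M a x)"
    and lact_scale_right: "x \<in> carrier M \<Longrightarrow> lact M a (mscale M c x) = mscale M c (lact M a x)"
    and ip_add: "\<lbrakk>x \<in> carrier M; y \<in> carrier M; z \<in> carrier M\<rbrakk>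
      \<Longrightarrow> ip M x (madd M y z) = ip M x y + ip M x z"
    and ip_scale: "\<lbrakk>x \<in> carrier M; y \<in> carrier M\<rbrakk> \<Longrightarrow> ip M x (mscale M c y) = c *\<^sub>C ip M x y"
    and ip_ract: "\<lbrakk>x \<in> carrier M; y \<in> carrier M\<rbrakk> \<Longrightarrow> ip M x (ract M y a) = ip M x y * a"
    and ip_star: "\<lbrakk>x \<in> carrier M; y \<in> carrier M\<rbrakk> \<Longrightarrow> star (ip M x y) = ip M y x"
    and ip_positive: "x \<in> carrier M \<Longrightarrow> cpositive (ip M x x)"
    and lact_adjoint: "\<lbrakk>x \<in> carrier M; y \<in> carrier M\<rbrakk>
      \<Longrightarrow> ip M (lact M a x) y = ip M x (lact M (star a) y)"
    and mnorm_lact: "x \<in> carrier M \<Longrightarrow> mnorm M (lact M a x) \<le> norm a * mnorm M x"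
begin

lemmas closed = zero_closed add_closed scale_closed ract_closed lact_closed

lemma msub_closed: "\<lbrakk>x \<in> carrier M; y \<in> carrier M\<rbrakk> \<Longrightarrow> msub M x y \<in> carrier M"
  by (simp add: msub_def closed)

lemma msub_self: "x \<in> carrier M \<Longrightarrow> msub M x x = mzero M"
  using add_scale[of x 1 "- 1"] by (simp add: msub_def scale_one scale_zero)

lemma add_left_commute: "\<lbrakk>x \<in> carrier M; y \<in> carrier M; z \<in> carrier M\<rbrakk>
    \<Longrightarrow> madd M x (madd M y z) = madd M y (madd M x z)"
  by (metis add_assoc add_commute)

lemmas add_ac = add_assoc add_commute add_left_commute

lemma msub_add_cancel: "\<lbrakk>x \<in> carrier M; y \<in> carrier M\<rbrakk> \<Longrightarrow> madd M (msub M x y) y = x"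
proof -
  assume xy: "x \<in> carrier M" "y \<in> carrier M"
  have "madd M (msub M x y) y = madd M x (madd M (mscale M (- 1) y) y)"
    by (simp add: msub_def add_assoc closed xy)
  also have "madd M (mscale M (- 1) y) y = msub M y y"
    unfolding msub_def by (intro add_commute closed xy)
  finally show ?thesis by (simp add: msub_self add_zero xy)
qed

lemma ip_add_left: "\<lbrakk>x \<in> carrier M; y \<in> carrier M; z \<in> carrier M\<rbrakk>
    \<Longrightarrow> ip M (madd M x y) z = ip M x z + ip M y z"
  using arg_cong[OF ip_add[of z x y], of star] by (simp add: ip_star add_closed star_add)

lemma ip_scale_left: "\<lbrakk>x \<in> carrier M; y \<in> carrier M\<rbrakk> \<Longrightarrow> ip M (mscale M c x) y = cnj c *\<^sub>C ip M x y"
  using arg_cong[OF ip_scale[of y x c], of star] by (simp add: ip_star scale_closed star_scaleC)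

lemma ip_ract_left: "\<lbrakk>x \<in> carrier M; y \<in> carrier M\<rbrakk> \<Longrightarrow> ip M (ract M x a) y = star a * ip M x y"
  using arg_cong[OF ip_ract[of y x a], of star] by (simp add: ip_star ract_closed star_mult)

lemma ip_msub: "\<lbrakk>x \<in> carrier M; y \<in> carrier M; z \<in> carrier M\<rbrakk>
    \<Longrightarrow> ip M x (msub M y z) = ip M x y - ip M x z"
  by (simp add: msub_def ip_add ip_scale closed)

lemma ip_msub_left: "\<lbrakk>x \<in> carrier M; y \<in> carrier M; z \<in> carrier M\<rbrakk>
    \<Longrightarrow> ip M (msub M x y) z = ip M x z - ip M y z"
  by (simp add: msub_def ip_add_left ip_scale_left closed)

lemma ip_zero: "x \<in> carrier M \<Longrightarrow> ip M x (mzero M) = 0"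
  using ip_add[of x "mzero M" "mzero M"] by (simp add: closed add_zero)

text \<open>Expand \<open>ip M z z\<close> for \<open>z = x b + y\<close> with
  \<open>b = - a / s\<close>. Since \<open>star b * ip M x x * b \<le> s (star b * b) = (1 / s)
  (star a * a)\<close>, one of the two negative terms survives, and
  \<open>(1 / s) (star a * a) \<le> ip M y y\<close>. Taking \<open>s\<close> positive and letting
  it decrease to \<open>norm (ip M x x)\<close> also covers a vector \<open>x\<close> of length
  zero.\<close>

lemma ip_Cauchy_Schwarz:
  assumes x: "x \<in> carrier M" and y: "y \<in> carrier M"
  shows "norm (ip M x y) \<le> mnorm M x * mnorm M y"
proof -
  define a where "a = ip M x y"
  have bound: "(norm a)\<^sup>2 \<le> s * norm (ip M y y)" if s: "s > 0" "s \<ge> norm (ip M x x)" for s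
  proof -
    define b where "b = - ((1 / s) *\<^sub>R a)"
    define z where "z = madd M (ract M x b) y"
    have zc: "z \<in> carrier M" by (simp add: z_def closed x y)
    have sb: "star b = - ((1 / s) *\<^sub>R star a)"
      by (simp add: b_def star_minus star_scaleR)
    have yx: "ip M y x = star a" by (simp add: a_def ip_star x y)
    have "ip M z z = star b * ip M x x * b + star b * ip M x y + ip M y x * b + ip M y y"
      unfolding z_def by (simp add: ip_add ip_add_left ip_ract ip_ract_left closed x y algebra_simps)
    also have "\<dots> = star b * ip M x x * b - (1 / s) *\<^sub>R (star a * a) - (1 / s) *\<^sub>R (star a * a) + ip M y y"
      by (simp add: sb yx) (simp add: b_def a_def)
    finally have zz: "ip M z z = star b * ip M x x * b - (1 / s) *\<^sub>R (star a * a) - (1 / s) *\<^sub>R (star a * a)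
      + ip M y y" .
    have "star b * b = (1 / s * (1 / s)) *\<^sub>R (star a * a)"
      by (simp add: sb) (simp add: b_def)
    then have bb: "s *\<^sub>R (star b * b) = (1 / s) *\<^sub>R (star a * a)"
      using s by simp
    have "cpositive (s *\<^sub>R (star b * b) - star b * ip M x x * b)"
      by (rule cpositive_conj_bound) (simp_all add: ip_star x s)
    from cpositive_add[OF this ip_positive[OF zc]]
    have "cpositive (ip M y y - (1 / s) *\<^sub>R (star a * a))"
      unfolding zz bb by (simp add: algebra_simps)
    moreover have "cpositive ((1 / s) *\<^sub>R (star a * a))"
      using s by (intro cpositive_scaleR cpositive_star_mult) simp
    ultimately have "norm ((1 / s) *\<^sub>R (star a * a)) \<le> norm (ip M y y)"
      by (intro cpositive_norm_mono)
    then show ?thesis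
      using s by (simp add: cstar_identity field_simps)
  qed
  have "(norm a)\<^sup>2 \<le> norm (ip M x x) * norm (ip M y y)"
  proof (rule tendsto_lowerbound)
    show "((\<lambda>s. s * norm (ip M y y)) \<longlongrightarrow> norm (ip M x x) * norm (ip M y y)) (at_right (norm (ip M x x)))"
      by (intro tendsto_intros)
    show "\<forall>\<^sub>F s in at_right (norm (ip M x x)). (norm a)\<^sup>2 \<le> s * norm (ip M y y)"
      unfolding eventually_at_right_field
      by (rule exI[of _ "norm (ip M x x) + 1"]) (auto intro!: bound intro: le_less_trans[OF norm_ge_zero])
  qed simp
  then have "(norm a)\<^sup>2 \<le> (mnorm M x * mnorm M y)\<^sup>2"
    by (simp add: power_mult_distrib mnorm_square)
  then show ?thesis
    unfolding a_def by (rule power2_le_imp_le) simp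
qed

lemma mnorm_add:
  assumes x: "x \<in> carrier M" and y: "y \<in> carrier M"
  shows "mnorm M (madd M x y) \<le> mnorm M x + mnorm M y"
proof -
  have "ip M (madd M x y) (madd M x y) = ip M x x + ip M x y + ip M y x + ip M y y"
    by (simp add: ip_add ip_add_left closed x y)
  then have "norm (ip M (madd M x y) (madd M x y))
      \<le> norm (ip M x x) + norm (ip M x y) + norm (ip M y x) + norm (ip M y y)"
    by (simp) (intro norm_triangle_le add_right_mono order_refl)
  also have "\<dots> \<le> norm (ip M x x) + mnorm M x * mnorm M y + mnorm M y * mnorm M x + norm (ip M y y)"
    by (intro add_mono order_refl ip_Cauchy_Schwarz x y)
  also have "\<dots> = (mnorm M x + mnorm M y)\<^sup>2"
    by (simp add: power2_sum mnorm_square mult.commute)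
  finally show ?thesis
    unfolding mnorm_square[symmetric] by (rule power2_le_imp_le) simp
qed

lemma mnorm_scale: "x \<in> carrier M \<Longrightarrow> mnorm M (mscale M c x) = cmod c * mnorm M x"
  by (simp add: mnorm_def ip_scale ip_scale_left closed norm_scaleC real_sqrt_mult)

lemma mnorm_ract:
  assumes "x \<in> carrier M"
  shows "mnorm M (ract M x a) \<le> norm a * mnorm M x"
proof -
  have "norm (ip M (ract M x a) (ract M x a)) = norm (star a * ip M x x * a)"
    by (simp add: ip_ract ip_ract_left closed assms mult.assoc)
  also have "\<dots> \<le> norm (star a) * norm (ip M x x) * norm a"
    by (meson mult_right_mono norm_ge_zero norm_mult_ineq order_trans)
  also have "\<dots> = (norm a * mnorm M x)\<^sup>2"
    by (simp add: power_mult_distrib mnorm_square) (simp add: power2_eq_square)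
  finally show ?thesis
    unfolding mnorm_square[symmetric] by (rule power2_le_imp_le) simp
qed

lemma mdist_scale: "\<lbrakk>x \<in> carrier M; y \<in> carrier M\<rbrakk>
    \<Longrightarrow> mdist M (mscale M c x) (mscale M c y) = cmod c * mdist M x y"
proof -
  assume xy: "x \<in> carrier M" "y \<in> carrier M"
  have "msub M (mscale M c x) (mscale M c y) = mscale M c (msub M x y)"
    by (simp add: msub_def scale_scale scale_add closed xy)
  then show ?thesis by (simp add: mdist_msub mnorm_scale msub_closed xy)
qed

lemma mdist_ract: "\<lbrakk>x \<in> carrier M; y \<in> carrier M\<rbrakk>
    \<Longrightarrow> mdist M (ract M x a) (ract M y a) \<le> norm a * mdist M x y"
proof -
  assume xy: "x \<in> carrier M" "y \<in> carrier M"
  have "msub M (ract M x a) (ract M y a) = ract M (msub M x y) a"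
    by (simp add: msub_def ract_add_left ract_scale_left closed xy)
  then show ?thesis by (simp add: mdist_msub mnorm_ract msub_closed xy)
qed

lemma mdist_lact: "\<lbrakk>x \<in> carrier M; y \<in> carrier M\<rbrakk>
    \<Longrightarrow> mdist M (lact M a x) (lact M a y) \<le> norm a * mdist M x y"
proof -
  assume xy: "x \<in> carrier M" "y \<in> carrier M"
  have "msub M (lact M a x) (lact M a y) = lact M a (msub M x y)"
    by (simp add: msub_def lact_add_right lact_scale_right closed xy)
  then show ?thesis by (simp add: mdist_msub mnorm_lact msub_closed xy)
qed

lemma mdist_self: "x \<in> carrier M \<Longrightarrow> mdist M x x = 0"
  by (simp add: mdist_msub msub_self mnorm_def ip_zero closed)

lemma mdist_commute:
  assumes xy: "x \<in> carrier M" "y \<in> carrier M"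
  shows "mdist M x y = mdist M y x"
proof -
  have "msub M x y = mscale M (- 1) (msub M y x)"
    by (simp add: msub_def scale_add scale_scale scale_one closed xy add_commute)
  then show ?thesis by (simp add: mdist_msub mnorm_scale msub_closed xy)
qed

lemma mdist_triangle:
  assumes xyz: "x \<in> carrier M" "y \<in> carrier M" "z \<in> carrier M"
  shows "mdist M x z \<le> mdist M x y + mdist M y z"
proof -
  have "msub M x z = madd M (msub M x y) (msub M y z)"
    using msub_add_cancel[OF xyz(1,2)] xyz
    by (simp add: msub_def closed flip: add_assoc)
  then show ?thesis by (simp add: mdist_msub mnorm_add msub_closed xyz)
qed

lemma mdist_add:
  assumes xy: "x \<in> carrier M" "y \<in> carrier M" "x' \<in> carrier M" "y' \<in> carrier M"
  shows "mdist M (madd M x y) (madd M x' y') \<le> mdist M x x' + mdist M y y'"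
proof -
  have "msub M (madd M x y) (madd M x' y') = madd M (msub M x x') (msub M y y')"
    by (simp add: msub_def scale_add closed xy add_ac)
  then show ?thesis by (simp add: mdist_msub mnorm_add msub_closed xy)
qed

lemma ip_diff_le:
  assumes xy: "x \<in> carrier M" "y \<in> carrier M" "x' \<in> carrier M" "y' \<in> carrier M"
  shows "norm (ip M x y - ip M x' y') \<le> mdist M x x' * mnorm M y + mnorm M x' * mdist M y y'"
proof -
  have "ip M x y - ip M x' y' = ip M (msub M x x') y + ip M x' (msub M y y')"
    by (simp add: ip_msub ip_msub_left xy)
  then show ?thesis
    unfolding mdist_msub
    by (auto intro!: norm_triangle_le add_mono ip_Cauchy_Schwarz msub_closed xy)
qed

lemma mnorm_le_add_mdist:
  assumes xy: "x \<in> carrier M" "y \<in> carrier M"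
  shows "mnorm M x \<le> mnorm M y + mdist M x y"
  using mnorm_add[OF msub_closed[OF xy] xy(2)] by (simp add: msub_add_cancel xy mdist_msub)

end

section \<open>Completions\<close>

text \<open>
  The estimates below hold in semi-inner product bimodules, and they are inherited by a structure
  that is mapped isometrically into one, such as the formal tensor product.
\<close>

locale metric_bimodule =
  fixes M :: "('a::cstar_algebra, 'm) bimodule"
  assumes zero_closed: "mzero M \<in> carrier M"
    and add_closed: "\<lbrakk>x \<in> carrier M; y \<in> carrier M\<rbrakk> \<Longrightarrow> madd M x y \<in> carrier M"
    and scale_closed: "x \<in> carrier M \<Longrightarrow> mscale M c x \<in> carrier M"
    and ract_closed: "x \<in> carrier M \<Longrightarrow> ract M x a \<in> carrier M"
    and lact_closed: "x \<in> carrier M \<Longrightarrow> lact M a x \<in> carrier M"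
    and mdist_self: "x \<in> carrier M \<Longrightarrow> mdist M x x = 0"
    and mdist_commute: "\<lbrakk>x \<in> carrier M; y \<in> carrier M\<rbrakk> \<Longrightarrow> mdist M x y = mdist M y x"
    and mdist_triangle: "\<lbrakk>x \<in> carrier M; y \<in> carrier M; z \<in> carrier M\<rbrakk>
      \<Longrightarrow> mdist M x z \<le> mdist M x y + mdist M y z"
    and mdist_add: "\<lbrakk>x \<in> carrier M; y \<in> carrier M; x' \<in> carrier M; y' \<in> carrier M\<rbrakk>
      \<Longrightarrow> mdist M (madd M x y) (madd M x' y') \<le> mdist M x x' + mdist M y y'"
    and mdist_scale: "\<lbrakk>x \<in> carrier M; y \<in> carrier M\<rbrakk>
      \<Longrightarrow> mdist M (mscale M c x) (mscale M c y) = cmod c * mdist M x y"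
    and mdist_ract: "\<lbrakk>x \<in> carrier M; y \<in> carrier M\<rbrakk>
      \<Longrightarrow> mdist M (ract M x a) (ract M y a) \<le> norm a * mdist M x y"
    and mdist_lact: "\<lbrakk>x \<in> carrier M; y \<in> carrier M\<rbrakk>
      \<Longrightarrow> mdist M (lact M a x) (lact M a y) \<le> norm a * mdist M x y"
    and ip_diff_le: "\<lbrakk>x \<in> carrier M; y \<in> carrier M; x' \<in> carrier M; y' \<in> carrier M\<rbrakk>
      \<Longrightarrow> norm (ip M x y - ip M x' y') \<le> mdist M x x' * mnorm M y + mnorm M x' * mdist M y y'"
    and mnorm_le_add_mdist: "\<lbrakk>x \<in> carrier M; y \<in> carrier M\<rbrakk> \<Longrightarrow> mnorm M x \<le> mnorm M y + mdist M x y"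

sublocale pre_bimodule \<subseteq> metric_bimodule
  by unfold_locales (simp_all add: closed mdist_self mdist_commute mdist_add mdist_scale mdist_ract
      mdist_lact ip_diff_le mnorm_le_add_mdist mdist_triangle)

abbreviation cls :: "('a::cstar_algebra, 'm) bimodule \<Rightarrow> (nat \<Rightarrow> 'm) \<Rightarrow> (nat \<Rightarrow> 'm) set"
  where "cls M f \<equiv> null_rel M `` {f}"

lemma cauchy_seqsD: "f \<in> cauchy_seqs M \<Longrightarrow> f n \<in> carrier M"
  by (auto simp: cauchy_seqs_def)

lemma cauchy_seqs_dist:
  "\<lbrakk>f \<in> cauchy_seqs M; 0 < e\<rbrakk> \<Longrightarrow> \<exists>N. \<forall>m\<ge>N. \<forall>n\<ge>N. mdist M (f m) (f n) < e"
  by (auto simp: cauchy_seqs_def)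

lemma tendsto_zero_sandwich:
  assumes "g \<longlonglongrightarrow> 0" "\<And>n. (0::real) \<le> f n" "\<And>n. f n \<le> g n"
  shows "f \<longlonglongrightarrow> 0"
  by (rule tendsto_sandwich[OF _ _ tendsto_const assms(1)]) (use assms in auto)

text \<open>A Lipschitz bound in two source sequences serves all operations: sums with
  \<open>K = K' = 1\<close>, unary maps with a constant second sequence and \<open>K' = 0\<close>,
  and products of sequences from different modules with \<open>K\<close> and \<open>K'\<close>
  bounding their lengths.\<close>

lemma cauchy_seqsI:
  assumes h: "\<And>n. h n \<in> carrier M" and f: "f \<in> cauchy_seqs M1" and g: "g \<in> cauchy_seqs M2"
    and K: "0 \<le> K" "0 \<le> K'"
    and le: "\<And>m n. mdist M (h m) (h n) \<le> K * mdist M1 (f m) (f n) + K' * mdist M2 (g m) (g n)"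
  shows "h \<in> cauchy_seqs M"
  unfolding cauchy_seqs_def
proof (intro CollectI conjI allI impI)
  show "range h \<subseteq> carrier M" using h by blast
  fix e :: real assume "e > 0"
  define d where "d = e / (K + K' + 1)"
  have "d > 0" using \<open>e > 0\<close> K by (simp add: d_def)
  obtain N1 N2 where
    N: "\<forall>m\<ge>N1. \<forall>n\<ge>N1. mdist M1 (f m) (f n) < d" "\<forall>m\<ge>N2. \<forall>n\<ge>N2. mdist M2 (g m) (g n) < d"
    using cauchy_seqs_dist[OF f \<open>d > 0\<close>] cauchy_seqs_dist[OF g \<open>d > 0\<close>] by meson
  have "mdist M (h m) (h n) < e" if mn: "m \<ge> max N1 N2" "n \<ge> max N1 N2" for m n
  proof -
    have "mdist M (h m) (h n) \<le> K * mdist M1 (f m) (f n) + K' * mdist M2 (g m) (g n)" by (rule le)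
    also have "\<dots> \<le> K * d + K' * d"
      using N mn K by (intro add_mono mult_left_mono) (auto intro: less_imp_le)
    also have "\<dots> < (K + K' + 1) * d" using \<open>d > 0\<close> by (simp add: algebra_simps)
    also have "\<dots> = e" using K by (simp add: d_def)
    finally show ?thesis .
  qed
  then show "\<exists>N. \<forall>m\<ge>N. \<forall>n\<ge>N. mdist M (h m) (h n) < e" by blast
qed

context metric_bimodule
begin

lemmas mclosed = zero_closed add_closed scale_closed ract_closed lact_closed

abbreviation "C \<equiv> cauchy_seqs M"

lemma const_cauchy: "x \<in> carrier M \<Longrightarrow> (\<lambda>n. x) \<in> C"
  by (auto simp: cauchy_seqs_def mdist_self)

lemma add_cauchy: "\<lbrakk>f \<in> C; g \<in> C\<rbrakk> \<Longrightarrow> (\<lambda>n. madd M (f n) (g n)) \<in> C"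
  by (rule cauchy_seqsI[of _ M f M g M 1 1]) (simp_all add: cauchy_seqsD mclosed mdist_add)

lemma scale_cauchy: "f \<in> C \<Longrightarrow> (\<lambda>n. mscale M c (f n)) \<in> C"
  by (rule cauchy_seqsI[of _ M f M "\<lambda>_. mzero M" M "cmod c" 0])
    (simp_all add: cauchy_seqsD mclosed const_cauchy mdist_scale)

lemma ract_cauchy: "f \<in> C \<Longrightarrow> (\<lambda>n. ract M (f n) a) \<in> C"
  by (rule cauchy_seqsI[of _ M f M "\<lambda>_. mzero M" M "norm a" 0])
    (simp_all add: cauchy_seqsD mclosed const_cauchy mdist_ract add_increasing2)

lemma lact_cauchy: "f \<in> C \<Longrightarrow> (\<lambda>n. lact M a (f n)) \<in> C"
  by (rule cauchy_seqsI[of _ M f M "\<lambda>_. mzero M" M "norm a" 0])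
    (simp_all add: cauchy_seqsD mclosed const_cauchy mdist_lact add_increasing2)

lemma sub_cauchy: "\<lbrakk>f \<in> C; g \<in> C\<rbrakk> \<Longrightarrow> (\<lambda>n. msub M (f n) (g n)) \<in> C"
  unfolding msub_def by (intro add_cauchy scale_cauchy)

lemma equiv_null_rel: "equiv C (null_rel M)"
proof (rule equivI)
  show "null_rel M \<subseteq> C \<times> C" by (auto simp: null_rel_def)
  show "refl_on C (null_rel M)"
    by (auto simp: refl_on_def null_rel_def mdist_self cauchy_seqsD)
  show "sym (null_rel M)"
    by (auto simp: sym_def null_rel_def mdist_commute[OF cauchy_seqsD cauchy_seqsD])
  show "trans (null_rel M)"
  proof (rule transI)
    fix f g h assume fg: "(f, g) \<in> null_rel M" and gh: "(g, h) \<in> null_rel M"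
    then have "(\<lambda>n. mdist M (f n) (g n) + mdist M (g n) (h n)) \<longlonglongrightarrow> 0"
      by (intro tendsto_add_zero) (simp_all add: null_rel_def)
    then have "(\<lambda>n. mdist M (f n) (h n)) \<longlonglongrightarrow> 0"
      by (rule tendsto_zero_sandwich)
        (use fg gh in \<open>simp_all add: null_rel_def mdist_triangle cauchy_seqsD\<close>)
    then show "(f, h) \<in> null_rel M" using fg gh by (auto simp: null_rel_def)
  qed
qed

lemma cls_eq_iff: "\<lbrakk>f \<in> C; g \<in> C\<rbrakk> \<Longrightarrow> cls M f = cls M g \<longleftrightarrow> (\<lambda>n. mdist M (f n) (g n)) \<longlonglongrightarrow> 0"
  using eq_equiv_class_iff[OF equiv_null_rel, of f g] by (auto simp: null_rel_def)

lemma in_cls_iff: "f \<in> C \<Longrightarrow> (f, g) \<in> null_rel M \<longleftrightarrow> g \<in> C \<and> cls M g = cls M f"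
  using cls_eq_iff[of g f] by (auto simp: null_rel_def mdist_commute cauchy_seqsD)

lemma cls_cauchy: "f' \<in> cls M f \<Longrightarrow> f' \<in> C"
  by (auto simp: null_rel_def)

lemma self_in_cls: "f \<in> C \<Longrightarrow> f \<in> cls M f"
  by (simp add: in_cls_iff)

lemma carrier_completion: "carrier (completion M) = cls M ` C"
  by (auto simp: completion_def quotient_def)

lemma cls_eqI:
  assumes "f \<in> C" "g \<in> C" "h \<longlonglongrightarrow> 0" "\<And>n. mdist M (f n) (g n) \<le> h n"
  shows "cls M f = cls M g"
  unfolding cls_eq_iff[OF assms(1,2)]
  by (rule tendsto_zero_sandwich[OF assms(3) _ assms(4)]) simp

lemma null_distD: "\<lbrakk>f \<in> C; f' \<in> cls M f\<rbrakk> \<Longrightarrow> (\<lambda>n. mdist M (f' n) (f n)) \<longlonglongrightarrow> 0"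
  using cls_eq_iff[of f' f] by (simp add: in_cls_iff)

text \<open>The union over all representatives collapses, since any choice of them gives the same
  class. The other operations follow the same pattern.\<close>

lemma madd_completion:
  assumes "f \<in> C" "g \<in> C"
  shows "madd (completion M) (cls M f) (cls M g) = cls M (\<lambda>n. madd M (f n) (g n))"
proof -
  have "cls M (\<lambda>n. madd M (f' n) (g' n)) = cls M (\<lambda>n. madd M (f n) (g n))"
    if "f' \<in> cls M f" "g' \<in> cls M g" for f' g'
  proof (rule cls_eqI)
    show "(\<lambda>n. mdist M (f' n) (f n) + mdist M (g' n) (g n)) \<longlonglongrightarrow> 0"
      using tendsto_add[OF null_distD[OF assms(1) that(1)] null_distD[OF assms(2) that(2)]] by simp
  qed (use assms that[THEN cls_cauchy] in \<open>simp_all add: cauchy_seqsD add_cauchy mdist_add\<close>)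
  note eq = this
  show ?thesis
    using self_in_cls[OF assms(1)] self_in_cls[OF assms(2)]
    unfolding completion_def bimodule.simps by (intro SUP_eq_const eq) blast+
qed

lemma mscale_completion:
  assumes "f \<in> C"
  shows "mscale (completion M) c (cls M f) = cls M (\<lambda>n. mscale M c (f n))"
proof -
  have "cls M (\<lambda>n. mscale M c (f' n)) = cls M (\<lambda>n. mscale M c (f n))" if "f' \<in> cls M f" for f'
  proof (rule cls_eqI)
    show "(\<lambda>n. cmod c * mdist M (f' n) (f n)) \<longlonglongrightarrow> 0"
      using tendsto_mult_left[OF null_distD[OF assms that], of "cmod c"] by simp
  qed (use assms that[THEN cls_cauchy] in \<open>simp_all add: cauchy_seqsD scale_cauchy mdist_scale\<close>)
  note eq = this
  show ?thesis
    using self_in_cls[OF assms]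
    unfolding completion_def bimodule.simps by (intro SUP_eq_const eq) blast+
qed

lemma ract_completion:
  assumes "f \<in> C"
  shows "ract (completion M) (cls M f) a = cls M (\<lambda>n. ract M (f n) a)"
proof -
  have "cls M (\<lambda>n. ract M (f' n) a) = cls M (\<lambda>n. ract M (f n) a)" if "f' \<in> cls M f" for f'
  proof (rule cls_eqI)
    show "(\<lambda>n. norm a * mdist M (f' n) (f n)) \<longlonglongrightarrow> 0"
      using tendsto_mult_left[OF null_distD[OF assms that], of "norm a"] by simp
  qed (use assms that[THEN cls_cauchy] in \<open>simp_all add: cauchy_seqsD ract_cauchy mdist_ract\<close>)
  note eq = this
  show ?thesis
    using self_in_cls[OF assms]
    unfolding completion_def bimodule.simps by (intro SUP_eq_const eq) blast+
qed

lemma lact_completion: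
  assumes "f \<in> C"
  shows "lact (completion M) a (cls M f) = cls M (\<lambda>n. lact M a (f n))"
proof -
  have "cls M (\<lambda>n. lact M a (f' n)) = cls M (\<lambda>n. lact M a (f n))" if "f' \<in> cls M f" for f'
  proof (rule cls_eqI)
    show "(\<lambda>n. norm a * mdist M (f' n) (f n)) \<longlonglongrightarrow> 0"
      using tendsto_mult_left[OF null_distD[OF assms that], of "norm a"] by simp
  qed (use assms that[THEN cls_cauchy] in \<open>simp_all add: cauchy_seqsD lact_cauchy mdist_lact\<close>)
  note eq = this
  show ?thesis
    using self_in_cls[OF assms]
    unfolding completion_def bimodule.simps by (intro SUP_eq_const eq) blast+
qed

lemma mzero_completion: "mzero (completion M) = cls M (\<lambda>n. mzero M)"
  by (simp add: completion_def)

lemma mnorm_bounded: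
  assumes "f \<in> C"
  obtains K where "0 \<le> K" "\<And>n. mnorm M (f n) \<le> K"
proof -
  obtain N where N: "\<forall>m\<ge>N. \<forall>n\<ge>N. mdist M (f m) (f n) < 1"
    using cauchy_seqs_dist[OF assms zero_less_one] by blast
  define K where "K = Max ((\<lambda>n. mnorm M (f n)) ` {..N}) + 1"
  have K: "mnorm M (f n) + 1 \<le> K" if "n \<le> N" for n
    unfolding K_def using that by (intro add_right_mono Max_ge) auto
  have "mnorm M (f n) \<le> K" for n
  proof (cases "n \<le> N")
    case True
    with K show ?thesis by force
  next
    case False
    then have "mdist M (f n) (f N) < 1" using N by simp
    moreover have "mnorm M (f n) \<le> mnorm M (f N) + mdist M (f n) (f N)"
      using assms by (intro mnorm_le_add_mdist cauchy_seqsD)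
    ultimately show ?thesis using K[of N] by simp
  qed
  moreover have "0 \<le> K" using K[of 0] mnorm_nonneg[of M "f 0"] by linarith
  ultimately show ?thesis using that by blast
qed

lemma ip_convergent:
  assumes f: "f \<in> C" and g: "g \<in> C"
  shows "convergent (\<lambda>n. ip M (f n) (g n))"
proof -
  obtain K where K: "0 \<le> K" "\<And>n. mnorm M (f n) \<le> K" using mnorm_bounded[OF f] by blast
  obtain K' where K': "0 \<le> K'" "\<And>n. mnorm M (g n) \<le> K'" using mnorm_bounded[OF g] by blast
  have "Cauchy (\<lambda>n. ip M (f n) (g n))"
  proof (rule metric_CauchyI)
    fix e :: real assume "e > 0"
    then have "e / (K + K' + 1) > 0" using K K' by simp
    then obtain N1 N2 where
      N: "\<forall>m\<ge>N1. \<forall>n\<ge>N1. mdist M (f m) (f n) < e / (K + K' + 1)"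
        "\<forall>m\<ge>N2. \<forall>n\<ge>N2. mdist M (g m) (g n) < e / (K + K' + 1)"
      using cauchy_seqs_dist[OF f] cauchy_seqs_dist[OF g] by meson
    have "dist (ip M (f m) (g m)) (ip M (f n) (g n)) < e" if "m \<ge> max N1 N2" "n \<ge> max N1 N2" for m n
    proof -
      have "dist (ip M (f m) (g m)) (ip M (f n) (g n))
        \<le> mdist M (f m) (f n) * mnorm M (g m) + mnorm M (f n) * mdist M (g m) (g n)"
        unfolding dist_norm using f g by (intro ip_diff_le cauchy_seqsD)
      also have "\<dots> \<le> (e / (K + K' + 1)) * K' + K * (e / (K + K' + 1))"
        using N that \<open>e > 0\<close> K K' by (intro add_mono mult_mono) (auto intro: less_imp_le)
      also have "\<dots> = (K + K') * (e / (K + K' + 1))"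
        by (simp only: distrib_right mult.commute add.commute)
      also have "\<dots> < (K + K' + 1) * (e / (K + K' + 1))"
        using \<open>e / (K + K' + 1) > 0\<close> by (intro mult_strict_right_mono) simp_all
      also have "\<dots> = e" using K K' by simp
      finally show ?thesis .
    qed
    then show "\<exists>N. \<forall>m\<ge>N. \<forall>n\<ge>N. dist (ip M (f m) (g m)) (ip M (f n) (g n)) < e" by blast
  qed
  then show ?thesis by (simp add: Cauchy_convergent_iff)
qed

text \<open>The limit does not depend on the representatives, so the definite description in
  \<open>completion\<close> denotes it.\<close>

lemma ip_completion:
  assumes f: "f \<in> C" and g: "g \<in> C"
  shows "(\<lambda>n. ip M (f n) (g n)) \<longlonglongrightarrow> ip (completion M) (cls M f) (cls M g)"
proof -
  obtain c where c: "(\<lambda>n. ip M (f n) (g n)) \<longlonglongrightarrow> c"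
    using ip_convergent[OF f g] convergent_def by blast
  have lim: "(\<lambda>n. ip M (f' n) (g' n)) \<longlonglongrightarrow> c" if "f' \<in> cls M f" "g' \<in> cls M g" for f' g'
  proof -
    have f': "f' \<in> C" and g': "g' \<in> C" using that[THEN cls_cauchy] .
    obtain K where K: "0 \<le> K" "\<And>n. mnorm M (f n) \<le> K" using mnorm_bounded[OF f] by blast
    obtain K' where K': "0 \<le> K'" "\<And>n. mnorm M (g' n) \<le> K'" using mnorm_bounded[OF g'] by blast
    have "(\<lambda>n. mdist M (f' n) (f n) * K' + K * mdist M (g' n) (g n)) \<longlonglongrightarrow> 0 * K' + K * 0"
      using null_distD[OF f that(1)] null_distD[OF g that(2)] by (intro tendsto_intros)
    then have "(\<lambda>n. mdist M (f' n) (f n) * K' + K * mdist M (g' n) (g n)) \<longlonglongrightarrow> 0"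
      by simp
    then have "(\<lambda>n. norm (ip M (f' n) (g' n) - ip M (f n) (g n))) \<longlonglongrightarrow> 0"
    proof (rule tendsto_zero_sandwich)
      fix n
      have "norm (ip M (f' n) (g' n) - ip M (f n) (g n))
        \<le> mdist M (f' n) (f n) * mnorm M (g' n) + mnorm M (f n) * mdist M (g' n) (g n)"
        using f g f' g' by (intro ip_diff_le cauchy_seqsD)
      also have "\<dots> \<le> mdist M (f' n) (f n) * K' + K * mdist M (g' n) (g n)"
        using K K' by (intro add_mono mult_mono) auto
      finally show "norm (ip M (f' n) (g' n) - ip M (f n) (g n))
        \<le> mdist M (f' n) (f n) * K' + K * mdist M (g' n) (g n)" .
    qed auto
    then have "(\<lambda>n. ip M (f' n) (g' n) - ip M (f n) (g n)) \<longlonglongrightarrow> 0"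
      by (rule tendsto_norm_zero_cancel)
    from tendsto_add[OF this c] show ?thesis by simp
  qed
  have "ip (completion M) (cls M f) (cls M g) = c"
    unfolding completion_def bimodule.simps
  proof (rule the_equality)
    show "\<forall>f'\<in>cls M f. \<forall>g'\<in>cls M g. (\<lambda>n. ip M (f' n) (g' n)) \<longlonglongrightarrow> c" using lim by blast
  qed (use LIMSEQ_unique[OF c] self_in_cls f g in blast)
  with c show ?thesis by simp
qed

lemma ip_completion_eqI:
  "\<lbrakk>f \<in> C; g \<in> C; (\<lambda>n. ip M (f n) (g n)) \<longlonglongrightarrow> c\<rbrakk> \<Longrightarrow> ip (completion M) (cls M f) (cls M g) = c"
  using LIMSEQ_unique[OF ip_completion] by blast

lemma mnorm_completion: "f \<in> C \<Longrightarrow> (\<lambda>n. mnorm M (f n)) \<longlonglongrightarrow> mnorm (completion M) (cls M f)"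
  unfolding mnorm_def by (intro tendsto_intros ip_completion)

lemma msub_completion: "\<lbrakk>f \<in> C; g \<in> C\<rbrakk>
    \<Longrightarrow> msub (completion M) (cls M f) (cls M g) = cls M (\<lambda>n. msub M (f n) (g n))"
  by (simp add: msub_def mscale_completion madd_completion scale_cauchy)

lemma mdist_completion: "\<lbrakk>f \<in> C; g \<in> C\<rbrakk>
    \<Longrightarrow> (\<lambda>n. mdist M (f n) (g n)) \<longlonglongrightarrow> mdist (completion M) (cls M f) (cls M g)"
  unfolding mdist_msub by (simp add: msub_completion mnorm_completion sub_cauchy)

lemmas completion_simps = madd_completion mscale_completion ract_completion lact_completion
  mzero_completion add_cauchy scale_cauchy ract_cauchy lact_cauchy const_cauchy zero_closed

lemma completion_carrierE:
  assumes "X \<in> carrier (completion M)"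
  obtains f where "f \<in> C" "X = cls M f"
  using assms by (auto simp: carrier_completion)

end

text \<open>Completeness is phrased through \<open>cauchy_seqs\<close>, which involves only points
  of the carrier. The passage to \<open>Metric_space.mcomplete\<close> is made in
  \<open>hilbert_bimodule\<close>, where symmetry of \<open>mdist\<close> on the whole type is at
  hand.\<close>

locale complete_bimodule = pre_bimodule +
  assumes ip_definite: "\<lbrakk>x \<in> carrier M; ip M x x = 0\<rbrakk> \<Longrightarrow> x = mzero M"
    and seq_complete: "\<sigma> \<in> cauchy_seqs M \<Longrightarrow> \<exists>x\<in>carrier M. (\<lambda>n. mdist M (\<sigma> n) x) \<longlonglongrightarrow> 0"
begin

lemma mdist_eq_0: "\<lbrakk>x \<in> carrier M; y \<in> carrier M; mdist M x y = 0\<rbrakk> \<Longrightarrow> x = y"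
proof -
  assume xy: "x \<in> carrier M" "y \<in> carrier M" and "mdist M x y = 0"
  then have "msub M x y = mzero M"
    by (intro ip_definite msub_closed) (simp_all add: mdist_msub mnorm_def)
  then have "x = madd M (mzero M) y" using msub_add_cancel[OF xy] by simp
  also have "\<dots> = madd M y (mzero M)" by (intro add_commute closed xy)
  also have "\<dots> = y" by (simp add: add_zero xy)
  finally show "x = y" .
qed

lemma limit_unique:
  assumes "x \<in> carrier M" "y \<in> carrier M" "\<And>n. f n \<in> carrier M"
    and fx: "(\<lambda>n. mdist M (f n) x) \<longlonglongrightarrow> 0" and fy: "(\<lambda>n. mdist M (f n) y) \<longlonglongrightarrow> 0"
  shows "x = y"
proof (rule mdist_eq_0)
  have le: "mdist M x y \<le> mdist M (f n) x + mdist M (f n) y" for n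
    using mdist_triangle[of x "f n" y] mdist_commute[of "f n" x] assms by simp
  have "mdist M x y \<le> 0"
    by (rule LIMSEQ_le_const[OF tendsto_add_zero[OF fx fy]]) (use le in blast)
  then show "mdist M x y = 0" using mdist_nonneg[of M x y] by linarith
qed (use assms in auto)

lemma Metric_space_mdist:
  assumes "\<And>x y. mdist M x y = mdist M y x"
  shows "Metric_space (carrier M) (mdist M)"
  using assms by unfold_locales (auto simp: mdist_self mdist_triangle intro: mdist_eq_0)

lemma hilbert_bimodule:
  assumes "\<And>x y. mdist M x y = mdist M y x"
  shows "hilbert_bimodule M"
proof -
  interpret S: Metric_space "carrier M" "mdist M"
    using assms by (rule Metric_space_mdist)
  have "S.mcomplete"
    unfolding S.mcomplete_def
  proof (intro allI impI)
    fix \<sigma> assume "S.MCauchy \<sigma>"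
    then have \<sigma>: "\<sigma> \<in> cauchy_seqs M" by (fastforce simp: S.MCauchy_def cauchy_seqs_def)
    then obtain x where x: "x \<in> carrier M" "(\<lambda>n. mdist M (\<sigma> n) x) \<longlonglongrightarrow> 0" using seq_complete by blast
    then have "limitin S.mtopology \<sigma> x sequentially"
      using cauchy_seqsD[OF \<sigma>] by (simp add: S.limit_metric_sequentially LIMSEQ_iff)
    then show "\<exists>x. limitin S.mtopology \<sigma> x sequentially" ..
  qed
  moreover have "\<exists>y\<in>carrier M. madd M x y = mzero M" if "x \<in> carrier M" for x
    using msub_self[OF that] scale_closed[OF that] by (auto simp: msub_def)
  ultimately show ?thesis
    by unfold_locales (use ip_definite in \<open>simp_all add: closed add_ac add_zero scale_add add_scale
      scale_scale scale_one ract_add_left ract_add_right ract_mult ract_scale_left ract_scale_right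
      ip_add ip_scale ip_ract ip_star ip_positive lact_adjoint lact_add_left lact_scale_left lact_mult\<close>)
qed

end

context pre_bimodule
begin

lemma msub_zero: "x \<in> carrier M \<Longrightarrow> msub M x (mzero M) = x"
proof -
  assume x: "x \<in> carrier M"
  have "mscale M (- 1) (mzero M) = mzero M"
    using scale_scale[OF x, of "- 1" 0] by (simp add: scale_zero x)
  then show ?thesis by (simp add: msub_def add_zero x)
qed

lemma pre_bimodule_completion: "pre_bimodule (completion M)"
proof
  show "mzero (completion M) \<in> carrier (completion M)"
    by (simp add: completion_simps carrier_completion)
next
  fix X Y a b and c d :: complex
  assume "X \<in> carrier (completion M)"
  then obtain f where f: "f \<in> C" "X = cls M f" by (rule completion_carrierE)
  note fD = cauchy_seqsD[OF f(1)]
  show "mscale (completion M) c X \<in> carrier (completion M)"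
    "ract (completion M) X a \<in> carrier (completion M)"
    "lact (completion M) a X \<in> carrier (completion M)"
    by (auto simp: f completion_simps carrier_completion)
  show "madd (completion M) X (mzero (completion M)) = X"
    "mscale (completion M) (c + d) X = madd (completion M) (mscale (completion M) c X) (mscale (completion M) d X)"
    "mscale (completion M) c (mscale (completion M) d X) = mscale (completion M) (c * d) X"
    "mscale (completion M) 1 X = X"
    "mscale (completion M) 0 X = mzero (completion M)"
    "ract (completion M) X (a + b) = madd (completion M) (ract (completion M) X a) (ract (completion M) X b)"
    "ract (completion M) X (a * b) = ract (completion M) (ract (completion M) X a) b"
    "ract (completion M) (mscale (completion M) c X) a = mscale (completion M) c (ract (completion M) X a)"
    "ract (completion M) X (c *\<^sub>C a) = mscale (completion M) c (ract (completion M) X a)"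
    "lact (completion M) (a + b) X = madd (completion M) (lact (completion M) a X) (lact (completion M) b X)"
    "lact (completion M) (a * b) X = lact (completion M) a (lact (completion M) b X)"
    "lact (completion M) (c *\<^sub>C a) X = mscale (completion M) c (lact (completion M) a X)"
    "lact (completion M) a (mscale (completion M) c X) = mscale (completion M) c (lact (completion M) a X)"
    by (simp_all add: f completion_simps fD add_zero add_scale scale_scale scale_one scale_zero
        ract_add_right ract_mult ract_scale_left ract_scale_right lact_add_left lact_mult
        lact_scale_left lact_scale_right)
  show "cpositive (ip (completion M) X X)"
    using cpositive_limit[OF ip_positive[OF fD] ip_completion[OF f(1) f(1)]] by (simp add: f)
  show "mnorm (completion M) (lact (completion M) a X) \<le> norm a * mnorm (completion M) X"
    unfolding f lact_completion[OF f(1)]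
    by (rule LIMSEQ_le[OF mnorm_completion[OF lact_cauchy[OF f(1)]] tendsto_mult_left[OF mnorm_completion[OF f(1)]]])
      (use mnorm_lact fD in blast)
  assume "Y \<in> carrier (completion M)"
  then obtain g where g: "g \<in> C" "Y = cls M g" by (rule completion_carrierE)
  note gD = cauchy_seqsD[OF g(1)]
  show "madd (completion M) X Y \<in> carrier (completion M)"
    by (auto simp: f g completion_simps carrier_completion)
  show "madd (completion M) X Y = madd (completion M) Y X"
    using add_commute[OF fD gD] by (simp add: f g completion_simps)
  show "mscale (completion M) c (madd (completion M) X Y)
      = madd (completion M) (mscale (completion M) c X) (mscale (completion M) c Y)"
    "ract (completion M) (madd (completion M) X Y) a
      = madd (completion M) (ract (completion M) X a) (ract (completion M) Y a)"
    "lact (completion M) a (madd (completion M) X Y)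
      = madd (completion M) (lact (completion M) a X) (lact (completion M) a Y)"
    by (simp_all add: f g completion_simps fD gD scale_add ract_add_left lact_add_right)
  show "ip (completion M) X (mscale (completion M) c Y) = c *\<^sub>C ip (completion M) X Y"
    using tendsto_scaleC[OF ip_completion[OF f(1) g(1)], of c]
    by (simp add: f g completion_simps) (rule ip_completion_eqI, simp_all add: f g completion_simps ip_scale fD gD)
  show "ip (completion M) X (ract (completion M) Y a) = ip (completion M) X Y * a"
    using tendsto_mult_right[OF ip_completion[OF f(1) g(1)], of a]
    by (simp add: f g completion_simps) (rule ip_completion_eqI, simp_all add: f g completion_simps ip_ract fD gD)
  show "star (ip (completion M) X Y) = ip (completion M) Y X"
    using tendsto_star[OF ip_completion[OF f(1) g(1)]] f g
    by (simp add: ip_star fD gD ip_completion_eqI)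
  show "ip (completion M) (lact (completion M) a X) Y = ip (completion M) X (lact (completion M) (star a) Y)"
    using ip_completion[OF f(1) lact_cauchy[OF g(1)], of "star a"]
    by (simp add: f g completion_simps)
      (rule ip_completion_eqI, simp_all add: f g completion_simps lact_adjoint fD gD)
  fix Z assume "Z \<in> carrier (completion M)"
  then obtain h where h: "h \<in> C" "Z = cls M h" by (rule completion_carrierE)
  note hD = cauchy_seqsD[OF h(1)]
  show "madd (completion M) (madd (completion M) X Y) Z = madd (completion M) X (madd (completion M) Y Z)"
    by (simp add: f g h completion_simps fD gD hD add_assoc)
  show "ip (completion M) X (madd (completion M) Y Z) = ip (completion M) X Y + ip (completion M) X Z"
    using tendsto_add[OF ip_completion[OF f(1) g(1)] ip_completion[OF f(1) h(1)]]
    by (simp add: f g h completion_simps) (rule ip_completion_eqI, simp_all add: f g h completion_simps ip_add fD gD hD)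
qed

lemma dense_completion:
  assumes X: "X \<in> carrier (completion M)" and e: "e > 0"
  shows "\<exists>x\<in>carrier M. mdist (completion M) X (cls M (\<lambda>n. x)) \<le> e"
proof -
  obtain f where f: "f \<in> C" "X = cls M f" using X by (rule completion_carrierE)
  obtain N where N: "\<forall>m\<ge>N. \<forall>n\<ge>N. mdist M (f m) (f n) < e"
    using cauchy_seqs_dist[OF f(1) e] by blast
  have fN: "f N \<in> carrier M" using cauchy_seqsD[OF f(1)] .
  have "mdist (completion M) X (cls M (\<lambda>n. f N)) \<le> e"
    unfolding f
    by (rule LIMSEQ_le_const2[OF mdist_completion[OF f(1) const_cauchy[OF fN]]])
      (use N in \<open>auto intro!: exI[of _ N] less_imp_le\<close>)
  with fN show ?thesis by blast
qed

lemma mdist_cls_const: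
  "\<lbrakk>x \<in> carrier M; y \<in> carrier M\<rbrakk> \<Longrightarrow> mdist (completion M) (cls M (\<lambda>n. x)) (cls M (\<lambda>n. y)) = mdist M x y"
  using LIMSEQ_unique[OF mdist_completion[OF const_cauchy const_cauchy] tendsto_const] by blast

text \<open>Given a Cauchy sequence \<open>\<sigma>\<close> of classes, density yields
  \<open>x k\<close> in the original module within \<open>1 / (k + 1)\<close> of
  \<open>\<sigma> k\<close>. As constants embed isometrically, \<open>x\<close> is itself a Cauchy
  sequence, and its class is the limit of \<open>\<sigma>\<close>.\<close>

theorem complete_bimodule_completion: "complete_bimodule (completion M)"
proof -
  interpret P: pre_bimodule "completion M" by (rule pre_bimodule_completion)
  show ?thesis
  proof
    fix X assume X: "X \<in> carrier (completion M)" "ip (completion M) X X = 0"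
    obtain f where f: "f \<in> C" "X = cls M f" using X(1) by (rule completion_carrierE)
    have "(\<lambda>n. mdist M (f n) (mzero M)) \<longlonglongrightarrow> mnorm (completion M) X"
      unfolding f using mnorm_completion[OF f(1)] cauchy_seqsD[OF f(1)] by (simp add: mdist_msub msub_zero)
    then show "X = mzero (completion M)"
      using X(2) unfolding f mzero_completion
      by (subst cls_eq_iff) (simp_all add: f const_cauchy closed mnorm_def)
  next
    fix \<sigma> assume \<sigma>: "\<sigma> \<in> cauchy_seqs (completion M)"
    note \<sigma>D = cauchy_seqsD[OF \<sigma>]
    have "\<exists>x\<in>carrier M. mdist (completion M) (\<sigma> k) (cls M (\<lambda>n. x)) \<le> inverse (real (Suc k))" for k
      by (rule dense_completion[OF \<sigma>D]) simp
    then obtain x where x: "\<And>k. x k \<in> carrier M"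
      and \<sigma>x: "\<And>k. mdist (completion M) (\<sigma> k) (cls M (\<lambda>n. x k)) \<le> inverse (real (Suc k))" by metis
    define E where "E k = cls M (\<lambda>n. x k)" for k
    have E: "E k \<in> carrier (completion M)" for k
      by (auto simp: E_def carrier_completion const_cauchy x)
    have \<sigma>E: "mdist (completion M) (\<sigma> k) (E k) \<le> inverse (real (Suc k))" for k
      using \<sigma>x by (simp add: E_def)
    have small: "\<exists>N. \<forall>k\<ge>N. inverse (real (Suc k)) < e" if "e > 0" for e :: real
      using LIMSEQ_D[OF LIMSEQ_inverse_real_of_nat that] by simp
    have xC: "x \<in> C"
      unfolding cauchy_seqs_def
    proof (intro CollectI conjI allI impI)
      fix e :: real assume "e > 0"
      then have e3: "e / 3 > 0" by simp
      obtain N1 where N1: "\<forall>k\<ge>N1. inverse (real (Suc k)) < e / 3" using small[OF e3] by blast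
      obtain N2 where N2: "\<forall>m\<ge>N2. \<forall>n\<ge>N2. mdist (completion M) (\<sigma> m) (\<sigma> n) < e / 3"
        using cauchy_seqs_dist[OF \<sigma> e3] by blast
      have "mdist M (x m) (x n) < e" if mn: "m \<ge> max N1 N2" "n \<ge> max N1 N2" for m n
      proof -
        have "mdist M (x m) (x n) = mdist (completion M) (E m) (E n)"
          by (simp add: E_def mdist_cls_const x)
        also have "\<dots> \<le> mdist (completion M) (E m) (\<sigma> m) + mdist (completion M) (\<sigma> m) (E n)"
          by (intro P.mdist_triangle E \<sigma>D)
        also have "mdist (completion M) (\<sigma> m) (E n) \<le> mdist (completion M) (\<sigma> m) (\<sigma> n) + mdist (completion M) (\<sigma> n) (E n)"
          by (intro P.mdist_triangle E \<sigma>D)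
        also have "mdist (completion M) (E m) (\<sigma> m) = mdist (completion M) (\<sigma> m) (E m)"
          by (intro P.mdist_commute E \<sigma>D)
        finally have "mdist M (x m) (x n) \<le> mdist (completion M) (\<sigma> m) (E m)
          + (mdist (completion M) (\<sigma> m) (\<sigma> n) + mdist (completion M) (\<sigma> n) (E n))" by simp
        moreover have "mdist (completion M) (\<sigma> m) (E m) < e / 3" "mdist (completion M) (\<sigma> n) (E n) < e / 3"
          using \<sigma>E[of m] \<sigma>E[of n] N1 mn by (meson le_less_trans max.boundedE)+
        moreover have "mdist (completion M) (\<sigma> m) (\<sigma> n) < e / 3" using N2 mn by simp
        ultimately show ?thesis by simp
      qed
      then show "\<exists>N. \<forall>m\<ge>N. \<forall>n\<ge>N. mdist M (x m) (x n) < e" by blast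
    qed (use x in auto)
    define X where "X = cls M x"
    have X: "X \<in> carrier (completion M)" by (auto simp: X_def carrier_completion xC)
    have "(\<lambda>k. mdist (completion M) (E k) X) \<longlonglongrightarrow> 0"
    proof (rule LIMSEQ_I)
      fix e :: real assume "e > 0"
      then have e2: "e / 2 > 0" by simp
      obtain N where N: "\<forall>m\<ge>N. \<forall>n\<ge>N. mdist M (x m) (x n) < e / 2"
        using cauchy_seqs_dist[OF xC e2] by blast
      have "mdist (completion M) (E k) X \<le> e / 2" if "k \<ge> N" for k
        unfolding E_def X_def
        by (rule LIMSEQ_le_const2[OF mdist_completion[OF const_cauchy[OF x] xC]])
          (use N that in \<open>auto intro!: exI[of _ N] less_imp_le\<close>)
      with \<open>e > 0\<close> show "\<exists>N. \<forall>k\<ge>N. norm (mdist (completion M) (E k) X - 0) < e"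
        by (fastforce intro!: exI[of _ N])
    qed
    from tendsto_add[OF LIMSEQ_inverse_real_of_nat this]
    have "(\<lambda>k. inverse (real (Suc k)) + mdist (completion M) (E k) X) \<longlonglongrightarrow> 0" by simp
    then have "(\<lambda>k. mdist (completion M) (\<sigma> k) X) \<longlonglongrightarrow> 0"
    proof (rule tendsto_zero_sandwich)
      fix k
      have "mdist (completion M) (\<sigma> k) X \<le> mdist (completion M) (\<sigma> k) (E k) + mdist (completion M) (E k) X"
        by (intro P.mdist_triangle E \<sigma>D X)
      with \<sigma>E[of k] show "mdist (completion M) (\<sigma> k) X \<le> inverse (real (Suc k)) + mdist (completion M) (E k) X"
        by linarith
    qed simp
    with X show "\<exists>X\<in>carrier (completion M). (\<lambda>k. mdist (completion M) (\<sigma> k) X) \<longlonglongrightarrow> 0" by blast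
  qed
qed

end

section \<open>Symmetry of the distance off the carrier, and tagged copies\<close>

text \<open>
  The locale \<open>Metric_space\<close> demands symmetry of the distance on the whole type, hence also for
  arguments outside the carrier of the completion.
\<close>

lemma (in pre_bimodule) mdist_completion_commute:
  assumes add: "\<And>x y. \<lbrakk>madd M x y \<in> carrier M; y \<in> carrier M\<rbrakk> \<Longrightarrow> x \<in> carrier M"
    and neg: "\<And>x. mscale M (- 1) x \<in> carrier M \<Longrightarrow> x \<in> carrier M"
  shows "mdist (completion M) X Y = mdist (completion M) Y X"
proof -
  define D where "D X Y = msub (completion M) X Y" for X Y
  have neg_neg: "mscale M (- 1) (mscale M (- 1) x) = x" if "x \<in> carrier M" for x
    using that by (simp add: scale_scale scale_one)
  have negC: "g \<in> C" if "(\<lambda>n. mscale M (- 1) (g n)) \<in> C" for g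
  proof -
    have "g n \<in> carrier M" for n using cauchy_seqsD[OF that] neg by blast
    with scale_cauchy[OF that, of "- 1"] show ?thesis by (simp add: neg_neg)
  qed
  have addC: "f \<in> C" if "(\<lambda>n. madd M (f n) (g n)) \<in> C" "g \<in> C" for f g
  proof -
    have f: "f n \<in> carrier M" for n
      using cauchy_seqsD[OF that(1)] cauchy_seqsD[OF that(2)] add by blast
    have "msub M (madd M (f n) (g n)) (g n) = f n" for n
      using msub_self[OF cauchy_seqsD[OF that(2)]] f cauchy_seqsD[OF that(2)]
      by (simp add: msub_def add_assoc closed add_zero)
    with sub_cauchy[OF that] show ?thesis by simp
  qed
  \<comment> \<open>Even for arbitrary sets \<open>X\<close> and \<open>Y\<close> only Cauchy
    members contribute to the difference: by \<open>neg\<close> and \<open>add\<close>, a sequence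
    whose negative is Cauchy, or whose sum with a Cauchy sequence is Cauchy, has its terms in the
    carrier and is Cauchy itself.\<close>
  have D: "h \<in> D X Y \<longleftrightarrow> (\<exists>f\<in>X \<inter> C. \<exists>g\<in>Y \<inter> C. h \<in> cls M (\<lambda>n. msub M (f n) (g n)))" for h X Y
  proof
    assume "h \<in> D X Y"
    then obtain f g g' where fg: "f \<in> X" "g \<in> Y" "g' \<in> cls M (\<lambda>n. mscale M (- 1) (g n))"
      "h \<in> cls M (\<lambda>n. madd M (f n) (g' n))"
      by (auto simp: D_def msub_def completion_def)
    have ng: "(\<lambda>n. mscale M (- 1) (g n)) \<in> C" and g': "g' \<in> C" and fg': "(\<lambda>n. madd M (f n) (g' n)) \<in> C"
      using fg(3,4) by (auto simp: null_rel_def)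
    have "cls M (\<lambda>n. madd M (f n) (g' n)) = cls M (\<lambda>n. msub M (f n) (g n))"
      using madd_completion[OF addC[OF fg' g'] g'] madd_completion[OF addC[OF fg' g'] ng] fg(3) ng
      by (simp add: in_cls_iff msub_def)
    with fg addC[OF fg' g'] negC[OF ng]
    show "\<exists>f\<in>X \<inter> C. \<exists>g\<in>Y \<inter> C. h \<in> cls M (\<lambda>n. msub M (f n) (g n))" by blast
  next
    assume "\<exists>f\<in>X \<inter> C. \<exists>g\<in>Y \<inter> C. h \<in> cls M (\<lambda>n. msub M (f n) (g n))"
    then obtain f g where "f \<in> X" "g \<in> Y" "g \<in> C" "h \<in> cls M (\<lambda>n. msub M (f n) (g n))" by blast
    with self_in_cls[OF scale_cauchy[OF \<open>g \<in> C\<close>, of "- 1"]]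
    show "h \<in> D X Y" unfolding D_def msub_def completion_def bimodule.simps by blast
  qed
  have DC: "h \<in> C" if "h \<in> D X Y" for h X Y
    using that cls_cauchy unfolding D by blast
  have D_neg: "(\<lambda>n. mscale M (- 1) (h n)) \<in> D Y X" if hD: "h \<in> D X Y" for h X Y
  proof -
    obtain f g where fg: "f \<in> X" "f \<in> C" "g \<in> Y" "g \<in> C" "h \<in> cls M (\<lambda>n. msub M (f n) (g n))"
      using hD unfolding D by blast
    have h: "h \<in> C" using fg(5) by (rule cls_cauchy)
    have "cls M h = cls M (\<lambda>n. msub M (f n) (g n))"
      using fg(5) sub_cauchy[OF fg(2,4)] by (simp add: in_cls_iff)
    then have "cls M (\<lambda>n. mscale M (- 1) (h n)) = cls M (\<lambda>n. mscale M (- 1) (msub M (f n) (g n)))"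
      using mscale_completion[OF h, of "- 1"] mscale_completion[OF sub_cauchy[OF fg(2,4)], of "- 1"]
      by (simp only:)
    also have "(\<lambda>n. mscale M (- 1) (msub M (f n) (g n))) = (\<lambda>n. msub M (g n) (f n))"
    proof
      fix n
      have "f n \<in> carrier M" "g n \<in> carrier M" using fg cauchy_seqsD by blast+
      then show "mscale M (- 1) (msub M (f n) (g n)) = msub M (g n) (f n)"
        by (simp add: msub_def scale_add neg_neg closed add_commute)
    qed
    finally show ?thesis
      using fg scale_cauchy[OF h, of "- 1"] self_in_cls unfolding D by blast
  qed
  have le: "(\<lambda>n. ip M (h n) (k n)) \<longlonglongrightarrow> c"
    if "\<forall>h\<in>D X Y. \<forall>k\<in>D X Y. (\<lambda>n. ip M (h n) (k n)) \<longlonglongrightarrow> c" and hk: "h \<in> D Y X" "k \<in> D Y X"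
    for X Y h k c
  proof -
    have "(\<lambda>n. ip M (mscale M (- 1) (h n)) (mscale M (- 1) (k n))) \<longlonglongrightarrow> c"
      using that(1)[rule_format, OF D_neg[OF hk(1)] D_neg[OF hk(2)]] .
    then show ?thesis
      using cauchy_seqsD[OF DC[OF hk(1)]] cauchy_seqsD[OF DC[OF hk(2)]]
      by (simp add: ip_scale ip_scale_left closed)
  qed
  \<comment> \<open>Negation maps \<open>D X Y\<close> and \<open>D Y X\<close> into each other
    without changing inner products, so the definite descriptions behind \<open>ip\<close> have
    equivalent predicates and agree even where no limit exists.\<close>
  have "(\<forall>h\<in>D X Y. \<forall>k\<in>D X Y. (\<lambda>n. ip M (h n) (k n)) \<longlonglongrightarrow> c)
      \<longleftrightarrow> (\<forall>h\<in>D Y X. \<forall>k\<in>D Y X. (\<lambda>n. ip M (h n) (k n)) \<longlonglongrightarrow> c)" for c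
    using le by blast
  then have "ip (completion M) (D X Y) (D X Y) = ip (completion M) (D Y X) (D Y X)"
    unfolding completion_def bimodule.simps by presburger
  then show ?thesis by (simp add: mdist_msub mnorm_def D_def)
qed

lemma mdist_tagged: "mdist (tagged s M) x y = mdist M (snd x) (snd y)"
  by (simp add: mdist_def tagged_def Let_def)

lemma complete_bimodule_tagged:
  assumes "complete_bimodule M"
  shows "complete_bimodule (tagged s M)"
proof -
  interpret complete_bimodule M by (rule assms)
  have mnorm: "mnorm (tagged s M) x = mnorm M (snd x)" for x
    by (simp add: mnorm_def tagged_def)
  show ?thesis
  proof
    fix \<sigma> assume \<sigma>: "\<sigma> \<in> cauchy_seqs (tagged s M)"
    have "snd (\<sigma> n) \<in> carrier M" for n
      using cauchy_seqsD[OF \<sigma>, of n] by (auto simp: tagged_def)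
    with \<sigma> have "(\<lambda>n. snd (\<sigma> n)) \<in> cauchy_seqs M"
      by (simp add: cauchy_seqs_def mdist_tagged image_subset_iff)
    then obtain x where "x \<in> carrier M" "(\<lambda>n. mdist M (snd (\<sigma> n)) x) \<longlonglongrightarrow> 0"
      using seq_complete by blast
    then show "\<exists>x\<in>carrier (tagged s M). (\<lambda>n. mdist (tagged s M) (\<sigma> n) x) \<longlonglongrightarrow> 0"
      unfolding mdist_tagged by (intro bexI[of _ "(s, x)"]) (simp_all add: tagged_def)
  qed (use ip_definite mnorm_lact in \<open>auto simp: mnorm, auto simp: tagged_def closed add_ac add_zero scale_add add_scale
      scale_scale scale_one scale_zero ract_add_left ract_add_right ract_mult ract_scale_left ract_scale_right
      ip_add ip_scale ip_ract ip_star ip_positive lact_adjoint lact_add_left lact_scale_left lact_mult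
      lact_add_right lact_scale_right\<close>)
qed

section \<open>Isometries with dense range\<close>

context pre_bimodule
begin

lemma zero_simps:
  "mscale M c (mzero M) = mzero M" "ract M (mzero M) a = mzero M" "lact M a (mzero M) = mzero M"
proof -
  have z: "mscale M 0 (mzero M) = mzero M" by (simp add: scale_zero closed)
  show "mscale M c (mzero M) = mzero M"
    using scale_scale[OF zero_closed, of c 0] by (simp add: z)
  show "ract M (mzero M) a = mzero M" "lact M a (mzero M) = mzero M"
    using ract_scale_left[OF zero_closed, of 0 a] lact_scale_right[OF zero_closed, of a 0]
    by (simp_all add: z scale_zero closed)
qed

lemma convergent_cauchy_seqs:
  assumes y: "y \<in> carrier M" and f: "\<And>n. f n \<in> carrier M" and lim: "(\<lambda>n. mdist M (f n) y) \<longlonglongrightarrow> 0"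
  shows "f \<in> cauchy_seqs M"
  unfolding cauchy_seqs_def
proof (intro CollectI conjI allI impI)
  fix e :: real assume "e > 0"
  then obtain N where N: "\<forall>n\<ge>N. mdist M (f n) y < e / 2"
    using LIMSEQ_D[OF lim, of "e / 2"] by auto
  have "mdist M (f m) (f n) < e" if "m \<ge> N" "n \<ge> N" for m n
  proof -
    have "mdist M (f m) (f n) \<le> mdist M (f m) y + mdist M (f n) y"
      using mdist_triangle[OF f y f, of m n] mdist_commute[OF y f, of n] by simp
    moreover have "mdist M (f m) y < e / 2" "mdist M (f n) y < e / 2" using N that by blast+
    ultimately show ?thesis by simp
  qed
  then show "\<exists>N. \<forall>m\<ge>N. \<forall>n\<ge>N. mdist M (f m) (f n) < e" by blast
qed (use f in auto)

lemma tendsto_ip: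
  assumes xy: "x \<in> carrier M" "y \<in> carrier M" and fg: "\<And>n. f n \<in> carrier M" "\<And>n. g n \<in> carrier M"
    and fx: "(\<lambda>n. mdist M (f n) x) \<longlonglongrightarrow> 0" and gy: "(\<lambda>n. mdist M (g n) y) \<longlonglongrightarrow> 0"
  shows "(\<lambda>n. ip M (f n) (g n)) \<longlonglongrightarrow> ip M x y"
proof -
  have "(\<lambda>n. mdist M (f n) x * (mnorm M y + mdist M (g n) y) + mnorm M x * mdist M (g n) y) \<longlonglongrightarrow>
      0 * (mnorm M y + 0) + mnorm M x * 0"
    by (intro tendsto_intros fx gy)
  then have "(\<lambda>n. mdist M (f n) x * (mnorm M y + mdist M (g n) y) + mnorm M x * mdist M (g n) y) \<longlonglongrightarrow> 0"
    by simp
  then have "(\<lambda>n. norm (ip M (f n) (g n) - ip M x y)) \<longlonglongrightarrow> 0"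
  proof (rule tendsto_zero_sandwich)
    fix n
    have "norm (ip M (f n) (g n) - ip M x y) \<le> mdist M (f n) x * mnorm M (g n) + mnorm M x * mdist M (g n) y"
      by (intro ip_diff_le xy fg)
    also have "mdist M (f n) x * mnorm M (g n) \<le> mdist M (f n) x * (mnorm M y + mdist M (g n) y)"
      by (intro mult_left_mono mnorm_le_add_mdist xy fg) simp
    finally show "norm (ip M (f n) (g n) - ip M x y)
      \<le> mdist M (f n) x * (mnorm M y + mdist M (g n) y) + mnorm M x * mdist M (g n) y" by simp
  qed simp
  then have "(\<lambda>n. ip M (f n) (g n) - ip M x y) \<longlonglongrightarrow> 0" by (rule tendsto_norm_zero_cancel)
  then show ?thesis by (rule LIM_zero_cancel)
qed

end

text \<open>The value at a class is the limit of \<open>g\<close> along a representative; isometry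
  makes it well defined and injective, density makes it surjective. Of \<open>P\<close> only closure
  under its operations is asked, because the metric estimates are pulled back along
  \<open>g\<close>; this admits formal tensors.\<close>

lemma (in complete_bimodule) completion_iso:
  fixes P :: "('a, 'k) bimodule"
  assumes P: "mzero P \<in> carrier P"
    "\<And>x y. \<lbrakk>x \<in> carrier P; y \<in> carrier P\<rbrakk> \<Longrightarrow> madd P x y \<in> carrier P"
    "\<And>x c. x \<in> carrier P \<Longrightarrow> mscale P c x \<in> carrier P"
    "\<And>x a. x \<in> carrier P \<Longrightarrow> ract P x a \<in> carrier P"
    "\<And>x a. x \<in> carrier P \<Longrightarrow> lact P a x \<in> carrier P"
    and g_closed: "\<And>x. x \<in> carrier P \<Longrightarrow> g x \<in> carrier M"
    and g_add: "\<And>x y. \<lbrakk>x \<in> carrier P; y \<in> carrier P\<rbrakk> \<Longrightarrow> g (madd P x y) = madd M (g x) (g y)"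
    and g_scale: "\<And>x c. x \<in> carrier P \<Longrightarrow> g (mscale P c x) = mscale M c (g x)"
    and g_ract: "\<And>x a. x \<in> carrier P \<Longrightarrow> g (ract P x a) = ract M (g x) a"
    and g_lact: "\<And>x a. x \<in> carrier P \<Longrightarrow> g (lact P a x) = lact M a (g x)"
    and g_ip: "\<And>x y. \<lbrakk>x \<in> carrier P; y \<in> carrier P\<rbrakk> \<Longrightarrow> ip P x y = ip M (g x) (g y)"
    and dense: "\<And>y e. \<lbrakk>y \<in> carrier M; e > 0\<rbrakk> \<Longrightarrow> \<exists>x\<in>carrier P. mdist M (g x) y \<le> e"
  shows "\<exists>h. bimodule_iso (completion P) M h \<and> (\<forall>x\<in>carrier P. h (cls P (\<lambda>n. x)) = g x)"
proof -
  have norm_P: "mnorm P x = mnorm M (g x)" if "x \<in> carrier P" for x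
    using that by (simp add: mnorm_def g_ip)
  have dist_P: "mdist P x y = mdist M (g x) (g y)" if "x \<in> carrier P" "y \<in> carrier P" for x y
    using that by (simp add: mdist_msub norm_P msub_def P g_add g_scale)
  interpret P: metric_bimodule P
    by unfold_locales (simp_all add: P dist_P norm_P g_closed g_add g_scale g_ract g_lact g_ip
        mdist_self mdist_commute mdist_triangle mdist_add mdist_scale mdist_ract mdist_lact
        ip_diff_le mnorm_le_add_mdist)
  define lim where "lim f = (THE y. y \<in> carrier M \<and> (\<lambda>n. mdist M (g (f n)) y) \<longlonglongrightarrow> 0)" for f
  have fD: "f n \<in> carrier P" "g (f n) \<in> carrier M" if "f \<in> P.C" for f n
    using cauchy_seqsD[OF that] g_closed by auto
  have lim: "lim f \<in> carrier M" "(\<lambda>n. mdist M (g (f n)) (lim f)) \<longlonglongrightarrow> 0" if f: "f \<in> P.C" for f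
  proof -
    have "(\<lambda>n. g (f n)) \<in> cauchy_seqs M"
      using f fD[OF f] by (auto simp: cauchy_seqs_def dist_P)
    then obtain y where y: "y \<in> carrier M" "(\<lambda>n. mdist M (g (f n)) y) \<longlonglongrightarrow> 0"
      using seq_complete by blast
    have "\<exists>!y. y \<in> carrier M \<and> (\<lambda>n. mdist M (g (f n)) y) \<longlonglongrightarrow> 0"
      using y limit_unique[of _ _ "\<lambda>n. g (f n)"] fD[OF f] by blast
    from theI'[OF this] show "lim f \<in> carrier M" "(\<lambda>n. mdist M (g (f n)) (lim f)) \<longlonglongrightarrow> 0"
      unfolding lim_def by blast+
  qed
  have lim_eqI: "lim f = y" if "f \<in> P.C" "y \<in> carrier M" "(\<lambda>n. mdist M (g (f n)) y) \<longlonglongrightarrow> 0" for f y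
    using limit_unique[of "lim f" y "\<lambda>n. g (f n)"] lim[OF that(1)] fD[OF that(1)] that by blast
  have lim_eq_iff: "lim f = lim f' \<longleftrightarrow> cls P f = cls P f'" if f: "f \<in> P.C" and f': "f' \<in> P.C" for f f'
  proof
    assume eq: "lim f = lim f'"
    have "(\<lambda>n. mdist M (g (f n)) (lim f) + mdist M (g (f' n)) (lim f)) \<longlonglongrightarrow> 0"
      using lim(2)[OF f] lim(2)[OF f'] unfolding eq by (rule tendsto_add_zero)
    then show "cls P f = cls P f'"
    proof (rule P.cls_eqI[OF f f'])
      fix n
      show "mdist P (f n) (f' n) \<le> mdist M (g (f n)) (lim f) + mdist M (g (f' n)) (lim f)"
        using mdist_triangle[of "g (f n)" "lim f" "g (f' n)"] mdist_commute[of "g (f' n)" "lim f"]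
        by (simp add: dist_P fD f f' lim)
    qed
  next
    assume "cls P f = cls P f'"
    then have "(\<lambda>n. mdist M (g (f n)) (g (f' n))) \<longlonglongrightarrow> 0"
      using P.cls_eq_iff[OF f f'] by (simp add: dist_P fD f f')
    from tendsto_add_zero[OF this lim(2)[OF f']] have "(\<lambda>n. mdist M (g (f n)) (lim f')) \<longlonglongrightarrow> 0"
      by (rule tendsto_zero_sandwich) (simp_all add: mdist_triangle fD f f' lim)
    then show "lim f = lim f'" by (intro lim_eqI f lim f')
  qed
  define h where "h X = lim (SOME f. f \<in> X)" for X
  have h: "h (cls P f) = lim f" if f: "f \<in> P.C" for f
  proof -
    have "(SOME f'. f' \<in> cls P f) \<in> cls P f"
      using someI[of "\<lambda>f'. f' \<in> cls P f", OF P.self_in_cls[OF f]] .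
    then have "(SOME f'. f' \<in> cls P f) \<in> P.C" "cls P (SOME f'. f' \<in> cls P f) = cls P f"
      using P.in_cls_iff[OF f] by auto
    then show ?thesis unfolding h_def using lim_eq_iff f by blast
  qed
  have "bimodule_iso (completion P) M h"
    unfolding bimodule_iso_def
  proof (intro conjI ballI allI)
    have inj: "inj_on h (carrier (completion P))"
      by (rule inj_onI) (auto simp: P.carrier_completion h lim_eq_iff)
    have "y \<in> h ` carrier (completion P)" if y: "y \<in> carrier M" for y
    proof -
      have "\<exists>x\<in>carrier P. mdist M (g x) y \<le> inverse (real (Suc n))" for n
        by (rule dense[OF y]) simp
      then obtain x where x: "\<And>n. x n \<in> carrier P" "\<And>n. mdist M (g (x n)) y \<le> inverse (real (Suc n))"
        by metis
      have xy: "(\<lambda>n. mdist M (g (x n)) y) \<longlonglongrightarrow> 0"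
        using LIMSEQ_inverse_real_of_nat by (rule tendsto_zero_sandwich) (rule mdist_nonneg, rule x)
      have "(\<lambda>n. g (x n)) \<in> cauchy_seqs M"
        using convergent_cauchy_seqs[OF y _ xy] g_closed x by blast
      then have "x \<in> P.C" using x by (auto simp: cauchy_seqs_def dist_P)
      moreover from this have "h (cls P x) = y" using lim_eqI[OF _ y xy] by (simp add: h)
      ultimately show ?thesis by (auto simp: P.carrier_completion)
    qed
    moreover have "h ` carrier (completion P) \<subseteq> carrier M"
      by (auto simp: P.carrier_completion h lim)
    ultimately show "bij_betw h (carrier (completion P)) (carrier M)"
      using inj by (auto simp: bij_betw_def)
  next
    fix X Y assume "X \<in> carrier (completion P)" "Y \<in> carrier (completion P)"
    then obtain f f' where f: "f \<in> P.C" "X = cls P f" and f': "f' \<in> P.C" "Y = cls P f'"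
      by (auto simp: P.carrier_completion)
    have "(\<lambda>n. mdist M (g (f n)) (lim f) + mdist M (g (f' n)) (lim f')) \<longlonglongrightarrow> 0"
      by (intro tendsto_add_zero lim f f')
    then have "(\<lambda>n. mdist M (g (madd P (f n) (f' n))) (madd M (lim f) (lim f'))) \<longlonglongrightarrow> 0"
      by (rule tendsto_zero_sandwich) (simp_all add: g_add fD f f' lim mdist_add)
    then have "lim (\<lambda>n. madd P (f n) (f' n)) = madd M (lim f) (lim f')"
      by (intro lim_eqI P.add_cauchy closed lim f f')
    then show "h (madd (completion P) X Y) = madd M (h X) (h Y)"
      by (simp add: f f' P.completion_simps h)
    have "(\<lambda>n. ip P (f n) (f' n)) \<longlonglongrightarrow> ip M (lim f) (lim f')"
      using tendsto_ip[OF lim(1)[OF f(1)] lim(1)[OF f'(1)] fD(2)[OF f(1)] fD(2)[OF f'(1)] lim(2)[OF f(1)] lim(2)[OF f'(1)]]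
      by (simp add: g_ip fD f f')
    then show "ip M (h X) (h Y) = ip (completion P) X Y"
      by (simp add: f f' h P.ip_completion_eqI)
  next
    fix X c assume "X \<in> carrier (completion P)"
    then obtain f where f: "f \<in> P.C" "X = cls P f" by (auto simp: P.carrier_completion)
    have "(\<lambda>n. mdist M (g (mscale P c (f n))) (mscale M c (lim f))) \<longlonglongrightarrow> 0"
      using tendsto_mult_right_zero[OF lim(2)[OF f(1)], of "cmod c"]
      by (rule tendsto_zero_sandwich) (simp_all add: g_scale fD f lim mdist_scale)
    then have "lim (\<lambda>n. mscale P c (f n)) = mscale M c (lim f)"
      by (intro lim_eqI P.scale_cauchy closed lim f)
    then show "h (mscale (completion P) c X) = mscale M c (h X)"
      by (simp add: f P.completion_simps h)
  next
    fix X a assume "X \<in> carrier (completion P)"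
    then obtain f where f: "f \<in> P.C" "X = cls P f" by (auto simp: P.carrier_completion)
    have "(\<lambda>n. mdist M (g (ract P (f n) a)) (ract M (lim f) a)) \<longlonglongrightarrow> 0"
      "(\<lambda>n. mdist M (g (lact P a (f n))) (lact M a (lim f))) \<longlonglongrightarrow> 0"
      by (rule tendsto_zero_sandwich[OF tendsto_mult_right_zero[OF lim(2)[OF f(1)], of "norm a"]];
        simp add: g_ract g_lact fD f lim mdist_ract mdist_lact)+
    then have "lim (\<lambda>n. ract P (f n) a) = ract M (lim f) a" "lim (\<lambda>n. lact P a (f n)) = lact M a (lim f)"
      by (simp_all add: lim_eqI P.ract_cauchy P.lact_cauchy closed lim f)
    then show "h (ract (completion P) X a) = ract M (h X) a" "h (lact (completion P) a X) = lact M a (h X)"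
      by (simp_all add: f P.completion_simps h)
  qed
  moreover have "h (cls P (\<lambda>n. x)) = g x" if "x \<in> carrier P" for x
    using that by (simp add: h P.const_cauchy lim_eqI g_closed mdist_self)
  ultimately show ?thesis by blast
qed

text \<open>Turns an isomorphism onto \<open>A\<close>, as \<open>completion_iso\<close> delivers
  it, into one that starts at \<open>A\<close>, as the unit fibre demands.\<close>

lemma bimodule_iso_inv:
  assumes M: "pre_bimodule M" and h: "bimodule_iso M N h" and k: "\<And>x. x \<in> carrier N \<Longrightarrow> k x \<in> carrier M \<and> h (k x) = x"
  shows "bimodule_iso N M k"
proof -
  interpret pre_bimodule M by (rule M)
  have bij: "bij_betw h (carrier M) (carrier N)"
    and hom: "\<And>x y. \<lbrakk>x \<in> carrier M; y \<in> carrier M\<rbrakk> \<Longrightarrow> h (madd M x y) = madd N (h x) (h y)"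
    "\<And>x y. \<lbrakk>x \<in> carrier M; y \<in> carrier M\<rbrakk> \<Longrightarrow> ip N (h x) (h y) = ip M x y"
    "\<And>x c. x \<in> carrier M \<Longrightarrow> h (mscale M c x) = mscale N c (h x)"
    "\<And>x a. x \<in> carrier M \<Longrightarrow> h (ract M x a) = ract N (h x) a"
    "\<And>x a. x \<in> carrier M \<Longrightarrow> h (lact M a x) = lact N a (h x)"
    using h by (auto simp: bimodule_iso_def)
  have kh: "k (h x) = x" if "x \<in> carrier M" for x
  proof -
    have "h x \<in> carrier N" using bij that by (auto simp: bij_betw_def)
    then show ?thesis using k[of "h x"] bij that by (auto simp: bij_betw_def inj_on_def)
  qed
  have eqI: "k y = x" if "x \<in> carrier M" "y = h x" for x y
    using that kh by simp
  have "bij_betw k (carrier N) (carrier M)"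
    by (rule bij_betw_byWitness[where f' = h]) (use k kh bij in \<open>auto simp: bij_betw_def\<close>)
  moreover have "k (madd N x y) = madd M (k x) (k y)" "ip M (k x) (k y) = ip N x y"
    if "x \<in> carrier N" "y \<in> carrier N" for x y
    using k[OF that(1)] k[OF that(2)] hom(2)[of "k x" "k y"] by (auto intro!: eqI simp: hom closed)
  moreover have "k (mscale N c x) = mscale M c (k x)" "k (ract N x a) = ract M (k x) a"
      "k (lact N a x) = lact M a (k x)" if "x \<in> carrier N" for x a c
    using k[OF that] by (auto intro!: eqI simp: hom closed)
  ultimately show ?thesis by (simp add: bimodule_iso_def)
qed

text \<open>Summing \<open>\<mu>\<close> over a list extends it to formal tensors. The hypothesis on
  inner products makes this sum isometric, and \<open>completion_iso\<close> gives the rest; density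
  is provided already by single products.\<close>

lemma (in complete_bimodule) internal_tensor_iso:
  assumes X: "pre_bimodule X" and Y: "pre_bimodule Y"
    and \<mu>_closed: "\<And>x y. \<lbrakk>x \<in> carrier X; y \<in> carrier Y\<rbrakk> \<Longrightarrow> \<mu> x y \<in> carrier M"
    and \<mu>_scale: "\<And>x y c. \<lbrakk>x \<in> carrier X; y \<in> carrier Y\<rbrakk> \<Longrightarrow> \<mu> (mscale X c x) y = mscale M c (\<mu> x y)"
    and \<mu>_ract: "\<And>x y a. \<lbrakk>x \<in> carrier X; y \<in> carrier Y\<rbrakk> \<Longrightarrow> \<mu> x (ract Y y a) = ract M (\<mu> x y) a"
    and \<mu>_lact: "\<And>x y a. \<lbrakk>x \<in> carrier X; y \<in> carrier Y\<rbrakk> \<Longrightarrow> \<mu> (lact X a x) y = lact M a (\<mu> x y)"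
    and \<mu>_ip: "\<And>x y x' y'. \<lbrakk>x \<in> carrier X; y \<in> carrier Y; x' \<in> carrier X; y' \<in> carrier Y\<rbrakk>
      \<Longrightarrow> ip M (\<mu> x y) (\<mu> x' y') = ip Y y (lact Y (ip X x x') y')"
    and dense: "\<And>z e. \<lbrakk>z \<in> carrier M; e > 0\<rbrakk> \<Longrightarrow> \<exists>x\<in>carrier X. \<exists>y\<in>carrier Y. mdist M (\<mu> x y) z \<le> e"
  shows "\<exists>h. bimodule_iso (internal_tensor X Y) M h \<and>
    (\<forall>x\<in>carrier X. \<forall>y\<in>carrier Y. h (simple_tensor X Y x y) = \<mu> x y)"
proof -
  interpret X: pre_bimodule X by (rule X)
  interpret Y: pre_bimodule Y by (rule Y)
  let ?T = "formal_tensor X Y"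
  define g where "g u = foldr (\<lambda>(x, y). madd M (\<mu> x y)) u (mzero M)" for u
  have g_simps: "g [] = mzero M" "g ((x, y) # u) = madd M (\<mu> x y) (g u)" for x y u
    by (simp_all add: g_def)
  have T: "carrier ?T = lists (carrier X \<times> carrier Y)" by (simp add: formal_tensor_def)
  have g_closed: "g u \<in> carrier M" if "u \<in> carrier ?T" for u
    using that unfolding T by induction (auto simp: g_simps closed \<mu>_closed)
  then have g_closed': "g u \<in> carrier M" if "\<forall>p\<in>set u. p \<in> carrier X \<times> carrier Y" for u
    using that T by fastforce
  have g_ip1: "ip M z (g v) = (\<Sum>(x', y')\<leftarrow>v. ip M z (\<mu> x' y'))" if "v \<in> carrier ?T" "z \<in> carrier M" for z v
    using that unfolding T
    by induction (auto simp: g_simps closed \<mu>_closed ip_add ip_zero g_closed')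
  have single: "g [(x, y)] = \<mu> x y" if "x \<in> carrier X" "y \<in> carrier Y" for x y
    using that by (simp add: g_simps add_zero \<mu>_closed)
  have "\<exists>h. bimodule_iso (completion ?T) M h \<and> (\<forall>u\<in>carrier ?T. h (cls ?T (\<lambda>n. u)) = g u)"
  proof (rule completion_iso)
    show "mzero ?T \<in> carrier ?T" by (simp add: formal_tensor_def)
  next
    fix u v assume u: "u \<in> carrier ?T" and v: "v \<in> carrier ?T"
    show "madd ?T u v \<in> carrier ?T"
      using u v unfolding T by (simp add: formal_tensor_def)
    show "g (madd ?T u v) = madd M (g u) (g v)"
      using u unfolding T
    proof induction
      case Nil
      show ?case
        using add_commute[OF zero_closed g_closed[OF v]]
        by (simp add: formal_tensor_def g_simps add_zero g_closed[OF v])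
    next
      case (Cons p u)
      then show ?case
        by (cases p) (simp add: formal_tensor_def g_simps add_assoc \<mu>_closed g_closed[unfolded T] g_closed[OF v])
    qed
    show "ip ?T u v = ip M (g u) (g v)"
      using u unfolding T
    proof induction
      case Nil
      show ?case
        using arg_cong[OF ip_zero[OF g_closed[OF v]], of star] v
        by (simp add: formal_tensor_def g_simps ip_star g_closed closed)
    next
      case (Cons p u)
      obtain x y where p: "p = (x, y)" by (cases p)
      with Cons have xy: "x \<in> carrier X" "y \<in> carrier Y" by auto
      have "(\<Sum>(x', y')\<leftarrow>v. ip Y y (lact Y (ip X x x') y')) = (\<Sum>(x', y')\<leftarrow>v. ip M (\<mu> x y) (\<mu> x' y'))"
        using v unfolding T by (intro arg_cong[where f = sum_list] map_cong) (auto simp: \<mu>_ip xy)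
      with Cons show ?case
        by (simp add: formal_tensor_def p g_simps ip_add_left \<mu>_closed xy g_closed[unfolded T] g_closed[OF v] g_ip1[OF v])
    qed
  next
    fix u a and c :: complex assume u: "u \<in> carrier ?T"
    show "mscale ?T c u \<in> carrier ?T" "ract ?T u a \<in> carrier ?T" "lact ?T a u \<in> carrier ?T"
      using u unfolding T by (auto simp: formal_tensor_def X.closed Y.closed in_lists_conv_set)
    show "g u \<in> carrier M" using u by (rule g_closed)
    show "g (mscale ?T c u) = mscale M c (g u)"
      using u unfolding T by induction
        (auto simp: formal_tensor_def g_simps zero_simps scale_add \<mu>_closed g_closed' \<mu>_scale)
    show "g (ract ?T u a) = ract M (g u) a"
      using u unfolding T by induction
        (auto simp: formal_tensor_def g_simps zero_simps ract_add_left \<mu>_closed g_closed' \<mu>_ract)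
    show "g (lact ?T a u) = lact M a (g u)"
      using u unfolding T by induction
        (auto simp: formal_tensor_def g_simps zero_simps lact_add_right \<mu>_closed g_closed' \<mu>_lact)
  next
    fix z and e :: real assume "z \<in> carrier M" "e > 0"
    then obtain x y where "x \<in> carrier X" "y \<in> carrier Y" "mdist M (\<mu> x y) z \<le> e" using dense by blast
    then show "\<exists>u\<in>carrier ?T. mdist M (g u) z \<le> e"
      by (intro bexI[of _ "[(x, y)]"]) (simp_all add: single T)
  qed
  then obtain h where "bimodule_iso (completion ?T) M h" "\<forall>u\<in>carrier ?T. h (cls ?T (\<lambda>n. u)) = g u" by blast
  moreover have "[(x, y)] \<in> carrier ?T" if "x \<in> carrier X" "y \<in> carrier Y" for x y
    using that T by fastforce
  ultimately show ?thesis
    unfolding internal_tensor_def simple_tensor_def by (intro exI[of _ h]) (auto simp: single)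
qed

section \<open>The bimodules of a transfer system\<close>

text \<open>Checked inside the associative algebra \<open>M(A)\<close>, where
  \<open>mult_embed_mult\<close> turns the right action into multiplication; the embedding is
  injective.\<close>

lemma mult_rmult: "(a * b) \<cdot>\<^sub>r m = a * (b \<cdot>\<^sub>r m)"
proof -
  have "mult_embed ((a * b) \<cdot>\<^sub>r m) = mult_embed (a * (b \<cdot>\<^sub>r m))"
    by (simp add: mult_embed_times mult.assoc flip: mult_embed_mult)
  then show ?thesis by simp
qed

lemma rmult_linear: "(a + b) \<cdot>\<^sub>r m = a \<cdot>\<^sub>r m + b \<cdot>\<^sub>r m" "(a - b) \<cdot>\<^sub>r m = a \<cdot>\<^sub>r m - b \<cdot>\<^sub>r m"
  "(c *\<^sub>C a) \<cdot>\<^sub>r m = c *\<^sub>C (a \<cdot>\<^sub>r m)" "0 \<cdot>\<^sub>r m = 0"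
proof -
  have "mult_embed ((a + b) \<cdot>\<^sub>r m) = mult_embed (a \<cdot>\<^sub>r m + b \<cdot>\<^sub>r m)"
    by (simp add: mult_embed_add distrib_right flip: mult_embed_mult)
  moreover have "mult_embed ((a - b) \<cdot>\<^sub>r m) = mult_embed (a \<cdot>\<^sub>r m - b \<cdot>\<^sub>r m)"
    by (simp add: mult_embed_diff left_diff_distrib flip: mult_embed_mult)
  moreover have "mult_embed ((c *\<^sub>C a) \<cdot>\<^sub>r m) = mult_embed (c *\<^sub>C (a \<cdot>\<^sub>r m))"
    by (simp add: mult_embed_scaleC mult_scaleC_left flip: mult_embed_mult)
  moreover have "mult_embed (0 \<cdot>\<^sub>r m) = mult_embed (0 :: 'a)"
    by (simp flip: mult_embed_mult)
  ultimately show "(a + b) \<cdot>\<^sub>r m = a \<cdot>\<^sub>r m + b \<cdot>\<^sub>r m" "(a - b) \<cdot>\<^sub>r m = a \<cdot>\<^sub>r m - b \<cdot>\<^sub>r m"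
    "(c *\<^sub>C a) \<cdot>\<^sub>r m = c *\<^sub>C (a \<cdot>\<^sub>r m)" "0 \<cdot>\<^sub>r m = 0"
    unfolding mult_embed_eq_iff by auto
qed

lemma tendsto_rmult:
  fixes m :: "'a::cstar_algebra multiplier"
  assumes "(f \<longlongrightarrow> a) F"
  shows "((\<lambda>x. f x \<cdot>\<^sub>r m) \<longlongrightarrow> a \<cdot>\<^sub>r m) F"
proof -
  have "(r *\<^sub>R b) \<cdot>\<^sub>r m = r *\<^sub>R (b \<cdot>\<^sub>r m)" for r b
    by (simp add: scaleR_scaleC rmult_linear)
  then have "bounded_linear (\<lambda>x. x \<cdot>\<^sub>r m)"
    by (intro bounded_linear_intro[where K = "norm m"])
      (use norm_rmult[of _ m] in \<open>simp_all add: rmult_linear mult.commute\<close>)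
  from bounded_linear.tendsto[OF this assms] show ?thesis .
qed

context transfer_system
begin

abbreviation "p s \<equiv> extension (\<alpha> s) 1"
abbreviation "Q s \<equiv> pre_fibre \<alpha> L s"

lemma is_extension: "is_extension (\<alpha> s) (extension (\<alpha> s))"
  using theI'[OF extendible[unfolded extendible_def]] by (simp add: extension_def)

lemma extension_hom: "star_hom (extension (\<alpha> s))" and extension_embed: "extension (\<alpha> s) (mult_embed a) = mult_embed (\<alpha> s a)"
  using is_extension[of s] by (simp_all add: is_extension_def)

lemma extension_mult: "extension (\<alpha> s) (m * n) = extension (\<alpha> s) m * extension (\<alpha> s) n"
  using extension_hom[of s] by (simp add: star_hom_def)

lemma alpha_mult: "\<alpha> s (a * b) = \<alpha> s a * \<alpha> s b" and alpha_star: "\<alpha> s (star a) = star (\<alpha> s a)"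
  and alpha_linear: "clinear_map (\<alpha> s)"
  using endomorphism[of s] by (simp_all add: star_hom_def)

lemmas alpha_simps = clinear_map_simps[OF alpha_linear]

lemma p_idem: "p s * p s = p s"
  by (simp flip: extension_mult)

lemma alpha_rmult_p: "\<alpha> s b \<cdot>\<^sub>r p s = \<alpha> s b"
proof -
  have "mult_embed (\<alpha> s b \<cdot>\<^sub>r p s) = extension (\<alpha> s) (mult_embed b * 1)"
    by (simp only: extension_mult extension_embed mult_embed_mult[symmetric])
  then show ?thesis by (simp add: extension_embed)
qed

text \<open>As the image of \<open>1\<close> under the extension, \<open>p s\<close> is a unit for
  the range of \<open>\<alpha> s\<close>. Such a product therefore depends on \<open>a\<close> only
  through \<open>a \<cdot>\<^sub>r p s\<close>, which is what makes \<open>fibre_mult\<close> well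
  defined.\<close>

lemma rmult_p_alpha: "(a \<cdot>\<^sub>r p s) * \<alpha> s b = a * \<alpha> s b"
proof -
  have "mult_embed ((a \<cdot>\<^sub>r p s) * \<alpha> s b) = mult_embed a * extension (\<alpha> s) (1 * mult_embed b)"
    by (simp only: extension_mult extension_embed mult_embed_times mult_embed_mult[symmetric] mult.assoc)
  then show ?thesis by (simp add: extension_embed flip: mult_embed_times)
qed

text \<open>Contractivity is read off from the extension, which acts on the unital algebra
  \<open>M(A)\<close>.\<close>

lemma norm_alpha: "norm (\<alpha> s a) \<le> norm a"
  using star_hom_norm_le[OF extension_hom, of s "mult_embed a"] by (simp add: extension_embed)

lemma tendsto_alpha: "(f \<longlongrightarrow> a) F \<Longrightarrow> ((\<lambda>x. \<alpha> s (f x)) \<longlongrightarrow> \<alpha> s a) F"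
  by (rule bounded_linear.tendsto)
    (auto intro!: bounded_linear_intro[where K = 1] simp: alpha_simps norm_alpha)

text \<open>As \<open>p s\<close> is idempotent, its right multiples are the fixed points of right
  multiplication by it. Membership becomes an equation, preserved under limits.\<close>

lemma carrier_Q: "carrier (Q s) = {x. x \<cdot>\<^sub>r p s = x}"
proof -
  have "a \<cdot>\<^sub>r p s \<cdot>\<^sub>r p s = a \<cdot>\<^sub>r p s" for a by (simp add: p_idem flip: rmult_simps(4))
  then have "(\<exists>a. x = a \<cdot>\<^sub>r p s) \<longleftrightarrow> x \<cdot>\<^sub>r p s = x" for x by metis
  then show ?thesis by (simp add: pre_fibre_def)
qed

lemma Q_simps: "madd (Q s) = (+)" "mzero (Q s) = 0" "mscale (Q s) = scaleC"
  "ract (Q s) x a = x * \<alpha> s a" "lact (Q s) = (*)" "ip (Q s) x y = L s (star x * y)"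
  by (simp_all add: pre_fibre_def)

text \<open>Strict convergence of \<open>\<alpha> s u\<close> to \<open>p s\<close> says that
  \<open>x * \<alpha> s u\<close> tends to \<open>x \<cdot>\<^sub>r p s\<close> in norm, and this is
  \<open>x\<close> on the carrier. The same fact supplies an approximate unit of \<open>A\<close>
  wherever one is wanted.\<close>

lemma approximate_unit_carrier:
  obtains F where "approximate_unit F" "\<And>x. x \<in> carrier (Q s) \<Longrightarrow> ((\<lambda>u. x * \<alpha> s u) \<longlongrightarrow> x) F"
proof -
  obtain F where F: "approximate_unit F" "strictly_tendsto (\<lambda>u. mult_embed (\<alpha> s u)) (p s) F"
    using is_extension[of s] by (auto simp: is_extension_def)
  then have "((\<lambda>u. x * \<alpha> s u) \<longlongrightarrow> x \<cdot>\<^sub>r p s) F" for x by (simp add: strictly_tendsto_def)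
  then show ?thesis using that F(1) by (metis (mono_tags) carrier_Q mem_Collect_eq)
qed

lemma mult_alpha_carrier: "x * \<alpha> s a \<in> carrier (Q s)"
  by (simp add: carrier_Q mult_rmult alpha_rmult_p)

text \<open>Since \<open>y\<close> is a limit of \<open>y * \<alpha> t u\<close>, the element
  \<open>\<alpha> s y\<close> is a limit of \<open>\<alpha> s y * \<alpha> (s + t) u\<close>; these
  lie in the carrier at \<open>s + t\<close>, which is closed under limits.\<close>

lemma alpha_carrier:
  assumes "y \<in> carrier (Q t)"
  shows "\<alpha> s y \<in> carrier (Q (s + t))"
proof -
  obtain F where F: "approximate_unit F" "((\<lambda>u. y * \<alpha> t u) \<longlongrightarrow> y) F"
    using approximate_unit_carrier[of t] assms by metis
  have "F \<noteq> bot" using F(1) by (simp add: approximate_unit_def)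
  have lim: "((\<lambda>u. \<alpha> s (y * \<alpha> t u)) \<longlongrightarrow> \<alpha> s y) F" by (rule tendsto_alpha[OF F(2)])
  have eq: "\<alpha> s (y * \<alpha> t u) = \<alpha> s y * \<alpha> (s + t) u" for u by (simp add: alpha_mult action_add)
  have "((\<lambda>u. \<alpha> s (y * \<alpha> t u) \<cdot>\<^sub>r p (s + t)) \<longlongrightarrow> \<alpha> s y \<cdot>\<^sub>r p (s + t)) F"
    by (rule tendsto_rmult[OF lim])
  then have "((\<lambda>u. \<alpha> s (y * \<alpha> t u)) \<longlongrightarrow> \<alpha> s y \<cdot>\<^sub>r p (s + t)) F"
    using mult_alpha_carrier[of "\<alpha> s y" "s + t"] by (simp add: eq carrier_Q)
  from tendsto_unique[OF \<open>F \<noteq> bot\<close> this lim] show ?thesis by (simp add: carrier_Q)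
qed

section \<open>Transfer operators and their semi-inner products\<close>

lemma L_linear: "clinear_map (L s)" and L_continuous: "continuous_on UNIV (L s)"
  and L_positive: "cpositive a \<Longrightarrow> cpositive (L s a)"
  using transfer_operator[of s] by (auto simp: transfer_operator_def)

lemmas L_simps = clinear_map_simps[OF L_linear]

lemma tendsto_L: "(f \<longlongrightarrow> a) F \<Longrightarrow> ((\<lambda>x. L s (f x)) \<longlongrightarrow> L s a) F"
  using continuous_on_tendsto_compose[OF L_continuous] by simp

lemma L_star: "L s (star a) = star (L s a)"
proof -
  obtain F :: "'a filter" where "approximate_unit F" using approximate_unit_carrier[of 0] by metis
  then show ?thesis using positive_map_star[OF L_linear L_continuous L_positive] by blast
qed

lemma L_alpha_left: "L s (\<alpha> s a * b) = a * L s b"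
proof -
  obtain T' where "\<forall>a. T' (mult_embed a) = mult_embed (L s a)" "\<forall>a u. L s (\<alpha> s a \<cdot>\<^sub>r u) = a \<cdot>\<^sub>r T' u"
    using transfer_operator[of s] by (auto simp: transfer_operator_def)
  then have "L s (\<alpha> s a \<cdot>\<^sub>r mult_embed b) = a \<cdot>\<^sub>r mult_embed (L s b)" by metis
  then show ?thesis by simp
qed

lemma L_alpha_right: "L s (b * \<alpha> s a) = L s b * a"
proof -
  have "L s (b * \<alpha> s a) = star (L s (star (b * \<alpha> s a)))" by (simp add: L_star star_star)
  also have "\<dots> = star (star a * L s (star b))" by (simp add: star_mult L_alpha_left flip: alpha_star)
  finally show ?thesis by (simp add: star_mult star_star L_star)
qed

lemma pre_bimodule_Q: "pre_bimodule (Q s)"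
proof
  fix x a :: 'a assume "x \<in> carrier (Q s)"
  let ?t = "(norm a)\<^sup>2"
  \<comment> \<open>The estimate
    \<open>star x * star a * a * x \<le> (norm a)^2 (star x * x)\<close> is made in \<open>A\<close>
    and then carried through the positive map \<open>L s\<close>.\<close>
  have "cpositive (L s (?t *\<^sub>R (star x * x) - star x * (star a * a) * x))"
    by (intro L_positive cpositive_conj_bound) (simp_all add: star_mult star_star cstar_identity)
  then have "cpositive (?t *\<^sub>R L s (star x * x) - L s (star (a * x) * (a * x)))"
    by (simp add: L_simps star_mult mult.assoc)
  then have "norm (L s (star (a * x) * (a * x))) \<le> norm (?t *\<^sub>R L s (star x * x))"
    by (intro cpositive_norm_mono L_positive cpositive_star_mult)
  then show "mnorm (Q s) (lact (Q s) a x) \<le> norm a * mnorm (Q s) x"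
    unfolding mnorm_def Q_simps by (intro real_le_lsqrt) (simp_all add: power_mult_distrib)
qed (auto simp: Q_simps carrier_Q rmult_linear mult_rmult alpha_rmult_p scaleC_add_right scaleC_add_left
    scaleC_scaleC alpha_simps alpha_mult mult_scaleC_left mult_scaleC_right L_simps L_alpha_right
    L_star[symmetric] star_mult star_star algebra_simps cpositive_star_mult L_positive
    simp flip: mult.assoc)

sublocale Q: pre_bimodule "Q s" for s
  by (rule pre_bimodule_Q)

lemma mdist_Q: "mdist (Q s) x y = sqrt (norm (L s (star (x - y) * (x - y))))"
  by (simp add: mdist_def Q_simps Let_def)

lemma tendsto_mdist_Q:
  assumes "(f \<longlongrightarrow> x) F"
  shows "((\<lambda>u. mdist (Q s) (f u) x) \<longlongrightarrow> 0) F"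
proof -
  have "((\<lambda>u. star (f u - x) * (f u - x)) \<longlongrightarrow> star (x - x) * (x - x)) F"
    by (intro tendsto_mult tendsto_star tendsto_diff assms tendsto_const)
  from tendsto_real_sqrt[OF tendsto_norm[OF tendsto_L[OF this]]]
  show ?thesis by (simp add: mdist_Q L_simps)
qed

section \<open>Products\<close>

lemma mult_carrier:
  assumes "y \<in> carrier (Q t)"
  shows "x * \<alpha> s y \<in> carrier (Q (s + t))"
  using alpha_carrier[OF assms, of s] by (simp add: carrier_Q mult_rmult)

text \<open>This is where commutativity of \<open>S\<close> enters: \<open>L (s + t) = L t \<circ> L s\<close>.\<close>

lemma ip_mult: "ip (Q (s + t)) (x * \<alpha> s y) (x' * \<alpha> s y') = ip (Q t) y (lact (Q t) (ip (Q s) x x') y')"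
proof -
  have "L (s + t) b = L t (L s b)" for b
    using transfer_add[of t s] by (simp add: add.commute)
  then have "ip (Q (s + t)) (x * \<alpha> s y) (x' * \<alpha> s y') = L t (L s (\<alpha> s (star y) * (star x * x' * \<alpha> s y')))"
    by (simp add: Q_simps star_mult alpha_star mult.assoc)
  also have "\<dots> = L t (star y * (L s (star x * x') * y'))"
    by (simp only: L_alpha_left L_alpha_right)
  finally show ?thesis by (simp add: Q_simps)
qed

lemma norm_ip_lact:
  assumes "y \<in> carrier (Q t)" "y' \<in> carrier (Q t)"
  shows "norm (ip (Q t) y (lact (Q t) b y')) \<le> norm b * (mnorm (Q t) y * mnorm (Q t) y')"
proof -
  have "norm (ip (Q t) y (lact (Q t) b y')) \<le> mnorm (Q t) y * mnorm (Q t) (lact (Q t) b y')"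
    by (intro Q.ip_Cauchy_Schwarz Q.closed assms)
  also have "\<dots> \<le> mnorm (Q t) y * (norm b * mnorm (Q t) y')"
    by (intro mult_left_mono Q.mnorm_lact assms) simp
  finally show ?thesis by (simp add: mult_ac)
qed

lemma mnorm_mult:
  assumes "y \<in> carrier (Q t)"
  shows "mnorm (Q (s + t)) (x * \<alpha> s y) \<le> mnorm (Q s) x * mnorm (Q t) y"
proof -
  have "(mnorm (Q (s + t)) (x * \<alpha> s y))\<^sup>2 \<le> norm (ip (Q s) x x) * (mnorm (Q t) y * mnorm (Q t) y)"
    unfolding mnorm_square ip_mult by (rule norm_ip_lact[OF assms assms])
  also have "\<dots> = (mnorm (Q s) x * mnorm (Q t) y)\<^sup>2"
    by (simp add: power_mult_distrib mnorm_square flip: power2_eq_square)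
  finally show ?thesis by (rule power2_le_imp_le) simp
qed

text \<open>Write the difference as
  \<open>(x - x') * \<alpha> s y + x' * \<alpha> s (y - y')\<close>. Multiplication is thus
  Lipschitz on bounded sets, enough to pass to Cauchy sequences and their classes.\<close>

lemma mdist_mult:
  assumes y: "y \<in> carrier (Q t)" "y' \<in> carrier (Q t)"
  shows "mdist (Q (s + t)) (x * \<alpha> s y) (x' * \<alpha> s y')
    \<le> mnorm (Q t) y * mdist (Q s) x x' + mnorm (Q s) x' * mdist (Q t) y y'"
proof -
  have sub: "msub (Q r) a b = a - b" for r a b by (simp add: msub_def Q_simps)
  have yy: "y - y' \<in> carrier (Q t)" using Q.msub_closed[OF y] by (simp add: sub)
  have "mdist (Q (s + t)) (x * \<alpha> s y) (x' * \<alpha> s y')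
      = mnorm (Q (s + t)) (madd (Q (s + t)) ((x - x') * \<alpha> s y) (x' * \<alpha> s (y - y')))"
    by (simp add: mdist_msub sub Q_simps alpha_simps algebra_simps)
  also have "\<dots> \<le> mnorm (Q (s + t)) ((x - x') * \<alpha> s y) + mnorm (Q (s + t)) (x' * \<alpha> s (y - y'))"
    by (intro Q.mnorm_add mult_carrier y yy)
  also have "\<dots> \<le> mnorm (Q s) (x - x') * mnorm (Q t) y + mnorm (Q s) x' * mnorm (Q t) (y - y')"
    by (intro add_mono mnorm_mult y yy)
  finally show ?thesis by (simp add: mdist_msub sub mult.commute)
qed

lemma mult_cauchy:
  assumes f: "f \<in> cauchy_seqs (Q s)" and g: "g \<in> cauchy_seqs (Q t)"
  shows "(\<lambda>n. f n * \<alpha> s (g n)) \<in> cauchy_seqs (Q (s + t))"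
proof -
  obtain K where K: "0 \<le> K" "\<And>n. mnorm (Q s) (f n) \<le> K" using Q.mnorm_bounded[OF f] by blast
  obtain K' where K': "0 \<le> K'" "\<And>n. mnorm (Q t) (g n) \<le> K'" using Q.mnorm_bounded[OF g] by blast
  show ?thesis
  proof (rule cauchy_seqsI[OF _ f g K'(1) K(1)])
    fix m n
    have "mdist (Q (s + t)) (f m * \<alpha> s (g m)) (f n * \<alpha> s (g n))
      \<le> mnorm (Q t) (g m) * mdist (Q s) (f m) (f n) + mnorm (Q s) (f n) * mdist (Q t) (g m) (g n)"
      by (intro mdist_mult cauchy_seqsD[OF g])
    also have "\<dots> \<le> K' * mdist (Q s) (f m) (f n) + K * mdist (Q t) (g m) (g n)"
      by (intro add_mono mult_right_mono K K') simp_all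
    finally show "mdist (Q (s + t)) (f m * \<alpha> s (g m)) (f n * \<alpha> s (g n))
      \<le> K' * mdist (Q s) (f m) (f n) + K * mdist (Q t) (g m) (g n)" .
  qed (intro mult_carrier cauchy_seqsD[OF g])
qed

lemma cls_mult_cong:
  assumes f: "f \<in> cauchy_seqs (Q s)" "f' \<in> cls (Q s) f" and g: "g \<in> cauchy_seqs (Q t)" "g' \<in> cls (Q t) g"
  shows "cls (Q (s + t)) (\<lambda>n. f' n * \<alpha> s (g' n)) = cls (Q (s + t)) (\<lambda>n. f n * \<alpha> s (g n))"
proof -
  have f': "f' \<in> cauchy_seqs (Q s)" and g': "g' \<in> cauchy_seqs (Q t)"
    using Q.cls_cauchy f(2) g(2) by blast+
  obtain K where K: "0 \<le> K" "\<And>n. mnorm (Q s) (f n) \<le> K" using Q.mnorm_bounded[OF f(1)] by blast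
  obtain K' where K': "0 \<le> K'" "\<And>n. mnorm (Q t) (g' n) \<le> K'" using Q.mnorm_bounded[OF g'] by blast
  show ?thesis
  proof (rule Q.cls_eqI[OF mult_cauchy[OF f' g'] mult_cauchy[OF f(1) g(1)]])
    show "(\<lambda>n. K' * mdist (Q s) (f' n) (f n) + K * mdist (Q t) (g' n) (g n)) \<longlonglongrightarrow> 0"
      by (intro tendsto_add_zero tendsto_mult_right_zero Q.null_distD f g)
    fix n
    have "mdist (Q (s + t)) (f' n * \<alpha> s (g' n)) (f n * \<alpha> s (g n))
      \<le> mnorm (Q t) (g' n) * mdist (Q s) (f' n) (f n) + mnorm (Q s) (f n) * mdist (Q t) (g' n) (g n)"
      by (intro mdist_mult cauchy_seqsD[OF g(1)] cauchy_seqsD[OF g'])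
    also have "\<dots> \<le> K' * mdist (Q s) (f' n) (f n) + K * mdist (Q t) (g' n) (g n)"
      by (intro add_mono mult_right_mono K K') simp_all
    finally show "mdist (Q (s + t)) (f' n * \<alpha> s (g' n)) (f n * \<alpha> s (g n))
      \<le> K' * mdist (Q s) (f' n) (f n) + K * mdist (Q t) (g' n) (g n)" .
  qed
qed

text \<open>Any admissible pair satisfies \<open>a n * \<alpha> s z = (a n \<cdot>\<^sub>r p s) *
  \<alpha> s z\<close>, so the product is computed from representatives of the two classes and the
  union runs over one class only; \<open>a = f\<close> and \<open>b = g\<close> show that it is not
  empty.\<close>

lemma fibre_mult_cls:
  assumes f: "f \<in> cauchy_seqs (Q s)" and g: "g \<in> cauchy_seqs (Q t)"
  shows "fibre_mult \<alpha> L (s, cls (Q s) f) (t, cls (Q t) g) = (s + t, cls (Q (s + t)) (\<lambda>n. f n * \<alpha> s (g n)))"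
proof -
  let ?S = "{cls (Q (s + t)) (\<lambda>n. a n * \<alpha> s (b n \<cdot>\<^sub>r p t)) |a b.
    (\<lambda>n. a n \<cdot>\<^sub>r p s) \<in> cls (Q s) f \<and> (\<lambda>n. b n \<cdot>\<^sub>r p t) \<in> cls (Q t) g}"
  have "cls (Q (s + t)) (\<lambda>n. a n * \<alpha> s (b n \<cdot>\<^sub>r p t)) = cls (Q (s + t)) (\<lambda>n. f n * \<alpha> s (g n))"
    if "(\<lambda>n. a n \<cdot>\<^sub>r p s) \<in> cls (Q s) f" "(\<lambda>n. b n \<cdot>\<^sub>r p t) \<in> cls (Q t) g" for a b
    using cls_mult_cong[OF f that(1) g that(2)] by (simp only: rmult_p_alpha)
  moreover have "(\<lambda>n. f n \<cdot>\<^sub>r p s) = f" "(\<lambda>n. g n \<cdot>\<^sub>r p t) = g"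
    using cauchy_seqsD[OF f] cauchy_seqsD[OF g] by (simp_all add: carrier_Q)
  then have "(\<lambda>n. f n \<cdot>\<^sub>r p s) \<in> cls (Q s) f \<and> (\<lambda>n. g n \<cdot>\<^sub>r p t) \<in> cls (Q t) g"
    using Q.self_in_cls f g by metis
  ultimately have "?S = {cls (Q (s + t)) (\<lambda>n. f n * \<alpha> s (g n))}" by blast
  then show ?thesis unfolding fibre_mult_def prod.case by simp
qed

section \<open>The product system\<close>

abbreviation "X s \<equiv> fibre \<alpha> L s"

lemma complete_bimodule_fibre: "complete_bimodule (X s)"
  unfolding fibre_def by (intro complete_bimodule_tagged Q.complete_bimodule_completion)

sublocale X: complete_bimodule "X s" for s
  by (rule complete_bimodule_fibre)

lemma mdist_fibre_commute: "mdist (X s) x y = mdist (X s) y x"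
  unfolding fibre_def mdist_tagged
proof (rule Q.mdist_completion_commute)
  fix x y assume "madd (Q s) x y \<in> carrier (Q s)" "y \<in> carrier (Q s)"
  then show "x \<in> carrier (Q s)" by (simp add: carrier_Q Q_simps rmult_linear)
next
  fix x assume "mscale (Q s) (- 1) x \<in> carrier (Q s)"
  then have "(- 1) *\<^sub>C (x \<cdot>\<^sub>r p s) = (- 1) *\<^sub>C x"
    by (simp only: carrier_Q Q_simps rmult_linear mem_Collect_eq)
  then show "x \<in> carrier (Q s)" by (simp add: carrier_Q)
qed

lemma carrier_fibre: "carrier (X s) = {(s, cls (Q s) f) |f. f \<in> cauchy_seqs (Q s)}"
  by (auto simp: fibre_def tagged_def Q.carrier_completion)

lemma fibre_simps:
  assumes f: "f \<in> cauchy_seqs (Q s)"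
  shows "mscale (X s) c (s, cls (Q s) f) = (s, cls (Q s) (\<lambda>n. c *\<^sub>C f n))"
    "ract (X s) (s, cls (Q s) f) a = (s, cls (Q s) (\<lambda>n. f n * \<alpha> s a))"
    "lact (X s) a (s, cls (Q s) f) = (s, cls (Q s) (\<lambda>n. a * f n))"
  using Q.mscale_completion[OF f] Q.ract_completion[OF f] Q.lact_completion[OF f]
  by (simp_all add: fibre_def tagged_def Q_simps)

lemma ip_fibre:
  assumes "f \<in> cauchy_seqs (Q s)" "g \<in> cauchy_seqs (Q s)" "(\<lambda>n. ip (Q s) (f n) (g n)) \<longlonglongrightarrow> c"
  shows "ip (X s) (s, cls (Q s) f) (s, cls (Q s) g) = c"
  using Q.ip_completion_eqI[OF assms] by (simp add: fibre_def tagged_def)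

lemma Q_cauchy:
  assumes f: "f \<in> cauchy_seqs (Q s)"
  shows "(\<lambda>n. c *\<^sub>C f n) \<in> cauchy_seqs (Q s)" "(\<lambda>n. f n * \<alpha> s a) \<in> cauchy_seqs (Q s)"
    "(\<lambda>n. a * f n) \<in> cauchy_seqs (Q s)"
  using Q.scale_cauchy[OF f] Q.ract_cauchy[OF f] Q.lact_cauchy[OF f] by (simp_all add: Q_simps)

lemma fibreE:
  assumes "x \<in> carrier (X s)"
  obtains f where "f \<in> cauchy_seqs (Q s)" "x = (s, cls (Q s) f)"
  using assms by (auto simp: carrier_fibre)

lemma dense_fibre:
  assumes "x \<in> carrier (X s)" "e > 0"
  shows "\<exists>z\<in>carrier (Q s). mdist (X s) x (s, cls (Q s) (\<lambda>n. z)) \<le> e"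
  using Q.dense_completion[of "snd x" s e] assms by (auto simp: fibre_def tagged_def mdist_tagged[unfolded tagged_def])

lemma mdist_fibre_const:
  "\<lbrakk>x \<in> carrier (Q s); y \<in> carrier (Q s)\<rbrakk>
    \<Longrightarrow> mdist (X s) (s, cls (Q s) (\<lambda>n. x)) (s, cls (Q s) (\<lambda>n. y)) = mdist (Q s) x y"
  by (simp add: fibre_def mdist_tagged Q.mdist_cls_const)

lemma const_fibre: "x \<in> carrier (Q s) \<Longrightarrow> (s, cls (Q s) (\<lambda>n. x)) \<in> carrier (X s)"
  using Q.const_cauchy by (auto simp: carrier_fibre)

text \<open>The identity \<open>ip_mult\<close> holds for each \<open>n\<close>, but with a
  coefficient \<open>ip (Q s) (f n) (f' n)\<close> that moves with \<open>n\<close>. Replacing it by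
  its limit \<open>b\<close> costs at most its distance to \<open>b\<close> times
  \<open>K * K'\<close>, which tends to zero.\<close>

lemma ip_fibre_mult:
  assumes f: "f \<in> cauchy_seqs (Q s)" and g: "g \<in> cauchy_seqs (Q t)"
    and f': "f' \<in> cauchy_seqs (Q s)" and g': "g' \<in> cauchy_seqs (Q t)"
  shows "ip (X (s + t)) (fibre_mult \<alpha> L (s, cls (Q s) f) (t, cls (Q t) g))
      (fibre_mult \<alpha> L (s, cls (Q s) f') (t, cls (Q t) g'))
    = ip (X t) (t, cls (Q t) g)
        (lact (X t) (ip (X s) (s, cls (Q s) f) (s, cls (Q s) f')) (t, cls (Q t) g'))"
proof -
  define b where "b = ip (X s) (s, cls (Q s) f) (s, cls (Q s) f')"
  have b: "(\<lambda>n. ip (Q s) (f n) (f' n)) \<longlonglongrightarrow> b"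
    using Q.ip_completion[OF f f'] by (simp add: b_def fibre_def tagged_def)
  define c where "c = ip (X t) (t, cls (Q t) g) (lact (X t) b (t, cls (Q t) g'))"
  have c: "(\<lambda>n. ip (Q t) (g n) (b * g' n)) \<longlonglongrightarrow> c"
    using Q.ip_completion[OF g Q_cauchy(3)[OF g']] by (simp add: c_def fibre_simps g') (simp add: fibre_def tagged_def)
  obtain K where K: "0 \<le> K" "\<And>n. mnorm (Q t) (g n) \<le> K" using Q.mnorm_bounded[OF g] by blast
  obtain K' where K': "0 \<le> K'" "\<And>n. mnorm (Q t) (g' n) \<le> K'" using Q.mnorm_bounded[OF g'] by blast
  have "(\<lambda>n. norm (ip (Q s) (f n) (f' n) - b) * (K * K')) \<longlonglongrightarrow> 0"
    using tendsto_mult_left_zero[OF tendsto_norm_zero[OF LIM_zero[OF b]]] .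
  then have "(\<lambda>n. norm (ip (Q t) (g n) (ip (Q s) (f n) (f' n) * g' n) - ip (Q t) (g n) (b * g' n))) \<longlonglongrightarrow> 0"
  proof (rule tendsto_zero_sandwich)
    fix n
    have "norm (ip (Q t) (g n) (ip (Q s) (f n) (f' n) * g' n) - ip (Q t) (g n) (b * g' n))
      = norm (ip (Q t) (g n) (lact (Q t) (ip (Q s) (f n) (f' n) - b) (g' n)))"
      by (simp add: Q_simps L_simps algebra_simps)
    also have "\<dots> \<le> norm (ip (Q s) (f n) (f' n) - b) * (mnorm (Q t) (g n) * mnorm (Q t) (g' n))"
      by (intro norm_ip_lact cauchy_seqsD[OF g] cauchy_seqsD[OF g'])
    also have "\<dots> \<le> norm (ip (Q s) (f n) (f' n) - b) * (K * K')"
      by (intro mult_left_mono mult_mono K K') simp_all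
    finally show "norm (ip (Q t) (g n) (ip (Q s) (f n) (f' n) * g' n) - ip (Q t) (g n) (b * g' n))
      \<le> norm (ip (Q s) (f n) (f' n) - b) * (K * K')" .
  qed simp
  from tendsto_add[OF tendsto_norm_zero_cancel[OF this] c]
  have "(\<lambda>n. ip (Q (s + t)) (f n * \<alpha> s (g n)) (f' n * \<alpha> s (g' n))) \<longlonglongrightarrow> c"
    by (simp only: ip_mult Q_simps(5)) simp
  then show ?thesis
    unfolding b_def[symmetric] c_def[symmetric] fibre_mult_cls[OF f g] fibre_mult_cls[OF f' g']
    by (intro ip_fibre mult_cauchy f g f' g')
qed

lemma dense_products:
  assumes z: "z \<in> carrier (X (s + t))" and e: "e > 0"
  shows "\<exists>x\<in>carrier (X s). \<exists>y\<in>carrier (X t). mdist (X (s + t)) (fibre_mult \<alpha> L x y) z \<le> e"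
proof -
  obtain z0 where z0: "z0 \<in> carrier (Q (s + t))" "mdist (X (s + t)) z (s + t, cls (Q (s + t)) (\<lambda>n. z0)) \<le> e / 2"
    using dense_fibre[OF z, of "e / 2"] e by auto
  obtain F where F: "approximate_unit F" "((\<lambda>u. z0 * \<alpha> (s + t) u) \<longlongrightarrow> z0) F"
    using approximate_unit_carrier[of "s + t"] z0(1) by metis
  have "\<forall>\<^sub>F u in F. mdist (Q (s + t)) (z0 * \<alpha> (s + t) u) z0 < e / 2"
    using order_tendstoD(2)[OF tendsto_mdist_Q[OF F(2)], of "e / 2"] e by simp
  then obtain u where u: "mdist (Q (s + t)) (z0 * \<alpha> (s + t) u) z0 < e / 2"
    using F(1) eventually_happens' unfolding approximate_unit_def by blast
  \<comment> \<open>Right multiplication by \<open>p s\<close> puts \<open>z0\<close> into the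
    carrier at \<open>s\<close> and is absorbed by \<open>\<alpha> s\<close> in the product.\<close>
  define x y where "x = z0 \<cdot>\<^sub>r p s" and "y = \<alpha> t u"
  have x: "x \<in> carrier (Q s)"
    by (simp add: x_def carrier_Q p_idem flip: rmult_simps(4))
  have y: "y \<in> carrier (Q t)" by (simp add: y_def carrier_Q alpha_rmult_p)
  have xy: "x * \<alpha> s y = z0 * \<alpha> (s + t) u"
    by (simp add: x_def y_def rmult_p_alpha action_add)
  have prod: "fibre_mult \<alpha> L (s, cls (Q s) (\<lambda>n. x)) (t, cls (Q t) (\<lambda>n. y))
      = (s + t, cls (Q (s + t)) (\<lambda>n. x * \<alpha> s y))"
    by (rule fibre_mult_cls[OF Q.const_cauchy[OF x] Q.const_cauchy[OF y]])
  have "mdist (X (s + t)) (s + t, cls (Q (s + t)) (\<lambda>n. x * \<alpha> s y)) z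
      \<le> mdist (X (s + t)) (s + t, cls (Q (s + t)) (\<lambda>n. x * \<alpha> s y)) (s + t, cls (Q (s + t)) (\<lambda>n. z0))
        + mdist (X (s + t)) (s + t, cls (Q (s + t)) (\<lambda>n. z0)) z"
    by (intro X.mdist_triangle const_fibre mult_carrier y z0 z)
  also have "\<dots> \<le> e / 2 + e / 2"
    using u z0(2) by (intro add_mono)
      (simp_all add: mdist_fibre_const mult_carrier y z0(1) xy mult_alpha_carrier mdist_fibre_commute[of _ _ z])
  finally show ?thesis
    using const_fibre[OF x] const_fibre[OF y] prod by (intro bexI) auto
qed

lemma fibre_tensor:
  "\<exists>h. bimodule_iso (internal_tensor (X s) (X t)) (X (s + t)) h \<and>
    (\<forall>x\<in>carrier (X s). \<forall>y\<in>carrier (X t). h (simple_tensor (X s) (X t) x y) = fibre_mult \<alpha> L x y)"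
proof (rule X.internal_tensor_iso)
  show "pre_bimodule (X s)" "pre_bimodule (X t)" by unfold_locales
next
  fix x y a and c :: complex assume x: "x \<in> carrier (X s)" and y: "y \<in> carrier (X t)"
  obtain f where f: "f \<in> cauchy_seqs (Q s)" "x = (s, cls (Q s) f)" using x by (rule fibreE)
  obtain g where g: "g \<in> cauchy_seqs (Q t)" "y = (t, cls (Q t) g)" using y by (rule fibreE)
  note fg = mult_cauchy[OF f(1) g(1)]
  show "fibre_mult \<alpha> L x y \<in> carrier (X (s + t))"
    using fg by (auto simp: f g fibre_mult_cls carrier_fibre)
  show "fibre_mult \<alpha> L (mscale (X s) c x) y = mscale (X (s + t)) c (fibre_mult \<alpha> L x y)"
    using fg by (simp add: f g fibre_mult_cls fibre_simps Q_cauchy mult_scaleC_left)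
  show "fibre_mult \<alpha> L x (ract (X t) y a) = ract (X (s + t)) (fibre_mult \<alpha> L x y) a"
    using fg by (simp add: f g fibre_mult_cls fibre_simps Q_cauchy alpha_mult action_add mult.assoc)
  show "fibre_mult \<alpha> L (lact (X s) a x) y = lact (X (s + t)) a (fibre_mult \<alpha> L x y)"
    using fg by (simp add: f g fibre_mult_cls fibre_simps Q_cauchy mult.assoc)
next
  fix x y x' y'
  assume "x \<in> carrier (X s)" "y \<in> carrier (X t)" "x' \<in> carrier (X s)" "y' \<in> carrier (X t)"
  then obtain f g f' g' where "f \<in> cauchy_seqs (Q s)" "x = (s, cls (Q s) f)"
    "g \<in> cauchy_seqs (Q t)" "y = (t, cls (Q t) g)" "f' \<in> cauchy_seqs (Q s)" "x' = (s, cls (Q s) f')"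
    "g' \<in> cauchy_seqs (Q t)" "y' = (t, cls (Q t) g')"
    by (auto simp: carrier_fibre)
  then show "ip (X (s + t)) (fibre_mult \<alpha> L x y) (fibre_mult \<alpha> L x' y') = ip (X t) y (lact (X t) (ip (X s) x x') y')"
    by (simp only: ip_fibre_mult)
qed (rule dense_products)

section \<open>The fibre at \<open>0\<close>, the axioms, and essentiality\<close>

lemma complete_bimodule_identity: "complete_bimodule (identity_bimodule :: ('a, 'a) bimodule)"
proof -
  have norm: "mnorm identity_bimodule x = norm x" for x :: 'a
    by (simp add: mnorm_def identity_bimodule_def cstar_identity)
  have dist: "mdist identity_bimodule x y = dist x y" for x y :: 'a
    unfolding mdist_msub norm by (simp add: msub_def identity_bimodule_def dist_norm)
  show ?thesis
  proof
    fix \<sigma> :: "nat \<Rightarrow> 'a" assume "\<sigma> \<in> cauchy_seqs identity_bimodule"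
    then have "Cauchy \<sigma>" by (auto simp: cauchy_seqs_def dist Cauchy_def)
    then obtain x where "\<sigma> \<longlonglongrightarrow> x" by (meson Cauchy_convergent_iff convergent_def)
    then show "\<exists>x\<in>carrier identity_bimodule. (\<lambda>n. mdist identity_bimodule (\<sigma> n) x) \<longlonglongrightarrow> 0"
      unfolding dist by (intro bexI[of _ x]) (simp_all add: identity_bimodule_def flip: tendsto_dist_iff)
  next
    fix x :: 'a assume "ip identity_bimodule x x = 0"
    then show "x = mzero identity_bimodule"
      using cstar_identity[of x] by (simp add: identity_bimodule_def)
  next
    fix x a :: 'a
    show "mnorm identity_bimodule (lact identity_bimodule a x) \<le> norm a * mnorm identity_bimodule x"
      unfolding norm by (simp add: identity_bimodule_def norm_mult_ineq)
  qed (auto simp: identity_bimodule_def scaleC_add_right scaleC_add_left scaleC_scaleC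
      mult_scaleC_left mult_scaleC_right star_mult star_star algebra_simps cpositive_star_mult)
qed

text \<open>With \<open>\<alpha> 0\<close> and \<open>L 0\<close> both the identity,
  \<open>Q 0\<close> is \<open>A\<close> with its standard inner product. This is already complete,
  so the constant sequences exhaust the classes.\<close>

lemma unit_fibre: "bimodule_iso identity_bimodule (X 0) (fibre_unit \<alpha> L)"
proof -
  interpret I: complete_bimodule "identity_bimodule :: ('a, 'a) bimodule"
    by (rule complete_bimodule_identity)
  have carrier: "carrier (Q 0) = UNIV"
    using alpha_rmult_p[of 0] by (auto simp: carrier_Q action_zero)
  have "\<exists>h. bimodule_iso (completion (Q 0)) identity_bimodule h \<and> (\<forall>x\<in>carrier (Q 0). h (cls (Q 0) (\<lambda>n. x)) = x)"
  proof (rule I.completion_iso)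
    fix y :: 'a and e :: real assume "y \<in> carrier identity_bimodule" "e > 0"
    then show "\<exists>x\<in>carrier (Q 0). mdist identity_bimodule x y \<le> e"
      by (intro bexI[of _ y]) (simp_all add: I.mdist_self carrier)
  qed (simp_all add: carrier Q_simps action_zero transfer_zero identity_bimodule_def)
  then obtain h where h: "bimodule_iso (completion (Q 0)) identity_bimodule h" "\<And>x. h (cls (Q 0) (\<lambda>n. x)) = x"
    by (auto simp: carrier)
  have "bimodule_iso (X 0) identity_bimodule (h \<circ> snd)"
  proof -
    have "bij_betw snd ({0} \<times> carrier (completion (Q 0))) (carrier (completion (Q 0)))"
      by (rule bij_betw_byWitness[where f' = "Pair 0"]) auto
    then have "bij_betw (h \<circ> snd) ({0} \<times> carrier (completion (Q 0))) (carrier identity_bimodule)"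
      using h(1) by (intro bij_betw_trans) (auto simp: bimodule_iso_def)
    with h(1) show ?thesis by (simp add: bimodule_iso_def fibre_def tagged_def)
  qed
  then show ?thesis
  proof (rule bimodule_iso_inv[rotated])
    fix a :: 'a
    show "fibre_unit \<alpha> L a \<in> carrier (X 0) \<and> (h \<circ> snd) (fibre_unit \<alpha> L a) = a"
      using const_fibre[of a 0] by (simp add: fibre_unit_def h carrier)
  qed unfold_locales
qed

text \<open>The algebraic axioms are checked on representatives, term by term: associativity is
  \<open>f * \<alpha> r g * \<alpha> (r + s) h = f * \<alpha> r (g * \<alpha> s h)\<close>, and the
  projection is the tag \<open>fst\<close>.\<close>

lemma product_system_fibre: "product_system (fibre \<alpha> L) (fibre_mult \<alpha> L) (fibre_unit \<alpha> L)"
proof (rule product_system.intro)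
  fix s show "hilbert_bimodule (X s)"
    by (rule X.hilbert_bimodule) (rule mdist_fibre_commute)
next
  fix x y assume "x \<in> (\<Union>s. carrier (X s))" "y \<in> (\<Union>s. carrier (X s))"
  then obtain s t f g where "f \<in> cauchy_seqs (Q s)" "x = (s, cls (Q s) f)" "g \<in> cauchy_seqs (Q t)" "y = (t, cls (Q t) g)"
    by (auto simp: carrier_fibre)
  with mult_cauchy[of f s g t] show "fibre_mult \<alpha> L x y \<in> (\<Union>s. carrier (X s))"
    by (auto simp: fibre_mult_cls carrier_fibre)
next
  fix x y z assume "x \<in> (\<Union>s. carrier (X s))" "y \<in> (\<Union>s. carrier (X s))" "z \<in> (\<Union>s. carrier (X s))"
  then obtain r s t f g h where fgh: "f \<in> cauchy_seqs (Q r)" "x = (r, cls (Q r) f)"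
    "g \<in> cauchy_seqs (Q s)" "y = (s, cls (Q s) g)" "h \<in> cauchy_seqs (Q t)" "z = (t, cls (Q t) h)"
    by (auto simp: carrier_fibre)
  with mult_cauchy[of f r g s] mult_cauchy[of g s h t]
  show "fibre_mult \<alpha> L (fibre_mult \<alpha> L x y) z = fibre_mult \<alpha> L x (fibre_mult \<alpha> L y z)"
    by (simp add: fibre_mult_cls alpha_mult action_add mult.assoc add.assoc)
next
  have "fst (fibre_mult \<alpha> L x y) = fst x + fst y" for x y
    by (simp add: fibre_mult_def split: prod.splits)
  then show "\<exists>p. (\<forall>x\<in>\<Union>s. carrier (X s). \<forall>y\<in>\<Union>s. carrier (X s). p (fibre_mult \<alpha> L x y) = p x + p y) \<and>
      (\<forall>s. {x \<in> \<Union>s. carrier (X s). p x = s} = carrier (X s))"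
    by (intro exI[of _ fst]) (auto simp: carrier_fibre)
next
  fix s x a assume "x \<in> carrier (X s)"
  then obtain f where f: "f \<in> cauchy_seqs (Q s)" "x = (s, cls (Q s) f)" by (rule fibreE)
  have "a \<in> carrier (Q 0)" using alpha_rmult_p[of 0 a] by (simp add: carrier_Q action_zero)
  then have a: "(\<lambda>n. a) \<in> cauchy_seqs (Q 0)" by (rule Q.const_cauchy)
  show "fibre_mult \<alpha> L (fibre_unit \<alpha> L a) x = lact (X s) a x"
    using fibre_mult_cls[OF a f(1)] f by (simp add: fibre_unit_def fibre_simps action_zero)
  show "fibre_mult \<alpha> L x (fibre_unit \<alpha> L a) = ract (X s) x a"
    using fibre_mult_cls[OF f(1) a] f by (simp add: fibre_unit_def fibre_simps)
qed (rule fibre_tensor unit_fibre)+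

lemma essential_fibre: "essential (X s)"
proof -
  interpret S: Metric_space "carrier (X s)" "mdist (X s)"
    by (rule X.Metric_space_mdist) (rule mdist_fibre_commute)
  have "\<exists>y\<in>module_span (X s) {lact (X s) a x |a x. x \<in> carrier (X s)}. y \<in> S.mball x r"
    if x: "x \<in> carrier (X s)" and r: "r > 0" for x r
  proof -
    obtain z where z: "z \<in> carrier (Q s)" "mdist (X s) x (s, cls (Q s) (\<lambda>n. z)) \<le> r / 2"
      using dense_fibre[OF x, of "r / 2"] r by auto
    \<comment> \<open>The approximate unit acts on the left here, so the index at which it is
      obtained does not matter.\<close>
    obtain F :: "'a filter" where F: "approximate_unit F" using approximate_unit_carrier[of 0] by metis
    then have "((\<lambda>u. u * z) \<longlongrightarrow> z) F" by (simp add: approximate_unit_def)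
    then have "\<forall>\<^sub>F u in F. mdist (Q s) (u * z) z < r / 2"
      using order_tendstoD(2)[OF tendsto_mdist_Q, of _ z F "r / 2" s] r by simp
    then obtain u where u: "mdist (Q s) (u * z) z < r / 2"
      using F eventually_happens' unfolding approximate_unit_def by blast
    define y where "y = lact (X s) u (s, cls (Q s) (\<lambda>n. z))"
    have yc: "y \<in> carrier (X s)" unfolding y_def by (intro X.lact_closed const_fibre z)
    have y: "y = (s, cls (Q s) (\<lambda>n. u * z))"
      by (simp add: y_def fibre_simps Q.const_cauchy z)
    have uz: "u * z \<in> carrier (Q s)" using z by (simp add: carrier_Q mult_rmult)
    have "mdist (X s) x y \<le> mdist (X s) x (s, cls (Q s) (\<lambda>n. z)) + mdist (X s) (s, cls (Q s) (\<lambda>n. z)) y"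
      by (intro X.mdist_triangle x yc const_fibre z)
    also have "mdist (X s) (s, cls (Q s) (\<lambda>n. z)) y = mdist (Q s) (u * z) z"
      unfolding y by (subst mdist_fibre_commute) (simp add: mdist_fibre_const uz z)
    finally have "mdist (X s) x y < r" using z(2) u by simp
    moreover have "y \<in> module_span (X s) {lact (X s) a x |a x. x \<in> carrier (X s)}"
      unfolding y_def using const_fibre[OF z(1)] by (blast intro: span_base)
    ultimately show ?thesis using x yc by (auto simp: S.in_mball)
  qed
  then show ?thesis unfolding essential_def S.metric_closure_of by blast
qed

end

theorem proposition2p1:
  fixes \<alpha> :: "'s::{comm_monoid_add, countable} \<Rightarrow> 'a::cstar_algebra \<Rightarrow> 'a"
    and L :: "'s \<Rightarrow> 'a \<Rightarrow> 'a"
  assumes "transfer_system \<alpha> L"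
  shows "product_system (fibre \<alpha> L) (fibre_mult \<alpha> L) (fibre_unit \<alpha> L) \<and>
    (\<forall>s. essential (fibre \<alpha> L s))"
proof -
  interpret transfer_system \<alpha> L by (rule assms)
  show ?thesis using product_system_fibre essential_fibre by blast
qed

end
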